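(* Suppose $Y$ has dynamics $$dY_t=-f(\omega,t,Y_{t-},Z_t)\,dt+Z_t^*\,dM_t$$ and satisfies the two conditions (a) and (b) given in the context (which are equivalent to one another), with associated functions $u$ and $\tilde f$; in particular $Y_t=u(t,X_t)$. Write $\mathbf{u}_t$ for the column vector with elements $u(t,e_i)$, and $\mathbf{f}(t,\mathbf{u}_t)$ for the column vector with elements $e_i^*\mathbf{f}(t,\mathbf{u}_t):=\tilde f(e_i,t,e_i^*\mathbf{u}_t,\mathbf{u}_t)$. Then $\mathbf{u}$ satisfies the vector ordinary differential equation $$d\mathbf{u}_t=-\big(\mathbf{f}(t,\mathbf{u}_t)+A_t^*\mathbf{u}_t\big)\,dt .$$
   Context: $X$ is a continuous-time finite-state Markov chain on a probability space $(\Omega,\mathbb{P})$, a right-continuous pure jump process taking values in the standard basis vectors $e_1,\dots,e_N$ of $\mathbb{R}^N$, with $X_0$ deterministic. $[\cdot]^*$ denotes transposition. $\{\mathcal{F}_t\}$ is the completion of the filtration generated by $X$. $A_t$ is the rate matrix, deterministic and possibly varying in time: $(A_t)_{ij}$ is the rate of jumping from state $j$ to state $i$, so $(A_t)_{ij}\ge 0$ for $i\ne j$ and every column of $A_t$ sums to $0$; all components of $A$ are uniformly bounded in time. It is assumed that $\mathbb{P}(X_t=e_i)>0$ for every $t>0$ and every $i$. $M$ is the $\mathbb{R}^N$-valued locally-finite-variation pure-jump martingale defined by $X_t=X_0+\int_{]0,t]}A_uX_{u-}\,du+M_t$. For $z\in\mathbb{R}^N$ put $\|z\|_{M_t}^2=z^*\frac{d\langle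 M,M\rangle_t}{dt}z$, where $\frac{d\langle M,M\rangle_t}{dt}=\mathrm{diag}(A_tX_{t-})-A_t\,\mathrm{diag}(X_{t-})-\mathrm{diag}(X_{t-})A_t^*$. For predictable $\mathbb{R}^N$-valued processes, $Z\sim_M Z'$ means $\|Z_t-Z'_t\|_{M_t}=0$ $dt\times d\mathbb{P}$-a.s. In the equation, $f:\Omega\times\mathbb{R}^+\times\mathbb{R}\times\mathbb{R}^N\to\mathbb{R}$ is progressively measurable, $Y$ is a real adapted process with $E[\sup_{t<T}Y_t^2]<\infty$ for all $T$, and $Z$ is predictable with values in $\mathbb{R}^N$. Standing assumptions on $f$: if $Z\sim_M Z'$ then $f(\omega,t,y,Z)=f(\omega,t,y,Z')$ up to indistinguishability; and $f$ satisfies sufficient conditions for the equation of interest to have a unique solution. The conditions on $Y$ are: (a) $Y_t=u(t,X_t)$, up to indistinguishability, for some function $u:\mathbb{R}^+\times\mathbb{R}^N\to\mathbb{R}$; (b) $f(\omega,t,Y_t,Z_t)=\tilde f(X_t,t,Y_t,Z_t)$ $\mathbb{P}\times dt$-a.e. for some function $\tilde f:\mathbb{R}^N\times\mathbb{R}^+\times\mathbb{R}\times\mathbb{R}^N\to\mathbb{R}$ and, up to $\sim_M$ equivalence, $Z_t$ is a deterministic function of $t$ satisfying $X_0^*Z_0=Y_0$ and $\frac{d(e_i^*Z_t)}{dt}=-\tilde f(e_i,t,e_i^*Z_t,Z_t)-Z_t^*A_te_i$ for all $i$. Conditions (a) and (b) are equivalent, and under either of them $e_i^*Z_t=u(t,e_i)$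 up to equivalence $\sim_M$.
   Formalization: In (b), f = f̃ along Y is required for every predictable representative of Z up to ~_M, since with Z alone the claim fails; for states other than X_0 the ODE holds for t>0 only, as u(0,e_i) is then undetermined; the ODEs are in integrated form. *)

theory Defs
  imports "HOL-Probability.Probability"
begin

text \<open>
  Time is \<open>real\<close>, and only times \<open>t \<ge> 0\<close> matter. Chain and solution processes have type
  \<open>real \<Rightarrow> 'a \<Rightarrow> _\<close>; the driver is \<open>f \<omega> t y z\<close>. The state space is the set of vectors
  \<open>axis i 1\<close> of \<open>real ^ 'n\<close>. Time integrals are over closed intervals and are Lebesgue
  integrals (\<open>absolutely_integrable_on\<close> is always required alongside).
\<close>

definition left_lim :: "(real \<Rightarrow> 'b::t2_space) \<Rightarrow> real \<Rightarrow> 'b" where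
  "left_lim g t = Lim (at_left t) g"

text \<open>The completed filtration generated by \<open>X\<close>.\<close>

definition chain_filtration ::
    "'a measure \<Rightarrow> (real \<Rightarrow> 'a \<Rightarrow> real ^ 'n) \<Rightarrow> real \<Rightarrow> 'a measure" where
  "chain_filtration P X t = sigma (space P)
     ({X s -` B \<inter> space P | s B. 0 \<le> s \<and> s \<le> t \<and> B \<in> sets borel} \<union> null_sets (completion P))"

text \<open>
  \<open>A t $ i $ j\<close> is the rate of jumping from state \<open>j\<close> to state \<open>i\<close>. Since \<open>A\<close> is only bounded
  and measurable in time, rates are expressed through the integrated forward equation of the
  transition matrices: \<open>p s t $ i $ j\<close> is the probability of being in state \<open>i\<close> at time \<open>t\<close>
  given state \<open>j\<close> at time \<open>s\<close>. As \<open>X\<close> takes values in the basis vectors, \<open>X t \<omega> $ i\<close> is the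
  indicator of \<open>X t \<omega> = axis i 1\<close>. A path which takes values in the basis vectors,
  is right-continuous and has left limits has finitely many jumps on bounded intervals and is
  constant between them.
\<close>

locale rate_markov_chain = prob_space P
  for P :: "'a measure" +
  fixes X :: "real \<Rightarrow> 'a \<Rightarrow> real ^ 'n"
    and A :: "real \<Rightarrow> real ^ 'n ^ 'n"
    and i0 :: 'n
  assumes X_measurable: "0 \<le> t \<Longrightarrow> X t \<in> borel_measurable P"
    and X_basis: "0 \<le> t \<Longrightarrow> \<omega> \<in> space P \<Longrightarrow> \<exists>i. X t \<omega> = axis i 1"
    and X_start: "\<omega> \<in> space P \<Longrightarrow> X 0 \<omega> = axis i0 1"
    and X_right_cont: "0 \<le> t \<Longrightarrow> \<omega> \<in> space P \<Longrightarrow> continuous (at_right t) (\<lambda>s. X s \<omega>)"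
    and X_left_lim: "0 < t \<Longrightarrow> \<omega> \<in> space P \<Longrightarrow> \<exists>l. ((\<lambda>s. X s \<omega>) \<longlongrightarrow> l) (at_left t)"
    and A_measurable: "A \<in> borel_measurable (restrict_space borel {0..})"
    and A_nonneg: "0 \<le> t \<Longrightarrow> i \<noteq> j \<Longrightarrow> 0 \<le> A t $ i $ j"
    and A_column_sum: "0 \<le> t \<Longrightarrow> (\<Sum>i\<in>UNIV. A t $ i $ j) = 0"
    and A_bounded: "\<exists>K. \<forall>t\<ge>0. \<forall>i j. \<bar>A t $ i $ j\<bar> \<le> K"
    and markov_rates: "\<exists>p :: real \<Rightarrow> real \<Rightarrow> real ^ 'n ^ 'n.
      (\<forall>s t i. 0 \<le> s \<and> s \<le> t \<longrightarrow>
         (AE \<omega> in completion P.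
            real_cond_exp (completion P) (chain_filtration P X s) (\<lambda>\<omega>. X t \<omega> $ i) \<omega>
              = (p s t *v X s \<omega>) $ i)) \<and>
      (\<forall>s t. 0 \<le> s \<and> s \<le> t \<longrightarrow>
         (\<lambda>r. A r ** p s r) absolutely_integrable_on {s..t} \<and>
         p s t = mat 1 + integral {s..t} (\<lambda>r. A r ** p s r))"

definition mart_part ::
    "(real \<Rightarrow> real ^ 'n ^ 'n) \<Rightarrow> (real \<Rightarrow> 'a \<Rightarrow> real ^ 'n) \<Rightarrow> real \<Rightarrow> 'a \<Rightarrow> real ^ 'n" where
  "mart_part A X t \<omega> =
     X t \<omega> - X 0 \<omega> - integral {0..t} (\<lambda>s. A s *v left_lim (\<lambda>r. X r \<omega>) s)"

definition mart_jump ::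
    "(real \<Rightarrow> real ^ 'n ^ 'n) \<Rightarrow> (real \<Rightarrow> 'a \<Rightarrow> real ^ 'n) \<Rightarrow> real \<Rightarrow> 'a \<Rightarrow> real ^ 'n" where
  "mart_jump A X t \<omega> = mart_part A X t \<omega> - left_lim (\<lambda>r. mart_part A X r \<omega>) t"

text \<open>
  The integral of \<open>Z\<close> against \<open>M = mart_part A X\<close> over \<open>{0<..t}\<close> is the pathwise
  Lebesgue-Stieltjes integral. The measure \<open>dM\<close> consists of an atom of mass
  \<open>mart_jump A X s \<omega>\<close> at each of the finitely many jump times \<open>s\<close> in \<open>{0<..t}\<close> and of the
  density \<open>- A s *v X\<^bsub>s-\<^esub>\<close> with respect to Lebesgue measure; the integral therefore
  exists iff the integral against the density does.
\<close>

definition mart_integrable ::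
    "(real \<Rightarrow> real ^ 'n ^ 'n) \<Rightarrow> (real \<Rightarrow> 'a \<Rightarrow> real ^ 'n) \<Rightarrow> (real \<Rightarrow> 'a \<Rightarrow> real ^ 'n)
      \<Rightarrow> real \<Rightarrow> 'a \<Rightarrow> bool" where
  "mart_integrable A X Z t \<omega> \<longleftrightarrow>
     (\<lambda>s. Z s \<omega> \<bullet> (A s *v left_lim (\<lambda>r. X r \<omega>) s)) absolutely_integrable_on {0..t}"

definition mart_integral ::
    "(real \<Rightarrow> real ^ 'n ^ 'n) \<Rightarrow> (real \<Rightarrow> 'a \<Rightarrow> real ^ 'n) \<Rightarrow> (real \<Rightarrow> 'a \<Rightarrow> real ^ 'n)
      \<Rightarrow> real \<Rightarrow> 'a \<Rightarrow> real" where
  "mart_integral A X Z t \<omega> =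
     (\<Sum>s\<in>{s \<in> {0<..t}. mart_jump A X s \<omega> \<noteq> 0}. Z s \<omega> \<bullet> mart_jump A X s \<omega>)
     - integral {0..t} (\<lambda>s. Z s \<omega> \<bullet> (A s *v left_lim (\<lambda>r. X r \<omega>) s))"

definition diag_mat :: "real ^ 'n \<Rightarrow> real ^ 'n ^ 'n" where
  "diag_mat v = (\<chi> i j. if i = j then v $ i else 0)"

definition bracket_density :: "real ^ 'n ^ 'n \<Rightarrow> real ^ 'n \<Rightarrow> real ^ 'n ^ 'n" where
  "bracket_density B x = diag_mat (B *v x) - B ** diag_mat x - diag_mat x ** transpose B"

definition M_norm ::
    "(real \<Rightarrow> real ^ 'n ^ 'n) \<Rightarrow> (real \<Rightarrow> 'a \<Rightarrow> real ^ 'n) \<Rightarrow> real \<Rightarrow> 'a \<Rightarrow> real ^ 'n \<Rightarrow> real" where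
  "M_norm A X t \<omega> z = sqrt (z \<bullet> (bracket_density (A t) (left_lim (\<lambda>r. X r \<omega>) t) *v z))"

text \<open>The relation \<open>\<sim>\<^sub>M\<close>, restricted to times in \<open>S\<close>; the unrestricted one is \<open>S = {0<..}\<close>.\<close>

definition M_equiv ::
    "'a measure \<Rightarrow> (real \<Rightarrow> real ^ 'n ^ 'n) \<Rightarrow> (real \<Rightarrow> 'a \<Rightarrow> real ^ 'n) \<Rightarrow> real set
      \<Rightarrow> (real \<Rightarrow> 'a \<Rightarrow> real ^ 'n) \<Rightarrow> (real \<Rightarrow> 'a \<Rightarrow> real ^ 'n) \<Rightarrow> bool" where
  "M_equiv P A X S Z Z' \<longleftrightarrow>
     (AE (\<omega>, t) in completion P \<Otimes>\<^sub>M lborel. t \<in> S \<longrightarrow> M_norm A X t \<omega> (Z t \<omega> - Z' t \<omega>) = 0)"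

definition predictable_algebra ::
    "'a measure \<Rightarrow> (real \<Rightarrow> 'a \<Rightarrow> real ^ 'n) \<Rightarrow> ('a \<times> real) measure" where
  "predictable_algebra P X = sigma (space P \<times> {0..})
     ({E \<times> {0} | E. E \<in> sets (chain_filtration P X 0)} \<union>
      {E \<times> {s<..t} | E s t. 0 \<le> s \<and> s \<le> t \<and> E \<in> sets (chain_filtration P X s)})"

definition predictable ::
    "'a measure \<Rightarrow> (real \<Rightarrow> 'a \<Rightarrow> real ^ 'n) \<Rightarrow> (real \<Rightarrow> 'a \<Rightarrow> real ^ 'n) \<Rightarrow> bool" where
  "predictable P X Z \<longleftrightarrow> (\<lambda>(\<omega>, t). Z t \<omega>) \<in> borel_measurable (predictable_algebra P X)"

definition progressive_driver ::
    "'a measure \<Rightarrow> (real \<Rightarrow> 'a \<Rightarrow> real ^ 'n) \<Rightarrow> ('a \<Rightarrow> real \<Rightarrow> real \<Rightarrow> real ^ 'n \<Rightarrow> real) \<Rightarrow> bool" where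
  "progressive_driver P X f \<longleftrightarrow>
     (\<forall>T\<ge>0. (\<lambda>(\<omega>, t, y, z). f \<omega> t y z) \<in> borel_measurable
        (chain_filtration P X T \<Otimes>\<^sub>M (restrict_space borel {0..T} \<Otimes>\<^sub>M (borel \<Otimes>\<^sub>M borel))))"

text \<open>
  The driver sees \<open>Z\<close> only up to \<open>\<sim>\<^sub>M\<close>. The relation \<open>\<sim>\<^sub>M\<close> ignores null sets of
  \<open>P \<otimes> dt\<close>, so the two driver processes are compared up to such null sets. (Asking
  for agreement at all times simultaneously is a stronger condition, and forces the driver
  at each fixed time to be almost surely independent of \<open>z\<close>.)
\<close>

definition driver_respects_M_equiv ::
    "'a measure \<Rightarrow> (real \<Rightarrow> real ^ 'n ^ 'n) \<Rightarrow> (real \<Rightarrow> 'a \<Rightarrow> real ^ 'n)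
      \<Rightarrow> ('a \<Rightarrow> real \<Rightarrow> real \<Rightarrow> real ^ 'n \<Rightarrow> real) \<Rightarrow> bool" where
  "driver_respects_M_equiv P A X f \<longleftrightarrow>
     (\<forall>Z Z'. predictable P X Z \<and> predictable P X Z' \<and> M_equiv P A X {0<..} Z Z' \<longrightarrow>
        (AE (\<omega>, t) in completion P \<Otimes>\<^sub>M lborel.
           0 < t \<longrightarrow> (\<forall>y. f \<omega> t y (Z t \<omega>) = f \<omega> t y (Z' t \<omega>))))"

text \<open>
  \<open>dY\<^sub>t = - f(\<omega>, t, Y\<^bsub>t-\<^esub>, Z\<^sub>t) dt + Z\<^sub>t\<^sup>* dM\<^sub>t\<close> on the time interval \<open>{0..T}\<close>, with \<open>Y\<close> adapted and
  locally square-integrable in the supremum, and \<open>Z\<close> predictable.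
\<close>

definition solution ::
    "'a measure \<Rightarrow> (real \<Rightarrow> real ^ 'n ^ 'n) \<Rightarrow> (real \<Rightarrow> 'a \<Rightarrow> real ^ 'n)
      \<Rightarrow> ('a \<Rightarrow> real \<Rightarrow> real \<Rightarrow> real ^ 'n \<Rightarrow> real)
      \<Rightarrow> real \<Rightarrow> (real \<Rightarrow> 'a \<Rightarrow> real) \<Rightarrow> (real \<Rightarrow> 'a \<Rightarrow> real ^ 'n) \<Rightarrow> bool" where
  "solution P A X f T Y Z \<longleftrightarrow>
     (\<forall>t\<in>{0..T}. Y t \<in> borel_measurable (chain_filtration P X t)) \<and>
     (\<integral>\<^sup>+\<omega>. (SUP t\<in>{0..<T}. ennreal ((Y t \<omega>)\<^sup>2)) \<partial>completion P) < \<infinity> \<and>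
     predictable P X Z \<and>
     (AE \<omega> in completion P. \<forall>t\<in>{0..T}.
        (\<lambda>s. f \<omega> s (left_lim (\<lambda>r. Y r \<omega>) s) (Z s \<omega>)) absolutely_integrable_on {0..t} \<and>
        mart_integrable A X Z t \<omega> \<and>
        Y t \<omega> = Y 0 \<omega> - integral {0..t} (\<lambda>s. f \<omega> s (left_lim (\<lambda>r. Y r \<omega>) s) (Z s \<omega>))
                 + mart_integral A X Z t \<omega>)"

text \<open>
  The equation can be read forward (\<open>Z\<close> and the initial value given, \<open>Y\<close> unknown) or backward
  (the value at time \<open>T\<close> given, \<open>Y\<close> and \<open>Z\<close> unknown). In either reading \<open>(Y, Z)\<close> is to be the
  unique solution.
\<close>

definition unique_forward ::
    "'a measure \<Rightarrow> (real \<Rightarrow> real ^ 'n ^ 'n) \<Rightarrow> (real \<Rightarrow> 'a \<Rightarrow> real ^ 'n)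
      \<Rightarrow> ('a \<Rightarrow> real \<Rightarrow> real \<Rightarrow> real ^ 'n \<Rightarrow> real)
      \<Rightarrow> (real \<Rightarrow> 'a \<Rightarrow> real) \<Rightarrow> (real \<Rightarrow> 'a \<Rightarrow> real ^ 'n) \<Rightarrow> bool" where
  "unique_forward P A X f Y Z \<longleftrightarrow>
     (\<forall>T>0. \<forall>Y'. solution P A X f T Y' Z \<and> (AE \<omega> in completion P. Y' 0 \<omega> = Y 0 \<omega>) \<longrightarrow>
        (AE \<omega> in completion P. \<forall>t\<in>{0..T}. Y' t \<omega> = Y t \<omega>))"

definition unique_backward ::
    "'a measure \<Rightarrow> (real \<Rightarrow> real ^ 'n ^ 'n) \<Rightarrow> (real \<Rightarrow> 'a \<Rightarrow> real ^ 'n)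
      \<Rightarrow> ('a \<Rightarrow> real \<Rightarrow> real \<Rightarrow> real ^ 'n \<Rightarrow> real)
      \<Rightarrow> (real \<Rightarrow> 'a \<Rightarrow> real) \<Rightarrow> (real \<Rightarrow> 'a \<Rightarrow> real ^ 'n) \<Rightarrow> bool" where
  "unique_backward P A X f Y Z \<longleftrightarrow>
     (\<forall>T>0. \<forall>Y' Z'. solution P A X f T Y' Z' \<and> (AE \<omega> in completion P. Y' T \<omega> = Y T \<omega>) \<longrightarrow>
        (AE \<omega> in completion P. \<forall>t\<in>{0..T}. Y' t \<omega> = Y t \<omega>) \<and> M_equiv P A X {0<..T} Z' Z)"

text \<open>
  \<open>dv\<^sub>t = G(t, v\<^sub>t) dt\<close> in integrated form. States other than the initial state \<open>i0\<close> have
  probability zero at time \<open>0\<close>, so that \<open>Y\<^sub>t = u(t, X\<^sub>t)\<close> puts no constraint on \<open>u(0, e\<^sub>i)\<close> for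
  \<open>i \<noteq> i0\<close>; these components solve the equation on \<open>{0<..}\<close>, the component \<open>i0\<close> on \<open>{0..}\<close>.
\<close>

definition solves_ode ::
    "'n \<Rightarrow> (real \<Rightarrow> real ^ 'n \<Rightarrow> real ^ 'n) \<Rightarrow> (real \<Rightarrow> real ^ 'n) \<Rightarrow> bool" where
  "solves_ode i0 G v \<longleftrightarrow>
     (\<forall>i s t. 0 \<le> s \<and> s \<le> t \<and> (0 < s \<or> i = i0) \<longrightarrow>
        (\<lambda>r. G r (v r) $ i) absolutely_integrable_on {s..t} \<and>
        v t $ i = v s $ i + integral {s..t} (\<lambda>r. G r (v r) $ i))"

definition vec_driver ::
    "(real ^ 'n \<Rightarrow> real \<Rightarrow> real \<Rightarrow> real ^ 'n \<Rightarrow> real) \<Rightarrow> real \<Rightarrow> real ^ 'n \<Rightarrow> real ^ 'n" where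
  "vec_driver g t v = (\<chi> i. g (axis i 1) t (axis i 1 \<bullet> v) v)"

definition vec_of_fun :: "(real \<Rightarrow> real ^ 'n \<Rightarrow> real) \<Rightarrow> real \<Rightarrow> real ^ 'n" where
  "vec_of_fun u t = (\<chi> i. u t (axis i 1))"

definition markovian ::
    "'a measure \<Rightarrow> (real \<Rightarrow> 'a \<Rightarrow> real ^ 'n) \<Rightarrow> (real \<Rightarrow> 'a \<Rightarrow> real)
      \<Rightarrow> (real \<Rightarrow> real ^ 'n \<Rightarrow> real) \<Rightarrow> bool" where
  "markovian P X Y u \<longleftrightarrow> (AE \<omega> in completion P. \<forall>t\<ge>0. Y t \<omega> = u t (X t \<omega>))"

text \<open>
  \<open>g\<close> is the Markovian form of the driver \<open>f\<close> (usually written f-tilde). The process \<open>Z\<close> is only determined up to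
  \<open>\<sim>\<^sub>M\<close>, and the differential equation evaluates \<open>g\<close> at a representative other than \<open>Z\<close>; so
  the identity between \<open>f\<close> and \<open>g\<close> is required along \<open>Y\<close> for every predictable representative
  of \<open>Z\<close>, including \<open>Z\<close> itself. Without this \<open>g\<close> would be unconstrained at the argument
  where the differential equation uses it.
\<close>

definition deterministic_integrand ::
    "'a measure \<Rightarrow> (real \<Rightarrow> real ^ 'n ^ 'n) \<Rightarrow> (real \<Rightarrow> 'a \<Rightarrow> real ^ 'n) \<Rightarrow> 'n
      \<Rightarrow> ('a \<Rightarrow> real \<Rightarrow> real \<Rightarrow> real ^ 'n \<Rightarrow> real)
      \<Rightarrow> (real ^ 'n \<Rightarrow> real \<Rightarrow> real \<Rightarrow> real ^ 'n \<Rightarrow> real)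
      \<Rightarrow> (real \<Rightarrow> 'a \<Rightarrow> real) \<Rightarrow> (real \<Rightarrow> 'a \<Rightarrow> real ^ 'n) \<Rightarrow> bool" where
  "deterministic_integrand P A X i0 f g Y Z \<longleftrightarrow>
     (\<forall>Z'. predictable P X Z' \<and> M_equiv P A X {0<..} Z' Z \<longrightarrow>
        (AE (\<omega>, t) in completion P \<Otimes>\<^sub>M lborel.
           0 < t \<longrightarrow> f \<omega> t (Y t \<omega>) (Z' t \<omega>) = g (X t \<omega>) t (Y t \<omega>) (Z' t \<omega>))) \<and>
     (\<exists>z :: real \<Rightarrow> real ^ 'n.
        predictable P X (\<lambda>t \<omega>. z t) \<and>
        M_equiv P A X {0<..} Z (\<lambda>t \<omega>. z t) \<and>
        (AE \<omega> in completion P. X 0 \<omega> \<bullet> z 0 = Y 0 \<omega>) \<and>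
        solves_ode i0
          (\<lambda>t v. \<chi> i. - g (axis i 1) t (axis i 1 \<bullet> v) v - v \<bullet> (A t *v axis i 1)) z)"

end

theory Submission
  imports Defs
begin

text \<open>
  While the chain stays in state \<open>i\<close>, the equation for \<open>Y\<^sub>t = u(t, e\<^sub>i)\<close> is an ordinary integral
  equation, which some path satisfies on any short interval because the chain holds its state with
  positive probability. Hence \<open>u(\<sqdot>, e\<^sub>i)\<close> is continuous, and comparing the two sides of the dynamics at a jump
  from \<open>j\<close> to \<open>i\<close> gives \<open>Z\<^sup>*(e\<^sub>i - e\<^sub>j) = u(t, e\<^sub>i) - u(t, e\<^sub>j)\<close>. The set where this relation fails
  is predictable and carries no jumps, so by the compensator formula
  \<open>E[# jumps j to i in B] = E[\<integral> 1\<^sub>B A\<^sub>i\<^sub>j 1{X\<^bsub>t-\<^esub> = e\<^sub>j} dt]\<close> for predictable \<open>B\<close> it is null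
  for the intensity; since columns of \<open>A\<close> sum to zero this says \<open>Z \<sim>\<^sub>M u\<close>. Both the driver and
  \<open>Z\<^sup>* A e\<^sub>i\<close> may therefore be evaluated at \<open>u\<close> in the integral equation, which becomes the
  required one. The compensator formula itself comes from counting jumps along ever finer grids and
  the first-order expansion of the transition probabilities.
\<close>

section \<open>Step paths and their jumps\<close>

text \<open>Nothing is assumed about \<open>u\<close> beyond Y = u(t, X), not even measurability in
  time. Its regularity has to be read off from paths. Continuity makes \<open>u\<close> predictable
  as a process, hence an admissible representative of Z in the hypotheses on the driver, and it
  identifies left limits of Y with values of \<open>u\<close>. Equality up to
  \<open>\<sim>\<^sub>M\<close> fixes only differences of components across nonzero rates, never the
  components themselves; the values of \<open>u\<close> are therefore obtained from Y. As
  \<open>u\<close> is deterministic, one path per state and window is enough. The length of the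
  window does not depend on where it starts: every positive time is interior to some window, and
  finitely many windows cover a bounded interval. The rates are merely bounded and measurable, so
  transition probabilities cannot be differentiated at a given time; the expansion uses rates
  integrated over grid cells, with a quadratic remainder. Statements almost everywhere in (path,
  time) reach a chosen path through Fubini.\<close>

text \<open>The states form a discrete set, where right-continuity and the existence of left limits
  mean that the path is eventually constant on each side; the value type needs no topology.\<close>

definition step_path :: "(real \<Rightarrow> 'b) \<Rightarrow> bool" where
  "step_path c \<longleftrightarrow> (\<forall>t\<ge>0. \<forall>\<^sub>F r in at_right t. c r = c t) \<and>
     (\<forall>t>0. \<exists>k. \<forall>\<^sub>F r in at_left t. c r = k)"

text \<open>The left limit of a path with discrete values. A step path has one at every positive
  time; elsewhere the description operator may return anything.\<close>

definition before :: "(real \<Rightarrow> 'b) \<Rightarrow> real \<Rightarrow> 'b" where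
  "before c t = (THE k. \<forall>\<^sub>F r in at_left t. c r = k)"

text \<open>Only positive times count: paths are unconstrained at negative times, so
  \<open>before c 0\<close> carries no information.\<close>

definition jumps :: "(real \<Rightarrow> 'b) \<Rightarrow> real set" where
  "jumps c = {t. 0 < t \<and> before c t \<noteq> c t}"

definition jumps_between :: "(real \<Rightarrow> 'b) \<Rightarrow> 'b \<Rightarrow> 'b \<Rightarrow> real set" where
  "jumps_between c j i = {t. 0 < t \<and> before c t = j \<and> c t = i}"

lemma before_eqI:
  assumes "\<forall>\<^sub>F r in at_left t. c r = k"
  shows "before c t = k"
  unfolding before_def
proof (rule the_equality)
  fix k' assume "\<forall>\<^sub>F r in at_left t. c r = k'"
  with assms have "\<forall>\<^sub>F r in at_left t. k' = k"
    by eventually_elim simp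
  then show "k' = k" by simp
qed (rule assms)

lemma step_path_before:
  assumes "step_path c" "0 < t"
  shows "\<forall>\<^sub>F r in at_left t. c r = before c t"
proof -
  obtain k where "\<forall>\<^sub>F r in at_left t. c r = k"
    using assms unfolding step_path_def by blast
  with before_eqI[OF this] show ?thesis by simp
qed

lemma step_path_right:
  assumes "step_path c" "0 \<le> t"
  shows "\<forall>\<^sub>F r in at_right t. c r = c t"
  using assms unfolding step_path_def by blast

text \<open>On an interval a locally constant function is constant. A jump at \<open>a\<close> does
  no harm, since only right neighbourhoods of \<open>a\<close> meet the interval.\<close>

lemma step_path_constant:
  assumes c: "step_path c" and ab: "0 \<le> a" "a \<le> r" "r \<le> b" and nj: "jumps c \<inter> {a<..b} = {}"
  shows "c r = c a"
proof (rule connected_local_const[of "{a..b}", symmetric])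
  show "\<forall>x\<in>{a..b}. \<forall>\<^sub>F y in at x within {a..b}. c x = c y"
  proof
    fix x assume x: "x \<in> {a..b}"
    then have R: "\<forall>\<^sub>F y in at_right x. c x = c y"
      using step_path_right[OF c, of x] ab by (auto elim: eventually_mono)
    show "\<forall>\<^sub>F y in at x within {a..b}. c x = c y"
    proof (cases "x = a")
      case True
      from R show ?thesis
        unfolding eventually_at_filter by eventually_elim (use True in auto)
    next
      case False
      with x nj ab have "x \<notin> jumps c" "0 < x" by auto
      then have "before c x = c x" by (auto simp: jumps_def)
      with step_path_before[OF c \<open>0 < x\<close>] have "\<forall>\<^sub>F y in at_left x. c x = c y"
        by (auto elim: eventually_mono)
      with R have "\<forall>\<^sub>F y in at x. c x = c y" by (simp add: eventually_at_split)
      moreover have "at x within {a..b} \<le> at x" by (simp add: at_le)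
      ultimately show ?thesis by (rule filter_leD[rotated])
    qed
  qed
qed (use ab in auto)

lemma step_path_before_constant:
  assumes c: "step_path c" and ab: "0 \<le> a" "a < b" and nj: "jumps c \<inter> {a<..<b} = {}"
  shows "before c b = c a"
proof (rule before_eqI)
  have "\<forall>\<^sub>F r in at_left b. r \<in> {a<..<b}"
    using eventually_at_left_real[OF \<open>a < b\<close>] .
  then show "\<forall>\<^sub>F r in at_left b. c r = c a"
  proof eventually_elim
    case (elim r)
    then have "jumps c \<inter> {a<..r} = {}" using nj by force
    then show ?case using step_path_constant[OF c \<open>0 \<le> a\<close>, of r r] elim by auto
  qed
qed

text \<open>Jumps cannot accumulate: on either side of a point the path is constant on a small open
  interval, and no point of such an interval is a jump.\<close>

lemma finite_jumps:
  assumes c: "step_path c"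
  shows "finite (jumps c \<inter> {0<..T})"
proof (rule ccontr)
  let ?J = "jumps c \<inter> {0<..T}"
  assume "infinite ?J"
  then obtain x where x: "x \<in> {0..T}" "x islimpt ?J"
    using Heine_Borel_imp_Bolzano_Weierstrass[of "{0..T}" ?J] by (auto simp: subset_iff)
  have open_notin: "r \<notin> jumps c" if "\<forall>r\<in>{p<..<q}. c r = k" "r \<in> {p<..<q}" for p q r k
  proof -
    have "\<forall>\<^sub>F y in at_left r. y \<in> {p<..<r}"
      using that by (intro eventually_at_left_real) auto
    then have "\<forall>\<^sub>F y in at_left r. c y = k"
      by eventually_elim (use that in auto)
    then show ?thesis using before_eqI[of c k r] that by (auto simp: jumps_def)
  qed
  obtain q where q: "x < q" "\<forall>r\<in>{x<..<q}. c r = c x"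
    using step_path_right[OF c, of x] x by (auto simp: eventually_at_right_field)
  have right: "\<forall>\<^sub>F r in at_right x. r \<notin> ?J"
    unfolding eventually_at_right_field
    using open_notin[OF q(2)] q(1) by (intro exI[of _ q]) auto
  have left: "\<forall>\<^sub>F r in at_left x. r \<notin> ?J"
  proof (cases "x = 0")
    \<comment> \<open>Left of zero there are only negative times, which lie outside
      \<open>{0<..T}\<close>.\<close>
    case True
    then show ?thesis by (auto simp: eventually_at_left_field intro: exI[of _ "-1"])
  next
    case False
    then have "0 < x" using x by auto
    from step_path_before[OF c this] obtain p where
      p: "p < x" "\<forall>r\<in>{p<..<x}. c r = before c x"
      by (auto simp: eventually_at_left_field)
    show ?thesis
      unfolding eventually_at_left_field
      using open_notin[OF p(2)] p(1) by (intro exI[of _ p]) auto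
  qed
  from left right have "\<forall>\<^sub>F r in at x. r \<notin> ?J" by (simp add: eventually_at_split)
  then show False using x(2) by (auto simp: islimpt_iff_eventually)
qed

lemma jumps_between_subset: "j \<noteq> i \<Longrightarrow> jumps_between c j i \<subseteq> jumps c"
  by (auto simp: jumps_def jumps_between_def)

section \<open>Counting jumps along partitions of an interval\<close>

lemma card_Int_grid:
  fixes g :: "nat \<Rightarrow> real"
  assumes "mono g" "finite (J \<inter> {g 0<..g m})"
  shows "card (J \<inter> {g 0<..g m}) = (\<Sum>l<m. card (J \<inter> {g l<..g (Suc l)}))"
  using assms(2)
proof (induction m)
  case (Suc m)
  have le: "g 0 \<le> g m" "g m \<le> g (Suc m)" using assms(1) by (auto simp: mono_def)
  have fin: "finite (J \<inter> {g 0<..g m})" "finite (J \<inter> {g m<..g (Suc m)})"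
    using le by (auto intro: finite_subset[OF _ Suc.prems])
  have "J \<inter> {g 0<..g (Suc m)} = (J \<inter> {g 0<..g m}) \<union> (J \<inter> {g m<..g (Suc m)})"
    using le by auto
  moreover have "card \<dots> = card (J \<inter> {g 0<..g m}) + card (J \<inter> {g m<..g (Suc m)})"
    using fin by (intro card_Un_disjoint) auto
  ultimately show ?case using Suc.IH[OF fin(1)] by simp
qed simp

text \<open>Equal cells, so that errors of second order in the mesh add up to order 1/m. For
  \<open>m = 0\<close> division by zero makes the grid constant at \<open>s\<close>, which is why
  reaching the right end requires \<open>0 < m\<close>.\<close>

definition grid :: "real \<Rightarrow> real \<Rightarrow> nat \<Rightarrow> nat \<Rightarrow> real" where
  "grid s t m l = s + real l * ((t - s) / real m)"

lemma mono_grid: "s \<le> t \<Longrightarrow> mono (grid s t m)"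
  unfolding mono_def grid_def
  by (intro allI impI add_left_mono mult_right_mono) simp_all

lemma grid_ends: "grid s t m 0 = s" "0 < m \<Longrightarrow> grid s t m m = t"
  by (auto simp: grid_def)

lemma grid_Suc: "grid s t m (Suc l) = grid s t m l + (t - s) / real m"
  by (simp add: grid_def distrib_right add_divide_distrib)

lemma grid_ge: "s \<le> t \<Longrightarrow> s \<le> grid s t m l"
  by (simp add: grid_def)

lemma jump_le_card_jumps:
  assumes c: "step_path c" and ab: "0 \<le> a" "a \<le> b"
  shows "of_bool (c a \<noteq> c b) \<le> card (jumps c \<inter> {a<..b})"
proof (cases "jumps c \<inter> {a<..b} = {}")
  case True
  then show ?thesis using step_path_constant[OF c ab order_refl] by simp
next
  case False
  moreover have "finite (jumps c \<inter> {a<..b})"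
    using finite_jumps[OF c, of b] by (rule finite_subset[rotated]) (use ab in auto)
  ultimately have "0 < card (jumps c \<inter> {a<..b})" by (simp add: card_gt_0_iff)
  then show ?thesis by (auto simp: of_bool_def)
qed

text \<open>If a cell contains a single jump, its end values are the values just before and at that
  jump. With two jumps in a cell the grid would see only their composition, whence the hypothesis
  \<open>one\<close>.\<close>

lemma card_jumps_between_cell:
  assumes c: "step_path c" and ab: "0 \<le> a" "a \<le> b" and ji: "j \<noteq> i"
    and one: "\<And>x y. x \<in> jumps c \<inter> {a<..b} \<Longrightarrow> y \<in> jumps c \<inter> {a<..b} \<Longrightarrow> x = y"
  shows "card (jumps_between c j i \<inter> {a<..b}) = of_bool (c a = j \<and> c b = i)"
proof (cases "jumps c \<inter> {a<..b} = {}")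
  case True
  then have "jumps_between c j i \<inter> {a<..b} = {}" using jumps_between_subset[OF ji, of c] by auto
  moreover have "c b = c a" using step_path_constant[OF c ab order_refl True] .
  ultimately show ?thesis using ji by auto
next
  case False
  then obtain \<tau> where \<tau>: "\<tau> \<in> jumps c" "a < \<tau>" "\<tau> \<le> b" by auto
  have uniq: "x = \<tau>" if "x \<in> jumps c" "a < x" "x \<le> b" for x
    using that \<tau> by (intro one) auto
  have nj: "jumps c \<inter> {a<..<\<tau>} = {}" "jumps c \<inter> {\<tau><..b} = {}"
    using \<tau> by (auto dest: uniq)
  have "before c \<tau> = c a" using step_path_before_constant[OF c ab(1) \<tau>(2) nj(1)] .
  moreover have "c b = c \<tau>" using step_path_constant[OF c _ \<tau>(3) order_refl nj(2)] \<tau> ab by simp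
  moreover have "jumps_between c j i \<inter> {a<..b} = (if before c \<tau> = j \<and> c \<tau> = i then {\<tau>} else {})"
  proof -
    have "jumps_between c j i \<inter> {a<..b} \<subseteq> {\<tau>}"
    proof
      fix x assume "x \<in> jumps_between c j i \<inter> {a<..b}"
      then show "x \<in> {\<tau>}" using jumps_between_subset[OF ji, of c] uniq[of x] by auto
    qed
    moreover have "\<tau> \<in> jumps_between c j i \<inter> {a<..b} \<longleftrightarrow> before c \<tau> = j \<and> c \<tau> = i"
      using \<tau> ab by (simp add: jumps_between_def)
    ultimately show ?thesis by (cases "before c \<tau> = j \<and> c \<tau> = i") (metis subset_singletonD empty_iff, metis subset_singletonD singletonI)
  qed
  ultimately show ?thesis by simp
qed

lemma finite_separated:
  fixes J :: "real set"
  assumes "finite J"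
  obtains \<eta> where "0 < \<eta>" "\<And>x y. x \<in> J \<Longrightarrow> y \<in> J \<Longrightarrow> \<bar>x - y\<bar> < \<eta> \<Longrightarrow> x = y"
proof -
  \<comment> \<open>The element 1 keeps the minimum defined when \<open>J\<close> has fewer than two
    points.\<close>
  let ?D = "insert 1 ((\<lambda>(x, y). \<bar>x - y\<bar>) ` {(x, y) \<in> J \<times> J. x \<noteq> y})"
  have fin: "finite ?D" using assms by (auto intro: finite_subset[of _ "J \<times> J"])
  have "0 < Min ?D" using fin by (subst Min_gr_iff) auto
  moreover have "x = y" if "x \<in> J" "y \<in> J" "\<bar>x - y\<bar> < Min ?D" for x y
  proof (rule ccontr)
    assume "x \<noteq> y"
    then have "\<bar>x - y\<bar> \<in> ?D" using that by force
    then have "Min ?D \<le> \<bar>x - y\<bar>" using fin by (rule Min_le[rotated])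
    with that show False by simp
  qed
  ultimately show thesis by (rule that)
qed

lemma eventually_grid_separates:
  assumes c: "step_path c" and st: "0 \<le> s" "s \<le> t"
  shows "\<forall>\<^sub>F m in sequentially. 0 < m \<and> (\<forall>l<m. \<forall>x y.
           x \<in> jumps c \<inter> {grid s t m l<..grid s t m (Suc l)} \<longrightarrow>
           y \<in> jumps c \<inter> {grid s t m l<..grid s t m (Suc l)} \<longrightarrow> x = y)"
proof -
  obtain \<eta> where \<eta>: "0 < \<eta>" "\<And>x y. x \<in> jumps c \<inter> {0<..t} \<Longrightarrow> y \<in> jumps c \<inter> {0<..t} \<Longrightarrow> \<bar>x - y\<bar> < \<eta> \<Longrightarrow> x = y"
    using finite_separated[OF finite_jumps[OF c, of t]] by metis
  have "(\<lambda>m. (t - s) / real m) \<longlonglongrightarrow> 0" by (rule lim_const_over_n)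
  then have "\<forall>\<^sub>F m in sequentially. (t - s) / real m < \<eta>" using \<eta>(1) by (rule order_tendstoD)
  with eventually_gt_at_top[of 0] show ?thesis
  proof eventually_elim
    case (elim m)
    have "x = y" if l: "l < m" and x: "x \<in> jumps c \<inter> {grid s t m l<..grid s t m (Suc l)}"
      and y: "y \<in> jumps c \<inter> {grid s t m l<..grid s t m (Suc l)}" for l x y
    proof -
      have "grid s t m (Suc l) \<le> grid s t m m" using mono_grid[OF st(2), of m] l by (auto simp: mono_def)
      then have "{grid s t m l<..grid s t m (Suc l)} \<subseteq> {0<..t}"
        using grid_ends(2)[OF elim(1), of s t] grid_ge[OF st(2), of m l] st by auto
      moreover have "\<bar>x - y\<bar> < \<eta>" using x y elim(2) by (auto simp: grid_Suc)
      ultimately show ?thesis using \<eta>(2) x y by blast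
    qed
    then show ?case using elim(1) by blast
  qed
qed

text \<open>The threshold for \<open>m\<close> depends on the smallest gap between jumps and is not
  uniform over paths, so expectations are later passed to the limit by Fatou and dominated
  convergence.\<close>

lemma card_jumps_between_grid:
  assumes c: "step_path c" and st: "0 \<le> s" "s \<le> t" and ji: "j \<noteq> i"
  shows "\<forall>\<^sub>F m in sequentially. (\<Sum>l<m. of_bool (c (grid s t m l) = j \<and> c (grid s t m (Suc l)) = i))
           = card (jumps_between c j i \<inter> {s<..t})"
  using eventually_grid_separates[OF c st]
proof eventually_elim
  case (elim m)
  let ?g = "grid s t m"
  have "finite (jumps_between c j i \<inter> {s<..t})"
    by (rule finite_subset[OF _ finite_jumps[OF c, of t]]) (use st jumps_between_subset[OF ji, of c] in auto)
  then have "card (jumps_between c j i \<inter> {s<..t})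
      = (\<Sum>l<m. card (jumps_between c j i \<inter> {?g l<..?g (Suc l)}))"
    using card_Int_grid[OF mono_grid[OF st(2), of m], of "jumps_between c j i" m] elim by (simp add: grid_ends)
  also have "\<dots> = (\<Sum>l<m. of_bool (c (?g l) = j \<and> c (?g (Suc l)) = i))"
  proof (rule sum.cong)
    fix l assume l: "l \<in> {..<m}"
    show "card (jumps_between c j i \<inter> {?g l<..?g (Suc l)}) = of_bool (c (?g l) = j \<and> c (?g (Suc l)) = i)"
      using elim l grid_ge[OF st(2), of m l] st mono_grid[OF st(2), of m]
      by (intro card_jumps_between_cell[OF c]) (auto simp: ji mono_def)
  qed simp
  finally show ?case by simp
qed

text \<open>Unlike the exact count, this bound holds for every positive \<open>m\<close>; it
  supplies the dominating function for the grid counts.\<close>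

lemma sum_grid_le_card_jumps:
  assumes c: "step_path c" and st: "0 \<le> s" "s \<le> t" and m: "0 < m"
  shows "(\<Sum>l<m. of_bool (c (grid s t m l) \<noteq> c (grid s t m (Suc l)))) \<le> card (jumps c \<inter> {s<..t})"
proof -
  let ?g = "grid s t m"
  have "finite (jumps c \<inter> {s<..t})"
    by (rule finite_subset[OF _ finite_jumps[OF c, of t]]) (use st in auto)
  then have "card (jumps c \<inter> {s<..t}) = (\<Sum>l<m. card (jumps c \<inter> {?g l<..?g (Suc l)}))"
    using card_Int_grid[OF mono_grid[OF st(2), of m], of "jumps c" m] m by (simp add: grid_ends)
  moreover have "of_bool (c (?g l) \<noteq> c (?g (Suc l))) \<le> card (jumps c \<inter> {?g l<..?g (Suc l)})" for l
    using grid_ge[OF st(2), of m l] st mono_grid[OF st(2), of m]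
    by (intro jump_le_card_jumps[OF c]) (auto simp: mono_def)
  ultimately show ?thesis by (simp only: sum_mono)
qed

lemma card_jumps_eq_sum:
  fixes c :: "real \<Rightarrow> 'b::finite"
  assumes c: "step_path c" and s: "0 \<le> s"
  shows "card (jumps c \<inter> {s<..t}) = (\<Sum>p\<in>{p. fst p \<noteq> snd p}. card (jumps_between c (fst p) (snd p) \<inter> {s<..t}))"
proof -
  have fin: "finite (jumps_between c j i \<inter> {s<..t})" if "j \<noteq> i" for j i
    by (rule finite_subset[OF _ finite_jumps[OF c, of t]]) (use s jumps_between_subset[OF that, of c] in auto)
  have "jumps c \<inter> {s<..t} = (\<Union>p\<in>{p. fst p \<noteq> snd p}. jumps_between c (fst p) (snd p) \<inter> {s<..t})"
    by (auto simp: jumps_def jumps_between_def)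
  also have "card \<dots> = (\<Sum>p\<in>{p. fst p \<noteq> snd p}. card (jumps_between c (fst p) (snd p) \<inter> {s<..t}))"
  proof (rule card_UN_disjoint)
    show "\<forall>p\<in>{p. fst p \<noteq> snd p}. finite (jumps_between c (fst p) (snd p) \<inter> {s<..t})"
      using fin by auto
  qed (auto simp: jumps_between_def)
  finally show ?thesis .
qed

section \<open>Short-time behaviour of the transition probabilities\<close>

lemma borel_measurable_vec_nth:
  "(\<lambda>x :: 'b::real_normed_vector ^ 'n. x $ i) \<in> borel_measurable borel"
  by (intro borel_measurable_continuous_onI linear_continuous_on bounded_linear_vec_nth)

lemma bounded_set_integrable:
  fixes h :: "real \<Rightarrow> real"
  assumes "h \<in> borel_measurable borel" "\<And>r. r \<in> {a<..b} \<Longrightarrow> \<bar>h r\<bar> \<le> B"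
  shows "set_integrable lborel {a<..b} h"
proof -
  have "emeasure lborel {a<..b} < \<infinity>" by (cases "a \<le> b") auto
  then show ?thesis
    unfolding set_integrable_def
    by (intro integrableI_bounded_set_indicator[where B = B]) (use assms in auto)
qed

lemma set_integral_bound:
  fixes h :: "real \<Rightarrow> real"
  assumes h: "h \<in> borel_measurable borel" and B: "\<And>r. r \<in> {a<..b} \<Longrightarrow> \<bar>h r\<bar> \<le> B" and ab: "a \<le> b"
  shows "\<bar>LINT r:{a<..b}|lborel. h r\<bar> \<le> B * (b - a)"
proof -
  have "\<bar>LINT r:{a<..b}|lborel. h r\<bar> \<le> (LINT r:{a<..b}|lborel. \<bar>h r\<bar>)"
    using set_integral_norm_bound[OF bounded_set_integrable[OF h B]] by simp
  also have "\<dots> \<le> (LINT r:{a<..b}|lborel. B)"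
    using h B by (intro set_integral_mono bounded_set_integrable[where B = "\<bar>B\<bar>"]) (auto intro: order_trans[OF _ abs_ge_self])
  also have "\<dots> = B * (b - a)"
    using ab by (simp add: set_lebesgue_integral_def)
  finally show ?thesis .
qed

lemma bounded_absolutely_integrable:
  fixes h :: "real \<Rightarrow> real"
  assumes h: "h \<in> borel_measurable borel" and B: "\<And>r. r \<in> {a..b} \<Longrightarrow> \<bar>h r\<bar> \<le> B"
  shows "h absolutely_integrable_on {a..b}"
proof (rule measurable_bounded_by_integrable_imp_absolutely_integrable)
  show "h \<in> borel_measurable (lebesgue_on {a..b})"
    using h by (intro measurable_restrict_space1 measurable_completion) simp
  show "(\<lambda>_. B) integrable_on {a..b}" by (rule integrable_const_ivl)
qed (use B in auto)

text \<open>Half-open intervals fit together exactly along a grid, whereas the forward equation is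
  posed on closed intervals; the left endpoint is a null set.\<close>

lemma set_lebesgue_integral_Ioc_eq_integral:
  fixes h :: "real \<Rightarrow> real"
  assumes h: "h \<in> borel_measurable borel" and B: "\<And>r. r \<in> {a<..b} \<Longrightarrow> \<bar>h r\<bar> \<le> B"
  shows "(LINT r:{a<..b}|lborel. h r) = integral {a..b} h"
proof -
  have "(LINT r:{a<..b}|lborel. h r) = integral {a<..b} h"
    using set_borel_integral_eq_integral(2)[OF bounded_set_integrable[OF h B]] by simp
  also have "\<dots> = integral {a..b} h"
    by (rule integral_spike_set; rule negligible_subset[of "{a}"]) auto
  finally show ?thesis .
qed

context rate_markov_chain begin

section \<open>The chain as a process of indices, and its filtration\<close>

sublocale completed: prob_space "completion P"
  by (rule prob_space_completion)

text \<open>The filtration contains all null sets of the completion, so events and expectations are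
  taken there rather than in \<open>P\<close>.\<close>

abbreviation Q :: "'a measure" where "Q \<equiv> completion P"
abbreviation F :: "real \<Rightarrow> 'a measure" where "F \<equiv> chain_filtration P X"

definition state :: "real \<Rightarrow> 'a \<Rightarrow> 'n" where
  "state t \<omega> = (THE i. X t \<omega> = axis i 1)"

abbreviation (input) trajectory :: "'a \<Rightarrow> real \<Rightarrow> 'n" where
  "trajectory \<omega> \<equiv> (\<lambda>t. state t \<omega>)"

lemma state_eqI: "X t \<omega> = axis i 1 \<Longrightarrow> state t \<omega> = i"
  unfolding state_def by (auto simp: axis_eq_axis)

lemma X_eq_axis: "0 \<le> t \<Longrightarrow> \<omega> \<in> space P \<Longrightarrow> X t \<omega> = axis (state t \<omega>) 1"
  using X_basis[of t \<omega>] state_eqI by metis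

lemma X_eq_axis_iff: "0 \<le> t \<Longrightarrow> \<omega> \<in> space P \<Longrightarrow> X t \<omega> = axis i 1 \<longleftrightarrow> state t \<omega> = i"
  using X_eq_axis[of t \<omega>] by (auto simp: axis_eq_axis)

lemma X_nth: "0 \<le> t \<Longrightarrow> \<omega> \<in> space P \<Longrightarrow> X t \<omega> $ i = of_bool (state t \<omega> = i)"
  using X_eq_axis[of t \<omega>] by (auto simp: axis_def)

lemma state_0: "\<omega> \<in> space P \<Longrightarrow> state 0 \<omega> = i0"
  by (simp add: state_eqI X_start)

lemma step_path: "\<omega> \<in> space P \<Longrightarrow> step_path (trajectory \<omega>)"
  unfolding step_path_def
proof (intro conjI allI impI)
  fix t :: real assume \<omega>: "\<omega> \<in> space P" and t: "0 \<le> t"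
  have "((\<lambda>s. X s \<omega>) \<longlongrightarrow> X t \<omega>) (at_right t)"
    using X_right_cont[OF t \<omega>] by (simp add: continuous_within)
  \<comment> \<open>The component of the current state is 1 and all components are 0 or 1, so
    convergence of this one component pins the state.\<close>
  then have "((\<lambda>s. X s \<omega> $ state t \<omega>) \<longlongrightarrow> X t \<omega> $ state t \<omega>) (at_right t)"
    by (rule tendsto_vec_nth)
  then have "\<forall>\<^sub>F s in at_right t. X s \<omega> $ state t \<omega> > 0"
    by (rule order_tendstoD) (simp add: X_nth[OF t \<omega>])
  with eventually_at_right_less[of t] show "\<forall>\<^sub>F r in at_right t. state r \<omega> = state t \<omega>"
  proof eventually_elim
    case (elim s)
    then show ?case using X_nth[of s \<omega> "state t \<omega>"] t \<omega> by (cases "state s \<omega> = state t \<omega>") auto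
  qed
next
  fix t :: real assume \<omega>: "\<omega> \<in> space P" and t: "0 < t"
  obtain l where l: "((\<lambda>s. X s \<omega>) \<longlongrightarrow> l) (at_left t)" using X_left_lim[OF t \<omega>] by blast
  have pos: "\<forall>\<^sub>F s in at_left t. 0 < s"
    using eventually_at_left_real[OF t] by eventually_elim auto
  \<comment> \<open>Otherwise all components would be below 1 shortly before \<open>t\<close>,
    although the component of the occupied state equals 1.\<close>
  have "\<exists>k. l $ k > 1 / 2"
  proof (rule ccontr)
    assume "\<nexists>k. l $ k > 1 / 2"
    then have "l $ k \<le> 1 / 2" for k by (meson not_le)
    then have "l $ k < 1" for k by (rule order_le_less_trans) simp
    then have "\<forall>\<^sub>F s in at_left t. \<forall>k. X s \<omega> $ k < 1"
      using order_tendstoD(2)[OF tendsto_vec_nth[OF l]] by (intro eventually_all_finite) simp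
    with pos have "\<forall>\<^sub>F s in at_left t. False"
    proof eventually_elim
      case (elim s)
      from elim(2) have "X s \<omega> $ state s \<omega> < 1" ..
      then show ?case using X_nth[of s \<omega> "state s \<omega>"] \<omega> elim(1) by simp
    qed
    then show False by simp
  qed
  then obtain k where "l $ k > 1 / 2" by blast
  then have "\<forall>\<^sub>F s in at_left t. X s \<omega> $ k > 1 / 2"
    using order_tendstoD(1)[OF tendsto_vec_nth[OF l]] by blast
  with pos have "\<forall>\<^sub>F r in at_left t. state r \<omega> = k"
  proof eventually_elim
    case (elim s)
    then show ?case using X_nth[of s \<omega> k] \<omega> by (cases "state s \<omega> = k") auto
  qed
  then show "\<exists>k. \<forall>\<^sub>F r in at_left t. state r \<omega> = k" ..
qed

lemma left_lim_X:
  assumes "\<omega> \<in> space P" "0 < t"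
  shows "left_lim (\<lambda>r. X r \<omega>) t = axis (before (trajectory \<omega>) t) 1"
  unfolding left_lim_def
proof (rule tendsto_Lim[OF trivial_limit_at_left_real tendsto_eventually])
  have "\<forall>\<^sub>F s in at_left t. 0 < s"
    using eventually_at_left_real[OF assms(2)] by eventually_elim auto
  with step_path_before[OF step_path[OF assms(1)] assms(2)]
  show "\<forall>\<^sub>F r in at_left t. X r \<omega> = axis (before (trajectory \<omega>) t) 1"
    by eventually_elim (use assms X_eq_axis in auto)
qed

lemma chain_filtration_generators:
  "{X s -` B \<inter> space P | s B. 0 \<le> s \<and> s \<le> t \<and> B \<in> sets borel} \<union> null_sets Q \<subseteq> sets Q"
proof -
  have "X s -` B \<inter> space P \<in> sets Q" if "0 \<le> s" "B \<in> sets borel" for s B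
    using measurable_sets[OF X_measurable[OF that(1)] that(2)] by (auto intro: sets_completionI_sets)
  then show ?thesis by auto
qed

lemma chain_filtration_generators_Pow:
  "{X s -` B \<inter> space P | s B. 0 \<le> s \<and> s \<le> t \<and> B \<in> sets borel} \<union> null_sets Q \<subseteq> Pow (space P)"
  using chain_filtration_generators[of t] sets.space_closed[of Q] by auto

lemma space_F [simp]: "space (F t) = space P"
  using chain_filtration_generators_Pow unfolding chain_filtration_def by (rule space_measure_of)

lemma sets_F: "sets (F t) = sigma_sets (space P)
    ({X s -` B \<inter> space P | s B. 0 \<le> s \<and> s \<le> t \<and> B \<in> sets borel} \<union> null_sets Q)"
  using chain_filtration_generators_Pow unfolding chain_filtration_def by (rule sets_measure_of)

lemma sets_F_subset: "sets (F t) \<subseteq> sets Q"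
  using sets.sigma_sets_subset[OF chain_filtration_generators[of t]] unfolding sets_F by simp

lemma sets_F_mono: "s \<le> t \<Longrightarrow> sets (F s) \<subseteq> sets (F t)"
  unfolding sets_F
proof (intro sigma_sets_mono' Un_mono order_refl subsetI)
  fix G assume "s \<le> t" "G \<in> {X r -` B \<inter> space P | r B. 0 \<le> r \<and> r \<le> s \<and> B \<in> sets borel}"
  then obtain r B where "G = X r -` B \<inter> space P" "0 \<le> r" "r \<le> t" "B \<in> sets borel" by auto
  then show "G \<in> {X r -` B \<inter> space P | r B. 0 \<le> r \<and> r \<le> t \<and> B \<in> sets borel}" by blast
qed

lemma subalgebra_F: "subalgebra Q (F t)"
  using sets_F_subset by (auto simp: subalgebra_def)

lemma state_in_F:
  assumes "0 \<le> s" "s \<le> t"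
  shows "{\<omega> \<in> space P. state s \<omega> = i} \<in> sets (F t)"
proof -
  have "{\<omega> \<in> space P. state s \<omega> = i} = X s -` {axis i 1} \<inter> space P"
    using X_eq_axis_iff[OF assms(1)] by auto
  moreover have "\<dots> \<in> sigma_sets (space P)
      ({X s -` B \<inter> space P | s B. 0 \<le> s \<and> s \<le> t \<and> B \<in> sets borel} \<union> null_sets Q)"
    using assms
    by (intro sigma_sets.Basic UnI1 CollectI exI[of _ s] exI[of _ "{axis i 1} :: (real ^ 'n) set"]) simp
  ultimately show ?thesis by (simp add: sets_F)
qed

lemma state_measurable [measurable (raw)]:
  "0 \<le> t \<Longrightarrow> state t \<in> measurable Q (count_space UNIV)"
  using state_in_F[of t t] sets_F_subset[of t]
  by (subst measurable_count_space_eq2) (auto simp: vimage_def Int_def conj_commute subset_iff)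

lemma measurable_state_sets: "0 \<le> t \<Longrightarrow> {\<omega> \<in> space P. state t \<omega> = i} \<in> sets Q"
  using state_in_F[of t t] sets_F_subset[of t] by auto

section \<open>Rates and transition probabilities\<close>

text \<open>Extension by zero makes every rate a Borel function on the whole line with a global
  bound.\<close>

definition rate :: "'n \<Rightarrow> 'n \<Rightarrow> real \<Rightarrow> real" where
  "rate i j t = (if 0 \<le> t then A t $ i $ j else 0)"

text \<open>Chosen strictly positive because it becomes a divisor in
  \<open>hold_time\<close>.\<close>

definition rate_bound :: real where
  "rate_bound = (SOME K. 0 < K \<and> (\<forall>t i j. \<bar>rate i j t\<bar> \<le> K))"

lemma rate_bound: "0 < rate_bound" "\<bar>rate i j t\<bar> \<le> rate_bound"
proof -
  obtain K where K: "\<forall>t\<ge>0. \<forall>i j. \<bar>A t $ i $ j\<bar> \<le> K" using A_bounded by blast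
  have "0 < max K 1 \<and> (\<forall>t i j. \<bar>rate i j t\<bar> \<le> max K 1)"
    using K by (auto simp: rate_def max.coboundedI1)
  then have "0 < rate_bound \<and> (\<forall>t i j. \<bar>rate i j t\<bar> \<le> rate_bound)"
    unfolding rate_bound_def by (rule someI)
  then show "0 < rate_bound" "\<bar>rate i j t\<bar> \<le> rate_bound" by auto
qed

lemma rate_nonneg: "i \<noteq> j \<Longrightarrow> 0 \<le> rate i j t"
  using A_nonneg by (simp add: rate_def)

lemma rate_measurable [measurable]: "rate i j \<in> borel_measurable borel"
proof -
  have "(\<lambda>t. A t $ i $ j) \<in> borel_measurable (restrict_space borel {0..})"
    using measurable_compose[OF A_measurable measurable_compose[OF borel_measurable_vec_nth borel_measurable_vec_nth]] by simp
  then have "(\<lambda>t. if t \<in> {0..} then A t $ i $ j else 0) \<in> borel_measurable borel"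
    by (subst measurable_If_restrict_space_iff) (simp_all add: atLeast_def)
  then show ?thesis by (simp add: rate_def[abs_def])
qed

lemma rate_integrable: "rate i j absolutely_integrable_on {a..b}"
  by (rule bounded_absolutely_integrable[where B = rate_bound]) (auto intro: rate_bound)

text \<open>Integrating the conditional expectation over the part of \<open>E\<close> in state
  \<open>j\<close> at time \<open>s\<close> turns the Markov property into a product formula, valid
  for every event \<open>E\<close> of the past. Entry (i, j) is thereby determined only if state
  \<open>j\<close> has positive probability at time \<open>s\<close>.\<close>

lemma transition_probabilities:
  obtains p :: "real \<Rightarrow> real \<Rightarrow> real ^ 'n ^ 'n" where
    "\<And>s t E i j. 0 \<le> s \<Longrightarrow> s \<le> t \<Longrightarrow> E \<in> sets (F s) \<Longrightarrow>
       measure Q {\<omega> \<in> E. state s \<omega> = j \<and> state t \<omega> = i} = measure Q {\<omega> \<in> E. state s \<omega> = j} * p s t $ i $ j"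
    "\<And>s t. 0 \<le> s \<Longrightarrow> s \<le> t \<Longrightarrow> (\<lambda>r. A r ** p s r) integrable_on {s..t}"
    "\<And>s t. 0 \<le> s \<Longrightarrow> s \<le> t \<Longrightarrow> p s t = mat 1 + integral {s..t} (\<lambda>r. A r ** p s r)"
proof -
  obtain p where p:
    "\<And>s t i. 0 \<le> s \<and> s \<le> t \<Longrightarrow>
         AE \<omega> in Q. real_cond_exp Q (F s) (\<lambda>\<omega>. X t \<omega> $ i) \<omega> = (p s t *v X s \<omega>) $ i"
    "\<And>s t. 0 \<le> s \<and> s \<le> t \<Longrightarrow>
         (\<lambda>r. A r ** p s r) absolutely_integrable_on {s..t} \<and>
         p s t = mat 1 + integral {s..t} (\<lambda>r. A r ** p s r)"
    using markov_rates by blast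
  have "measure Q {\<omega> \<in> E. state s \<omega> = j \<and> state t \<omega> = i} = measure Q {\<omega> \<in> E. state s \<omega> = j} * p s t $ i $ j"
    if st: "0 \<le> s" "s \<le> t" and E: "E \<in> sets (F s)" for s t E i j
  proof -
    interpret sub: finite_measure_subalgebra Q "F s"
      by standard (rule subalgebra_F)
    define E' where "E' = {\<omega> \<in> E. state s \<omega> = j}"
    have Esp: "E \<subseteq> space P" using sets.sets_into_space[OF E] by simp
    have "E' = E \<inter> {\<omega> \<in> space P. state s \<omega> = j}" using Esp by (auto simp: E'_def)
    then have E'F: "E' \<in> sets (F s)" using E state_in_F[OF st(1) order_refl] by auto
    then have E'Q: "E' \<in> sets Q" using sets_F_subset by blast
    have "0 \<le> t" using st by simp
    have meas: "(\<lambda>\<omega>. X t \<omega> $ i) \<in> borel_measurable Q"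
      using measurable_compose[OF X_measurable[OF \<open>0 \<le> t\<close>] borel_measurable_vec_nth] by (rule measurable_completion)
    have "integrable Q (\<lambda>\<omega>. X t \<omega> $ i)"
      by (rule completed.integrable_const_bound[where B = 1]) (use meas X_nth[OF \<open>0 \<le> t\<close>] in auto)
    then have "(\<integral>\<omega>\<in>E'. X t \<omega> $ i \<partial>Q) = (\<integral>\<omega>\<in>E'. real_cond_exp Q (F s) (\<lambda>\<omega>. X t \<omega> $ i) \<omega> \<partial>Q)"
      using E'F by (rule sub.real_cond_exp_intA)
    also have "\<dots> = (\<integral>\<omega>\<in>E'. p s t $ i $ j \<partial>Q)"
      unfolding set_lebesgue_integral_def
    proof (rule integral_cong_AE)
      show "AE \<omega> in Q. indicat_real E' \<omega> *\<^sub>R real_cond_exp Q (F s) (\<lambda>\<omega>. X t \<omega> $ i) \<omega> = indicat_real E' \<omega> *\<^sub>R p s t $ i $ j"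
        using p(1)[OF conjI[OF st], of i]
      proof eventually_elim
        case (elim \<omega>)
        show ?case
        proof (cases "\<omega> \<in> E'")
          case True
          then have "X s \<omega> = axis j 1" using Esp X_eq_axis_iff[OF st(1)] by (auto simp: E'_def)
          then show ?thesis using elim by (simp add: matrix_vector_mult_basis column_def)
        qed simp
      qed
    qed (use E'Q in auto)
    also have "\<dots> = measure Q E' * p s t $ i $ j"
      using E'Q sets.sets_into_space[OF E'Q] by (simp add: set_lebesgue_integral_def Int_absorb2)
    finally have 1: "(\<integral>\<omega>\<in>E'. X t \<omega> $ i \<partial>Q) = measure Q E' * p s t $ i $ j" .
    have eq: "{\<omega> \<in> E. state s \<omega> = j \<and> state t \<omega> = i} = E' \<inter> {\<omega> \<in> space P. state t \<omega> = i}"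
      using Esp by (auto simp: E'_def)
    have "(\<integral>\<omega>\<in>E'. X t \<omega> $ i \<partial>Q) = (\<integral>\<omega>. indicator {\<omega> \<in> E. state s \<omega> = j \<and> state t \<omega> = i} \<omega> \<partial>Q)"
      unfolding set_lebesgue_integral_def
      by (rule Bochner_Integration.integral_cong) (use X_nth[OF \<open>0 \<le> t\<close>] Esp in \<open>auto simp: E'_def indicator_def\<close>)
    also have "\<dots> = measure Q {\<omega> \<in> E. state s \<omega> = j \<and> state t \<omega> = i}"
      using E'Q sets.sets_into_space[OF E'Q] measurable_state_sets[OF \<open>0 \<le> t\<close>, of i]
      unfolding eq by (simp add: Int_absorb2 le_infI1)
    finally show ?thesis using 1 by (simp add: E'_def)
  qed
  moreover have "(\<lambda>r. A r ** p s r) integrable_on {s..t}"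
    "p s t = mat 1 + integral {s..t} (\<lambda>r. A r ** p s r)" if "0 \<le> s" "s \<le> t" for s t
    using p(2)[OF conjI[OF that]] set_lebesgue_integral_eq_integral(1) by blast+
  ultimately show thesis by (rule that)
qed

text \<open>One Picard step for the forward equation. The entries of \<open>p\<close> lie between 0
  and 1, so a row of \<open>A\<close> applied to them is at most L =
  \<open>CARD('n) * rate_bound\<close>, and \<open>p\<close> deviates from the identity by at most L
  times the elapsed time. Inserting this deviation back into the equation leaves the integrated rate
  and a quadratic remainder.\<close>

lemma short_time:
  assumes ab: "0 \<le> a" "a \<le> b" and E: "E \<in> sets (F a)"
  shows short_time_first: "\<bar>measure Q {\<omega> \<in> E. state a \<omega> = j \<and> state b \<omega> = i} - of_bool (i = j) * measure Q {\<omega> \<in> E. state a \<omega> = j}\<bar>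
           \<le> CARD('n) * rate_bound * (b - a)" (is ?thesis1)
    and short_time_second: "i \<noteq> j \<Longrightarrow> \<bar>measure Q {\<omega> \<in> E. state a \<omega> = j \<and> state b \<omega> = i}
            - measure Q {\<omega> \<in> E. state a \<omega> = j} * (LINT r:{a<..b}|lborel. rate i j r)\<bar>
           \<le> (CARD('n) * rate_bound)\<^sup>2 * (b - a)\<^sup>2" (is "_ \<Longrightarrow> ?thesis2")
proof -
  let ?L = "CARD('n) * rate_bound"
  obtain p where p:
    "\<And>s t E i j. 0 \<le> s \<Longrightarrow> s \<le> t \<Longrightarrow> E \<in> sets (F s) \<Longrightarrow>
       measure Q {\<omega> \<in> E. state s \<omega> = j \<and> state t \<omega> = i} = measure Q {\<omega> \<in> E. state s \<omega> = j} * p s t $ i $ j"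
    "\<And>s t. 0 \<le> s \<Longrightarrow> s \<le> t \<Longrightarrow> (\<lambda>r. A r ** p s r) integrable_on {s..t}"
    "\<And>s t. 0 \<le> s \<Longrightarrow> s \<le> t \<Longrightarrow> p s t = mat 1 + integral {s..t} (\<lambda>r. A r ** p s r)"
    by (rule transition_probabilities) blast
  have Esp: "E \<subseteq> space P" using sets.sets_into_space[OF E] by simp
  let ?q = "measure Q {\<omega> \<in> E. state a \<omega> = j}"
  have q: "0 \<le> ?q" "?q \<le> 1" by auto
  have L0: "0 \<le> ?L" using rate_bound(1) by simp
  have *: "?thesis1 \<and> (i \<noteq> j \<longrightarrow> ?thesis2)"
  proof (cases "?q = 0")
    \<comment> \<open>Column \<open>j\<close> of \<open>p\<close> may be unconstrained here, but by
      the product formula all the probabilities involved vanish.\<close>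
    case True
    then show ?thesis using p(1)[OF ab E, of j i] ab L0 by simp
  next
    case False
    have "?q \<le> measure Q {\<omega> \<in> space P. state a \<omega> = j}"
      using Esp by (intro completed.finite_measure_mono measurable_state_sets ab) auto
    with False q have w: "0 < measure Q {\<omega> \<in> space P. state a \<omega> = j}" (is "0 < ?w") by linarith
    \<comment> \<open>An entry times \<open>?w\<close> is the probability of a subevent of the event
      with probability \<open>?w\<close>; division gives both bounds.\<close>
    have p01: "0 \<le> p a r $ k $ j" "p a r $ k $ j \<le> 1" if "a \<le> r" for r k
    proof -
      have spF: "space P \<in> sets (F a)" using sets.top[of "F a"] by simp
      note pk = p(1)[OF ab(1) that spF, of j k]
      have "0 \<le> ?w * p a r $ k $ j" unfolding pk[symmetric] by simp
      then show "0 \<le> p a r $ k $ j" using w by (simp add: zero_le_mult_iff)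
      have "?w * p a r $ k $ j \<le> ?w"
        unfolding pk[symmetric] by (intro completed.finite_measure_mono measurable_state_sets ab) auto
      then show "p a r $ k $ j \<le> 1" using w by simp
    qed
    let ?h = "\<lambda>k r. \<Sum>m\<in>UNIV. rate k m r * p a r $ m $ j"
    have int: "(?h k has_integral (p a r $ k $ j - of_bool (k = j))) {a..r}" if "a \<le> r" for k r
    proof -
      have lin: "bounded_linear (\<lambda>M :: real ^ 'n ^ 'n. M $ k $ j)"
        using bounded_linear_compose[OF bounded_linear_vec_nth[of j] bounded_linear_vec_nth[of k]] by simp
      have "((\<lambda>r. A r ** p a r) has_integral (p a r - mat 1)) {a..r}"
        using integrable_integral[OF p(2)[OF ab(1) that]] p(3)[OF ab(1) that] by simp
      from has_integral_linear[OF this lin]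
      have "((\<lambda>r. (A r ** p a r) $ k $ j) has_integral (p a r $ k $ j - of_bool (k = j))) {a..r}"
        by (cases "k = j") (simp_all add: o_def mat_def)
      then show ?thesis
        by (rule has_integral_eq[rotated]) (use ab in \<open>auto simp: matrix_matrix_mult_def rate_def\<close>)
    qed
    have bound1: "\<bar>p a r $ k $ j - of_bool (k = j)\<bar> \<le> ?L * (r - a)" if "a \<le> r" for r k
    proof -
      have "\<bar>?h k x\<bar> \<le> ?L" if "x \<in> {a..r}" for x
      proof -
        have "\<bar>?h k x\<bar> \<le> (\<Sum>m\<in>UNIV. \<bar>rate k m x * p a x $ m $ j\<bar>)" by (rule sum_abs)
        also have "\<dots> \<le> (\<Sum>m\<in>(UNIV::'n set). rate_bound * 1)"
          unfolding abs_mult by (intro sum_mono mult_mono) (use p01 that rate_bound less_imp_le in auto)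
        finally show ?thesis by simp
      qed
      then show ?thesis
        using has_integral_bound[of ?L "?h k" _ a r] int[OF that] L0 that by (simp add: cbox_interval)
    qed
    have 1: ?thesis1
    proof -
      have "\<bar>?q * p a b $ i $ j - of_bool (i = j) * ?q\<bar> = \<bar>?q * (p a b $ i $ j - of_bool (i = j))\<bar>"
        by (simp add: algebra_simps)
      also have "\<dots> = ?q * \<bar>p a b $ i $ j - of_bool (i = j)\<bar>"
        using q(1) by (simp only: abs_mult abs_of_nonneg)
      also have "\<dots> \<le> 1 * (?L * (b - a))"
        by (intro mult_mono bound1) (use q ab in auto)
      finally show ?thesis using p(1)[OF ab E, of j i] by simp
    qed
    moreover have ?thesis2 if ij: "i \<noteq> j"
    proof -
      have "((\<lambda>r. ?h i r - rate i j r) has_integral (p a b $ i $ j - integral {a..b} (rate i j))) {a..b}"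
        using has_integral_diff[OF int[OF ab(2), of i] integrable_integral[OF set_lebesgue_integral_eq_integral(1)[OF rate_integrable]]] ij
        by simp
      \<comment> \<open>Summing \<open>rate i m r\<close> against column \<open>j\<close> of the
        identity matrix gives \<open>rate i j r\<close>, so what remains involves only the deviation
        of \<open>p\<close> from the identity.\<close>
      moreover have "?h i r - rate i j r = (\<Sum>m\<in>UNIV. rate i m r * (p a r $ m $ j - of_bool (m = j)))" for r
        by (simp add: right_diff_distrib sum_subtractf)
      ultimately have "((\<lambda>r. \<Sum>m\<in>UNIV. rate i m r * (p a r $ m $ j - of_bool (m = j)))
          has_integral (p a b $ i $ j - integral {a..b} (rate i j))) {a..b}" by simp
      moreover have "\<bar>\<Sum>m\<in>UNIV. rate i m x * (p a x $ m $ j - of_bool (m = j))\<bar> \<le> ?L\<^sup>2 * (b - a)" if "x \<in> {a..b}" for x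
      proof -
        have "\<bar>\<Sum>m\<in>UNIV. rate i m x * (p a x $ m $ j - of_bool (m = j))\<bar>
            \<le> (\<Sum>m\<in>UNIV. \<bar>rate i m x * (p a x $ m $ j - of_bool (m = j))\<bar>)" by (rule sum_abs)
        also have "\<dots> \<le> (\<Sum>m\<in>(UNIV::'n set). rate_bound * (?L * (b - a)))"
          unfolding abs_mult
        proof (intro sum_mono mult_mono rate_bound)
          fix m
          have "\<bar>p a x $ m $ j - of_bool (m = j)\<bar> \<le> ?L * (x - a)" using bound1 that by simp
          also have "\<dots> \<le> ?L * (b - a)" using that L0 by (intro mult_left_mono) auto
          finally show "\<bar>p a x $ m $ j - of_bool (m = j)\<bar> \<le> ?L * (b - a)" .
        qed (use rate_bound(1) in auto)
        finally show ?thesis by (simp add: power2_eq_square algebra_simps)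
      qed
      ultimately have "\<bar>p a b $ i $ j - integral {a..b} (rate i j)\<bar> \<le> ?L\<^sup>2 * (b - a) * (b - a)"
        using has_integral_bound[of "?L\<^sup>2 * (b - a)" "\<lambda>r. \<Sum>m\<in>UNIV. rate i m r * (p a r $ m $ j - of_bool (m = j))"
            "p a b $ i $ j - integral {a..b} (rate i j)" a b] ab
        by (simp add: cbox_interval)
      then have 2: "\<bar>p a b $ i $ j - integral {a..b} (rate i j)\<bar> \<le> ?L\<^sup>2 * (b - a)\<^sup>2"
        by (simp add: power2_eq_square algebra_simps)
      have "\<bar>?q * p a b $ i $ j - ?q * integral {a..b} (rate i j)\<bar> = ?q * \<bar>p a b $ i $ j - integral {a..b} (rate i j)\<bar>"
        using q(1) by (simp only: abs_mult abs_of_nonneg flip: right_diff_distrib)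
      also have "\<dots> \<le> 1 * (?L\<^sup>2 * (b - a)\<^sup>2)"
        by (intro mult_mono 2) (use q ab in auto)
      finally show ?thesis
        using p(1)[OF ab E, of j i] set_lebesgue_integral_Ioc_eq_integral[OF rate_measurable rate_bound(2)] by simp
    qed
    ultimately show ?thesis by blast
  qed
  from * show ?thesis1 by blast
  from * show "i \<noteq> j \<Longrightarrow> ?thesis2" by blast
qed

end

section \<open>Jump counts along grids\<close>

lemma sum_indicator_grid:
  fixes g :: "nat \<Rightarrow> real"
  assumes "mono g"
  shows "(\<Sum>l<m. indicator {g l<..g (Suc l)} r :: real) = indicator {g 0<..g m} r"
proof (induction m)
  case (Suc m)
  have "g 0 \<le> g m" "g m \<le> g (Suc m)" using assms by (auto simp: mono_def)
  then show ?case using Suc by (auto simp: indicator_def)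
qed simp

context rate_markov_chain begin

section \<open>The state just before a given time\<close>

definition pre_jump_set :: "'n \<Rightarrow> ('a \<times> real) set" where
  "pre_jump_set j = {(\<omega>, t). \<omega> \<in> space P \<and> 0 < t \<and> before (trajectory \<omega>) t = j}"

text \<open>The left-limit process is sampled at dyadic times just before \<open>t\<close>. Along
  step paths the samples are eventually equal to the limit, so the set is a limit inferior of
  countable unions of rectangles.\<close>

lemma pre_jump_set_measurable: "pre_jump_set j \<in> sets (Q \<Otimes>\<^sub>M borel)"
proof -
  \<comment> \<open>Ceiling minus one gives the largest dyadic of level \<open>m\<close> strictly
    below \<open>t\<close>; the floor would return \<open>t\<close> itself at dyadic times and see
    the value after a jump.\<close>
  define d :: "nat \<Rightarrow> real \<Rightarrow> real" where "d m t = (of_int \<lceil>t * 2 ^ m\<rceil> - 1) / 2 ^ m" for m t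
  have d_less: "d m t < t" and d_ge: "t - 1 / 2 ^ m \<le> d m t" for m t
  proof -
    have "of_int \<lceil>t * 2 ^ m\<rceil> - 1 < t * 2 ^ m" "t * 2 ^ m - 1 \<le> of_int \<lceil>t * 2 ^ m\<rceil> - 1" by linarith+
    then show "d m t < t" "t - 1 / 2 ^ m \<le> d m t" by (simp_all add: d_def field_simps)
  qed
  \<comment> \<open>Measurability of the state is available at nonnegative times only.\<close>
  have d_nonneg: "0 \<le> d m t" if "0 < t" for m t
  proof -
    have "0 < t * 2 ^ m" using that by simp
    then have "1 \<le> \<lceil>t * 2 ^ m\<rceil>" by (simp add: one_le_ceiling)
    then show ?thesis by (simp add: d_def)
  qed
  have lim: "filterlim (\<lambda>m. d m t) (at_left t) sequentially" for t
  proof -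
    have "(\<lambda>m. t - (1 / 2) ^ m) \<longlonglongrightarrow> t"
      using tendsto_diff[OF tendsto_const[of t] LIMSEQ_power_zero[of "1 / 2 :: real"]] by simp
    then have "(\<lambda>m. d m t) \<longlonglongrightarrow> t"
    proof (rule tendsto_sandwich[rotated 2])
      show "\<forall>\<^sub>F m in sequentially. t - (1 / 2) ^ m \<le> d m t"
        using d_ge[of t] by (simp add: power_one_over)
      show "\<forall>\<^sub>F m in sequentially. d m t \<le> t"
        using less_imp_le[OF d_less] by (intro always_eventually) simp
    qed (rule tendsto_const)
    then show ?thesis
      unfolding filterlim_at using d_less by (auto simp: less_le)
  qed
  define S :: "nat \<Rightarrow> ('a \<times> real) set" where "S m = {(\<omega>, t). \<omega> \<in> space P \<and> 0 < t \<and> state (d m t) \<omega> = j}" for m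
  have S: "S m \<in> sets (Q \<Otimes>\<^sub>M borel)" for m
  proof -
    \<comment> \<open>The sampling time is constant on each dyadic cell, and \<open>k\<close>, the
      value of the ceiling, labels the cells.\<close>
    let ?V = "\<lambda>k :: int. {\<omega> \<in> space P. state ((of_int k - 1) / 2 ^ m) \<omega> = j} \<times> {t :: real. 0 < t \<and> \<lceil>t * 2 ^ m\<rceil> = k}"
    have "S m = (\<Union>k\<in>{1..}. ?V k)"
      using one_le_ceiling[of "_ * 2 ^ m"] by (auto simp: S_def d_def)
    moreover have "?V k \<in> sets (Q \<Otimes>\<^sub>M borel)" if "k \<in> {1..}" for k
      using that by (intro pair_measureI measurable_state_sets) auto
    ultimately show ?thesis by (auto intro!: sets.countable_UN'')
  qed
  have "pre_jump_set j = (\<Union>n. \<Inter>m\<in>{n..}. S m)"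
  proof (intro set_eqI iffI)
    fix x assume "x \<in> pre_jump_set j"
    then obtain \<omega> t where x: "x = (\<omega>, t)" "\<omega> \<in> space P" "0 < t" "before (trajectory \<omega>) t = j"
      by (auto simp: pre_jump_set_def)
    have "\<forall>\<^sub>F m in sequentially. state (d m t) \<omega> = j"
      using step_path_before[OF step_path[OF x(2)] x(3)] lim[of t] unfolding x(4)
      by (auto simp: filterlim_iff)
    then show "x \<in> (\<Union>n. \<Inter>m\<in>{n..}. S m)"
      using x by (auto simp: S_def eventually_sequentially)
  next
    fix x assume "x \<in> (\<Union>n. \<Inter>m\<in>{n..}. S m)"
    then obtain \<omega> t n where x: "x = (\<omega>, t)" "\<forall>m\<ge>n. (\<omega>, t) \<in> S m" by (cases x) auto
    then have \<omega>: "\<omega> \<in> space P" "0 < t" by (auto simp: S_def)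
    have "\<forall>\<^sub>F m in sequentially. state (d m t) \<omega> = before (trajectory \<omega>) t"
      using step_path_before[OF step_path[OF \<omega>(1)] \<omega>(2)] lim[of t] by (auto simp: filterlim_iff)
    moreover have "\<forall>\<^sub>F m in sequentially. state (d m t) \<omega> = j"
      using x(2) by (auto simp: S_def eventually_sequentially)
    ultimately have "\<forall>\<^sub>F m in sequentially. before (trajectory \<omega>) t = j" by eventually_elim simp
    then show "x \<in> pre_jump_set j" using x \<omega> by (simp add: pre_jump_set_def)
  qed
  also have "\<dots> \<in> sets (Q \<Otimes>\<^sub>M borel)"
    using S by (intro sets.countable_UN sets.countable_INT'') auto
  finally show ?thesis .
qed

text \<open>The predictable intensity of jumps from \<open>j\<close> to \<open>i\<close>. Its
  indices follow the matrix, target before source; the jump counts below list the source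
  first.\<close>

definition intensity :: "'n \<Rightarrow> 'n \<Rightarrow> 'a \<times> real \<Rightarrow> real" where
  "intensity i j x = rate i j (snd x) * indicator (pre_jump_set j) x"

lemma intensity_measurable: "intensity i j \<in> borel_measurable (Q \<Otimes>\<^sub>M borel)"
  using pre_jump_set_measurable unfolding intensity_def by measurable

lemma intensity_measurable_section:
  "\<omega> \<in> space P \<Longrightarrow> (\<lambda>r. intensity i j (\<omega>, r)) \<in> borel_measurable borel"
  using measurable_compose[OF measurable_Pair1' intensity_measurable, of \<omega> i j] by simp

lemma intensity_bound: "\<bar>intensity i j x\<bar> \<le> rate_bound"
  using rate_bound less_imp_le[OF rate_bound(1)] by (auto simp: intensity_def indicator_def)

section \<open>Jump counts and their grid approximations\<close>

definition jump_count :: "'n \<Rightarrow> 'n \<Rightarrow> real \<Rightarrow> real \<Rightarrow> 'a \<Rightarrow> nat" where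
  "jump_count j i s t \<omega> = card (jumps_between (trajectory \<omega>) j i \<inter> {s<..t})"

definition total_count :: "real \<Rightarrow> real \<Rightarrow> 'a \<Rightarrow> nat" where
  "total_count s t \<omega> = card (jumps (trajectory \<omega>) \<inter> {s<..t})"

definition grid_count :: "'n \<Rightarrow> 'n \<Rightarrow> real \<Rightarrow> real \<Rightarrow> nat \<Rightarrow> 'a \<Rightarrow> nat" where
  "grid_count j i s t m \<omega> =
     (\<Sum>l<m. of_bool (state (grid s t m l) \<omega> = j \<and> state (grid s t m (Suc l)) \<omega> = i))"

lemma grid_count_measurable:
  assumes "0 \<le> s" "s \<le> t"
  shows "grid_count j i s t m \<in> measurable Q (count_space UNIV)"
proof -
  have "(\<lambda>\<omega>. of_bool (state (grid s t m l) \<omega> = j \<and> state (grid s t m (Suc l)) \<omega> = i) :: nat) \<in> measurable Q (count_space UNIV)" for l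
  proof -
    have [measurable]: "state (grid s t m l) \<in> measurable Q (count_space UNIV)"
      "state (grid s t m (Suc l)) \<in> measurable Q (count_space UNIV)"
      using assms grid_ge[OF assms(2), of m] by (auto intro!: state_measurable intro: order_trans)
    show ?thesis by measurable
  qed
  then show ?thesis unfolding grid_count_def[abs_def] by measurable
qed

lemma eventually_grid_count:
  assumes "\<omega> \<in> space P" "0 \<le> s" "s \<le> t" "j \<noteq> i"
  shows "\<forall>\<^sub>F m in sequentially. grid_count j i s t m \<omega> = jump_count j i s t \<omega>"
  using card_jumps_between_grid[OF step_path[OF assms(1)] assms(2-4)]
  by (simp add: grid_count_def jump_count_def)

lemma jump_count_measurable:
  assumes "0 \<le> s" "s \<le> t" "j \<noteq> i"
  shows "(\<lambda>\<omega>. real (jump_count j i s t \<omega>)) \<in> borel_measurable Q"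
proof (rule borel_measurable_LIMSEQ_real)
  fix \<omega> assume "\<omega> \<in> space Q"
  then have "\<forall>\<^sub>F m in sequentially. real (grid_count j i s t m \<omega>) = real (jump_count j i s t \<omega>)"
    using eventually_grid_count[OF _ assms, of \<omega>] by (auto elim: eventually_mono)
  then show "(\<lambda>m. real (grid_count j i s t m \<omega>)) \<longlonglongrightarrow> real (jump_count j i s t \<omega>)"
    by (rule tendsto_eventually)
next
  fix m
  show "(\<lambda>\<omega>. real (grid_count j i s t m \<omega>)) \<in> borel_measurable Q"
    using grid_count_measurable[OF assms(1,2), of j i m] by measurable
qed

lemma total_count_eq_sum:
  assumes "\<omega> \<in> space P" "0 \<le> s"
  shows "total_count s t \<omega> = (\<Sum>p\<in>{p. fst p \<noteq> snd p}. jump_count (fst p) (snd p) s t \<omega>)"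
  using card_jumps_eq_sum[OF step_path[OF assms(1)] assms(2), of t]
  by (simp add: total_count_def jump_count_def)

lemma grid_count_le_total:
  assumes "\<omega> \<in> space P" "0 \<le> s" "s \<le> t" "j \<noteq> i"
  shows "grid_count j i s t m \<omega> \<le> total_count s t \<omega>"
proof (cases "m = 0")
  case False
  have "grid_count j i s t m \<omega> \<le> (\<Sum>l<m. of_bool (state (grid s t m l) \<omega> \<noteq> state (grid s t m (Suc l)) \<omega>))"
    unfolding grid_count_def by (intro sum_mono) (use assms(4) in auto)
  also have "\<dots> \<le> total_count s t \<omega>"
    using sum_grid_le_card_jumps[OF step_path[OF assms(1)] assms(2,3), of m] False by (simp add: total_count_def)
  finally show ?thesis .
qed (simp add: grid_count_def)

lemma expectation_grid_count:
  assumes st: "0 \<le> s" "s \<le> t" and E: "E \<in> sets (F s)"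
  shows "(\<integral>\<omega>. indicator E \<omega> * real (grid_count j i s t m \<omega>) \<partial>Q)
    = (\<Sum>l<m. measure Q {\<omega> \<in> E. state (grid s t m l) \<omega> = j \<and> state (grid s t m (Suc l)) \<omega> = i})"
proof -
  let ?D = "\<lambda>l. {\<omega> \<in> E. state (grid s t m l) \<omega> = j \<and> state (grid s t m (Suc l)) \<omega> = i}"
  have Esp: "E \<subseteq> space P" using sets.sets_into_space[OF E] by simp
  have EQ: "E \<in> sets Q" using E sets_F_subset by blast
  have D: "?D l \<in> sets Q" for l
  proof -
    have "0 \<le> grid s t m l'" for l' using grid_ge[OF st(2), of m l'] st by simp
    then have "E \<inter> ({\<omega> \<in> space P. state (grid s t m l) \<omega> = j} \<inter> {\<omega> \<in> space P. state (grid s t m (Suc l)) \<omega> = i}) \<in> sets Q"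
      using EQ measurable_state_sets by blast
    moreover have "E \<inter> ({\<omega> \<in> space P. state (grid s t m l) \<omega> = j} \<inter> {\<omega> \<in> space P. state (grid s t m (Suc l)) \<omega> = i}) = ?D l"
      using Esp by auto
    ultimately show ?thesis by simp
  qed
  have "indicator E \<omega> * real (grid_count j i s t m \<omega>) = (\<Sum>l<m. indicator (?D l) \<omega>)" for \<omega>
    unfolding grid_count_def of_nat_sum sum_distrib_left by (rule sum.cong) (auto simp: indicator_def)
  then have "(\<integral>\<omega>. indicator E \<omega> * real (grid_count j i s t m \<omega>) \<partial>Q) = (\<integral>\<omega>. (\<Sum>l<m. indicator (?D l) \<omega>) \<partial>Q)"
    by simp
  also have "\<dots> = (\<Sum>l<m. \<integral>\<omega>. indicator (?D l) \<omega> \<partial>Q)"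
    using D by (intro Bochner_Integration.integral_sum integrable_real_indicator) (auto simp: completed.emeasure_eq_measure)
  also have "\<dots> = (\<Sum>l<m. measure Q (?D l))"
    using D sets.sets_into_space[OF D] by (intro sum.cong) (simp_all add: Int_absorb2)
  finally show ?thesis .
qed

text \<open>Each of the \<open>m\<close> cells contributes at most \<open>?L * ((t - s) / m)\<close>
  to the expected grid count, so these expectations are bounded uniformly in \<open>m\<close>, and
  Fatou passes the bound to the limit. Dominated convergence is not yet possible: its dominating
  function is a sum of the very counts whose integrability is at stake.\<close>

lemma jump_count_integrable:
  assumes st: "0 \<le> s" "s \<le> t" and ji: "j \<noteq> i"
  shows "integrable Q (\<lambda>\<omega>. real (jump_count j i s t \<omega>))"
proof (rule integrableI_bounded)
  let ?L = "CARD('n) * rate_bound"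
  have "(\<integral>\<^sup>+\<omega>. ennreal (norm (real (jump_count j i s t \<omega>))) \<partial>Q)
      = (\<integral>\<^sup>+\<omega>. liminf (\<lambda>m. ennreal (real (grid_count j i s t m \<omega>))) \<partial>Q)"
  proof (rule nn_integral_cong)
    fix \<omega> assume "\<omega> \<in> space Q"
    then have "\<forall>\<^sub>F m in sequentially. ennreal (real (grid_count j i s t m \<omega>)) = ennreal (real (jump_count j i s t \<omega>))"
      using eventually_grid_count[OF _ assms, of \<omega>] by (auto elim: eventually_mono)
    then have "(\<lambda>m. ennreal (real (grid_count j i s t m \<omega>))) \<longlonglongrightarrow> ennreal (real (jump_count j i s t \<omega>))"
      by (rule tendsto_eventually)
    then show "ennreal (norm (real (jump_count j i s t \<omega>))) = liminf (\<lambda>m. ennreal (real (grid_count j i s t m \<omega>)))"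
      unfolding real_norm_def abs_of_nat by (rule lim_imp_Liminf[symmetric, OF trivial_limit_sequentially])
  qed
  also have "\<dots> \<le> liminf (\<lambda>m. \<integral>\<^sup>+\<omega>. ennreal (real (grid_count j i s t m \<omega>)) \<partial>Q)"
    using grid_count_measurable[OF st] by (intro nn_integral_liminf) measurable
  also have "\<dots> \<le> liminf (\<lambda>m :: nat. ennreal (?L * (t - s)))"
  proof (rule Liminf_mono)
    show "\<forall>\<^sub>F m in sequentially. (\<integral>\<^sup>+\<omega>. ennreal (real (grid_count j i s t m \<omega>)) \<partial>Q) \<le> ennreal (?L * (t - s))"
      using eventually_gt_at_top[of 0]
    proof eventually_elim
      case (elim m)
      have spF: "space P \<in> sets (F r)" for r using sets.top[of "F r"] by simp
      have int: "integrable Q (\<lambda>\<omega>. real (grid_count j i s t m \<omega>))"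
      proof (rule completed.integrable_const_bound[where B = "real m"])
        have "grid_count j i s t m \<omega> \<le> (\<Sum>l<m. 1)" for \<omega>
          unfolding grid_count_def by (rule sum_mono) auto
        then show "AE \<omega> in Q. norm (real (grid_count j i s t m \<omega>)) \<le> real m" by simp
      qed (use grid_count_measurable[OF st, of j i m] in measurable)
      have "(\<integral>\<omega>. real (grid_count j i s t m \<omega>) \<partial>Q) = (\<integral>\<omega>. indicator (space P) \<omega> * real (grid_count j i s t m \<omega>) \<partial>Q)"
        by (rule Bochner_Integration.integral_cong) auto
      also have "\<dots> \<le> (\<Sum>l<m. ?L * ((t - s) / m))"
        unfolding expectation_grid_count[OF st spF]
      proof (rule sum_mono)
        fix l
        have "\<bar>measure Q {\<omega> \<in> space P. state (grid s t m l) \<omega> = j \<and> state (grid s t m (Suc l)) \<omega> = i}\<bar> \<le> ?L * (grid s t m (Suc l) - grid s t m l)"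
          using short_time_first[OF _ _ spF, of "grid s t m l" "grid s t m (Suc l)" j i] ji st
            grid_ge[OF st(2), of m l] mono_grid[OF st(2), of m] by (auto simp: mono_def)
        then show "measure Q {\<omega> \<in> space P. state (grid s t m l) \<omega> = j \<and> state (grid s t m (Suc l)) \<omega> = i} \<le> ?L * ((t - s) / m)"
          by (simp add: grid_Suc)
      qed
      also have "\<dots> = ?L * (t - s)" using elim by simp
      finally show ?case using nn_integral_eq_integral[OF int] by (simp add: ennreal_leI)
    qed
  qed
  also have "\<dots> < \<infinity>" by (simp add: Liminf_const)
  finally show "(\<integral>\<^sup>+\<omega>. ennreal (norm (real (jump_count j i s t \<omega>))) \<partial>Q) < \<infinity>" .
qed (rule jump_count_measurable[OF assms])

lemma total_count_integrable:
  assumes "0 \<le> s" "s \<le> t"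
  shows "integrable Q (\<lambda>\<omega>. real (total_count s t \<omega>))"
proof -
  have "integrable Q (\<lambda>\<omega>. \<Sum>p\<in>{p. fst p \<noteq> snd p}. real (jump_count (fst p) (snd p) s t \<omega>))"
    using assms by (intro Bochner_Integration.integrable_sum jump_count_integrable) auto
  then show ?thesis
    by (rule Bochner_Integration.integrable_cong[THEN iffD1, rotated 2]) (use assms total_count_eq_sum in simp_all)
qed

section \<open>Riemann sums for the integrated intensity\<close>

definition integrated_intensity :: "'n \<Rightarrow> 'n \<Rightarrow> real \<Rightarrow> real \<Rightarrow> 'a \<Rightarrow> real" where
  "integrated_intensity i j s t \<omega> = (LINT r:{s<..t}|lborel. intensity i j (\<omega>, r))"

lemma integrated_intensity_measurable:
  "integrated_intensity i j s t \<in> borel_measurable Q"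
proof -
  have "(\<lambda>(\<omega>, r). indicator {s<..t} r *\<^sub>R intensity i j (\<omega>, r)) \<in> borel_measurable (Q \<Otimes>\<^sub>M lborel)"
    using intensity_measurable[of i j] unfolding sets_pair_measure_cong[OF refl sets_lborel, THEN measurable_cong_sets, OF refl]
    by (simp add: case_prod_beta) measurable
  then show ?thesis
    unfolding integrated_intensity_def[abs_def] set_lebesgue_integral_def
    using lborel.borel_measurable_lebesgue_integral[of "\<lambda>\<omega> r. indicator {s<..t} r *\<^sub>R intensity i j (\<omega>, r)" Q] by simp
qed

lemma integrated_intensity_bound:
  assumes "\<omega> \<in> space P" "s \<le> t"
  shows "\<bar>integrated_intensity i j s t \<omega>\<bar> \<le> rate_bound * (t - s)"
  unfolding integrated_intensity_def
  by (rule set_integral_bound[OF intensity_measurable_section]) (use assms intensity_bound in auto)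

text \<open>Freezing the state at the left end of each cell is exact on cells without jumps. On any
  other cell the error is at most \<open>rate_bound\<close> times the mesh, and there are at most as
  many such cells as jumps.\<close>

lemma riemann_error:
  assumes \<omega>: "\<omega> \<in> space P" and st: "0 \<le> s" "s \<le> t" and m: "0 < m"
  shows "\<bar>(\<Sum>l<m. of_bool (state (grid s t m l) \<omega> = j) * (LINT r:{grid s t m l<..grid s t m (Suc l)}|lborel. rate i j r))
     - integrated_intensity i j s t \<omega>\<bar> \<le> rate_bound * ((t - s) / m) * total_count s t \<omega>"
proof -
  let ?g = "grid s t m"
  let ?cell = "\<lambda>l. {?g l<..?g (Suc l)}"
  let ?h = "\<lambda>r. intensity i j (\<omega>, r)"
  have hm: "?h \<in> borel_measurable borel" by (rule intensity_measurable_section[OF \<omega>])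
  have g: "0 \<le> ?g l" "?g l \<le> ?g (Suc l)" for l
    using grid_ge[OF st(2), of m l] st mono_grid[OF st(2), of m] by (auto simp: mono_def)
  have fin: "finite (jumps (trajectory \<omega>) \<inter> {a<..b})" if "0 \<le> a" for a b
    by (rule finite_subset[OF _ finite_jumps[OF step_path[OF \<omega>], of b]]) (use that in auto)
  have "(\<Sum>l<m. indicator (?cell l) r *\<^sub>R ?h r) = indicator {s<..t} r *\<^sub>R ?h r" for r
    unfolding scaleR_left.sum[symmetric] sum_indicator_grid[OF mono_grid[OF st(2), of m]]
    using m by (simp add: grid_ends)
  then have "integrated_intensity i j s t \<omega> = (\<integral>r. (\<Sum>l<m. indicator (?cell l) r *\<^sub>R ?h r) \<partial>lborel)"
    by (simp only: integrated_intensity_def set_lebesgue_integral_def)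
  also have "\<dots> = (\<Sum>l<m. LINT r:?cell l|lborel. ?h r)"
    unfolding set_lebesgue_integral_def
    by (rule Bochner_Integration.integral_sum)
      (use bounded_set_integrable[OF hm intensity_bound] in \<open>simp add: set_integrable_def\<close>)
  finally have eq: "integrated_intensity i j s t \<omega> = (\<Sum>l<m. LINT r:?cell l|lborel. ?h r)" .
  have cell: "\<bar>of_bool (state (?g l) \<omega> = j) * (LINT r:?cell l|lborel. rate i j r) - (LINT r:?cell l|lborel. ?h r)\<bar>
      \<le> rate_bound * ((t - s) / m) * card (jumps (trajectory \<omega>) \<inter> ?cell l)" for l
  proof -
    let ?d = "\<lambda>r. of_bool (state (?g l) \<omega> = j) * rate i j r - ?h r"
    have "of_bool (state (?g l) \<omega> = j) * (LINT r:?cell l|lborel. rate i j r) - (LINT r:?cell l|lborel. ?h r)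
        = (LINT r:?cell l|lborel. ?d r)"
      using bounded_set_integrable[OF hm intensity_bound] bounded_set_integrable[OF rate_measurable rate_bound(2)]
      by (subst set_integral_diff) auto
    moreover have "\<bar>LINT r:?cell l|lborel. ?d r\<bar> \<le> rate_bound * ((t - s) / m) * card (jumps (trajectory \<omega>) \<inter> ?cell l)"
    proof (cases "jumps (trajectory \<omega>) \<inter> ?cell l = {}")
      case True
      have "?d r = 0" if r: "r \<in> ?cell l" for r
      proof -
        have "0 < r" using r g(1)[of l] by simp
        have "before (trajectory \<omega>) r = state (?g l) \<omega>"
          using step_path_before_constant[OF step_path[OF \<omega>] g(1)[of l], of r] r True by fastforce
        then show ?thesis using \<omega> \<open>0 < r\<close> by (auto simp: intensity_def pre_jump_set_def)
      qed
      then have "(LINT r:?cell l|lborel. ?d r) = (LINT r:?cell l|lborel. 0)"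
        by (intro set_lebesgue_integral_cong) auto
      then show ?thesis using True by simp
    next
      case False
      then have "1 \<le> real (card (jumps (trajectory \<omega>) \<inter> ?cell l))"
        using fin[OF g(1)[of l]] by (simp add: Suc_le_eq card_gt_0_iff)
      \<comment> \<open>The integrand is a rate times a difference of two indicators, so a single
        \<open>rate_bound\<close> suffices.\<close>
      moreover have "\<bar>LINT r:?cell l|lborel. ?d r\<bar> \<le> rate_bound * (?g (Suc l) - ?g l)"
        using hm rate_bound less_imp_le[OF rate_bound(1)] g(2)
        by (intro set_integral_bound) (auto simp: intensity_def indicator_def pre_jump_set_def)
      ultimately show ?thesis
        using mult_left_mono[of 1 "real (card (jumps (trajectory \<omega>) \<inter> ?cell l))" "rate_bound * ((t - s) / m)"]
          rate_bound(1) st by (simp add: grid_Suc)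
    qed
    ultimately show ?thesis by simp
  qed
  have "\<bar>(\<Sum>l<m. of_bool (state (?g l) \<omega> = j) * (LINT r:?cell l|lborel. rate i j r)) - integrated_intensity i j s t \<omega>\<bar>
      \<le> (\<Sum>l<m. rate_bound * ((t - s) / m) * card (jumps (trajectory \<omega>) \<inter> ?cell l))"
    unfolding eq sum_subtractf[symmetric] by (rule order_trans[OF sum_abs sum_mono[OF cell]])
  also have "\<dots> = rate_bound * ((t - s) / m) * total_count s t \<omega>"
  proof -
    have "total_count s t \<omega> = (\<Sum>l<m. card (jumps (trajectory \<omega>) \<inter> ?cell l))"
      using card_Int_grid[OF mono_grid[OF st(2), of m], of "jumps (trajectory \<omega>)" m] fin[OF st(1), of t] m
      by (simp add: total_count_def grid_ends)
    then show ?thesis by (simp only: sum_distrib_left of_nat_sum)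
  qed
  finally show ?thesis .
qed

end

section \<open>The compensator of the jump measure\<close>

context rate_markov_chain begin

lemma state_in_E_measurable:
  assumes "E \<in> sets Q" "0 \<le> t"
  shows "{\<omega> \<in> E. state t \<omega> = j} \<in> sets Q"
proof -
  have "{\<omega> \<in> E. state t \<omega> = j} = E \<inter> {\<omega> \<in> space P. state t \<omega> = j}"
    using sets.sets_into_space[OF assms(1)] by auto
  then show ?thesis using assms measurable_state_sets by auto
qed

text \<open>Both expectations are limits of the expected grid counts \<open>?a\<close>: one since
  grid counts are eventually exact, the other since the probability of a transition over a cell is
  the integrated rate up to second order. As \<open>E\<close> belongs to the past of
  \<open>s\<close>, it belongs to the past of every grid time, and each cell can be conditioned on
  its left end.\<close>

lemma jump_count_compensator:
  assumes st: "0 \<le> s" "s \<le> t" and E: "E \<in> sets (F s)" and ji: "j \<noteq> i"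
  shows "(\<integral>\<omega>. indicator E \<omega> * real (jump_count j i s t \<omega>) \<partial>Q)
    = (\<integral>\<omega>. indicator E \<omega> * integrated_intensity i j s t \<omega> \<partial>Q)"
proof (rule LIMSEQ_unique)
  have EQ: "E \<in> sets Q" using E sets_F_subset by blast
  let ?a = "\<lambda>m. \<integral>\<omega>. indicator E \<omega> * real (grid_count j i s t m \<omega>) \<partial>Q"
  let ?r = "\<integral>\<omega>. indicator E \<omega> * integrated_intensity i j s t \<omega> \<partial>Q"
  show "?a \<longlonglongrightarrow> (\<integral>\<omega>. indicator E \<omega> * real (jump_count j i s t \<omega>) \<partial>Q)"
  proof (rule integral_dominated_convergence[where w = "\<lambda>\<omega>. real (total_count s t \<omega>)"])
    show "(\<lambda>\<omega>. indicator E \<omega> * real (jump_count j i s t \<omega>)) \<in> borel_measurable Q"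
      using EQ jump_count_measurable[OF st ji] by measurable
    show "(\<lambda>\<omega>. indicator E \<omega> * real (grid_count j i s t m \<omega>)) \<in> borel_measurable Q" for m
      using EQ grid_count_measurable[OF st, of j i m] by measurable
    show "integrable Q (\<lambda>\<omega>. real (total_count s t \<omega>))" by (rule total_count_integrable[OF st])
    show "AE \<omega> in Q. (\<lambda>m. indicator E \<omega> * real (grid_count j i s t m \<omega>)) \<longlonglongrightarrow> indicator E \<omega> * real (jump_count j i s t \<omega>)"
    proof (rule AE_I2)
      fix \<omega> assume "\<omega> \<in> space Q"
      then have "\<forall>\<^sub>F m in sequentially. indicator E \<omega> * real (grid_count j i s t m \<omega>) = indicator E \<omega> * real (jump_count j i s t \<omega>)"
        using eventually_grid_count[OF _ st ji, of \<omega>] by (auto elim: eventually_mono)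
      then show "(\<lambda>m. indicator E \<omega> * real (grid_count j i s t m \<omega>)) \<longlonglongrightarrow> indicator E \<omega> * real (jump_count j i s t \<omega>)"
        by (rule tendsto_eventually)
    qed
    show "AE \<omega> in Q. norm (indicator E \<omega> * real (grid_count j i s t m \<omega>)) \<le> real (total_count s t \<omega>)" for m
      using grid_count_le_total[OF _ st ji] by (intro AE_I2) (auto simp: indicator_def)
  qed
  let ?L = "CARD('n) * rate_bound"
  \<comment> \<open>The first summand collects the \<open>m\<close> quadratic remainders of the
    transition probabilities, the second the expected Riemann error.\<close>
  let ?C = "?L\<^sup>2 * (t - s)\<^sup>2 + rate_bound * (t - s) * (\<integral>\<omega>. real (total_count s t \<omega>) \<partial>Q)"
  show "?a \<longlonglongrightarrow> ?r"
  proof (rule LIM_zero_cancel, rule Lim_null_comparison)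
    show "\<forall>\<^sub>F m in sequentially. norm (?a m - ?r) \<le> ?C / real m"
      using eventually_gt_at_top[of 0]
    proof eventually_elim
      case (elim m)
      let ?g = "grid s t m"
      let ?R = "\<lambda>l. LINT r:{?g l<..?g (Suc l)}|lborel. rate i j r"
      let ?q = "\<lambda>l. measure Q {\<omega> \<in> E. state (?g l) \<omega> = j}"
      let ?f = "\<lambda>\<omega>. \<Sum>l<m. of_bool (state (?g l) \<omega> = j) * ?R l"
      have g: "s \<le> ?g l" "0 \<le> ?g l" "?g l \<le> ?g (Suc l)" for l
        using grid_ge[OF st(2), of m l] st mono_grid[OF st(2), of m] by (auto simp: mono_def)
      have int: "integrable Q (\<lambda>\<omega>. indicator {\<omega> \<in> E. state (?g l) \<omega> = j} \<omega> * ?R l)" for l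
        using state_in_E_measurable[OF EQ g(2)]
        by (intro integrable_mult_left integrable_real_indicator) (auto simp: completed.emeasure_eq_measure)
      have feq: "indicator E \<omega> * ?f \<omega> = (\<Sum>l<m. indicator {\<omega> \<in> E. state (?g l) \<omega> = j} \<omega> * ?R l)" for \<omega>
        unfolding sum_distrib_left by (rule sum.cong) (auto simp: indicator_def)
      have f_int: "integrable Q (\<lambda>\<omega>. indicator E \<omega> * ?f \<omega>)"
        unfolding feq using int by (rule Bochner_Integration.integrable_sum)
      have "(\<integral>\<omega>. indicator {\<omega> \<in> E. state (?g l) \<omega> = j} \<omega> * ?R l \<partial>Q) = ?q l * ?R l" for l
        using state_in_E_measurable[OF EQ g(2)[of l], of j] sets.sets_into_space[OF state_in_E_measurable[OF EQ g(2)[of l], of j]]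
        by (simp add: Int_absorb2)
      then have b: "(\<integral>\<omega>. indicator E \<omega> * ?f \<omega> \<partial>Q) = (\<Sum>l<m. ?q l * ?R l)"
        unfolding feq Bochner_Integration.integral_sum[OF int] by (rule sum.cong[OF refl])
      have "\<bar>?a m - (\<Sum>l<m. ?q l * ?R l)\<bar> \<le> (\<Sum>l<m. ?L\<^sup>2 * ((t - s) / m)\<^sup>2)"
        unfolding expectation_grid_count[OF st E] sum_subtractf[symmetric]
      proof (rule order_trans[OF sum_abs sum_mono])
        fix l
        have "E \<in> sets (F (?g l))" using E sets_F_mono[OF g(1)] by blast
        from short_time_second[OF g(2) g(3) this ji[symmetric]]
        show "\<bar>measure Q {\<omega> \<in> E. state (?g l) \<omega> = j \<and> state (?g (Suc l)) \<omega> = i} - ?q l * ?R l\<bar> \<le> ?L\<^sup>2 * ((t - s) / m)\<^sup>2"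
          by (simp add: grid_Suc)
      qed
      also have "\<dots> = ?L\<^sup>2 * (t - s)\<^sup>2 / m"
        using elim by (simp add: power_divide power2_eq_square)
      finally have 1: "\<bar>?a m - (\<integral>\<omega>. indicator E \<omega> * ?f \<omega> \<partial>Q)\<bar> \<le> ?L\<^sup>2 * (t - s)\<^sup>2 / m"
        unfolding b .
      have i_int: "integrable Q (\<lambda>\<omega>. indicator E \<omega> * integrated_intensity i j s t \<omega>)"
        using EQ integrated_intensity_measurable[of i j s t] integrated_intensity_bound[OF _ st(2)] rate_bound(1) st
        by (intro completed.integrable_const_bound[where B = "rate_bound * (t - s)"])
          (auto simp: indicator_def intro!: AE_I2)
      have "\<bar>(\<integral>\<omega>. indicator E \<omega> * ?f \<omega> \<partial>Q) - ?r\<bar>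
          = \<bar>\<integral>\<omega>. indicator E \<omega> * ?f \<omega> - indicator E \<omega> * integrated_intensity i j s t \<omega> \<partial>Q\<bar>"
        by (simp only: Bochner_Integration.integral_diff[OF f_int i_int])
      also have "\<dots> \<le> (\<integral>\<omega>. \<bar>indicator E \<omega> * ?f \<omega> - indicator E \<omega> * integrated_intensity i j s t \<omega>\<bar> \<partial>Q)"
        by (rule integral_abs_bound)
      also have "\<dots> \<le> (\<integral>\<omega>. rate_bound * ((t - s) / m) * real (total_count s t \<omega>) \<partial>Q)"
      proof (rule integral_mono)
        fix \<omega> assume "\<omega> \<in> space Q"
        then have "\<bar>?f \<omega> - integrated_intensity i j s t \<omega>\<bar> \<le> rate_bound * ((t - s) / m) * real (total_count s t \<omega>)"
          using riemann_error[OF _ st elim, of \<omega> j i] by simp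
        moreover have "\<bar>indicator E \<omega> * ?f \<omega> - indicator E \<omega> * integrated_intensity i j s t \<omega>\<bar> \<le> \<bar>?f \<omega> - integrated_intensity i j s t \<omega>\<bar>"
          by (auto simp: indicator_def)
        ultimately show "\<bar>indicator E \<omega> * ?f \<omega> - indicator E \<omega> * integrated_intensity i j s t \<omega>\<bar> \<le> rate_bound * ((t - s) / m) * real (total_count s t \<omega>)"
          by linarith
      qed (use f_int i_int total_count_integrable[OF st] in auto)
      also have "\<dots> = rate_bound * (t - s) * (\<integral>\<omega>. real (total_count s t \<omega>) \<partial>Q) / m"
        by simp
      finally have "norm (?a m - ?r) \<le> ?L\<^sup>2 * (t - s)\<^sup>2 / m + rate_bound * (t - s) * (\<integral>\<omega>. real (total_count s t \<omega>) \<partial>Q) / m"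
        unfolding real_norm_def using 1 by linarith
      then show ?case by (simp only: add_divide_distrib)
    qed
    show "(\<lambda>m. ?C / real m) \<longlonglongrightarrow> 0" by (rule lim_const_over_n)
  qed
qed

section \<open>The predictable sigma-algebra inside the product sigma-algebra\<close>

lemma sets_pair_lborel: "sets (Q \<Otimes>\<^sub>M lborel) = sets (Q \<Otimes>\<^sub>M borel)"
  by (intro sets_pair_measure_cong) simp_all

lemma intensity_measurable_lborel: "intensity i j \<in> borel_measurable (Q \<Otimes>\<^sub>M lborel)"
  using intensity_measurable measurable_cong_sets[OF sets_pair_lborel refl] by blast

abbreviation predictable_generator :: "('a \<times> real) set set" where
  "predictable_generator \<equiv> {E \<times> {0} | E. E \<in> sets (F 0)} \<union>
      {E \<times> {s<..t} | E s t. 0 \<le> s \<and> s \<le> t \<and> E \<in> sets (F s)}"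

lemma sets_F_space: "E \<in> sets (F s) \<Longrightarrow> E \<subseteq> space P"
  using sets.sets_into_space[of E "F s"] by simp

lemma predictable_generator_Pow: "predictable_generator \<subseteq> Pow (space P \<times> {0::real..})"
  using sets_F_space by fastforce

lemma space_predictable: "space (predictable_algebra P X) = space P \<times> {0::real..}"
  using predictable_generator_Pow unfolding predictable_algebra_def by (rule space_measure_of)

lemma sets_predictable: "sets (predictable_algebra P X) = sigma_sets (space P \<times> {0::real..}) predictable_generator"
  using predictable_generator_Pow unfolding predictable_algebra_def by (rule sets_measure_of)

lemma space_P_in_F: "space P \<in> sets (F s)"
  using sets.top[of "F s"] by simp

lemma space_P_in_Q: "space P \<in> sets Q"
  using sets.top[of Q] by simp

lemma sets_predictable_subset: "sets (predictable_algebra P X) \<subseteq> sets (Q \<Otimes>\<^sub>M lborel)"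
  unfolding sets_predictable sets_pair_lborel
proof (rule sets.sigma_sets_subset')
  show "predictable_generator \<subseteq> sets (Q \<Otimes>\<^sub>M borel)"
    using sets_F_subset by (auto intro!: pair_measureI)
  show "space P \<times> {0::real..} \<in> sets (Q \<Otimes>\<^sub>M borel)"
    by (intro pair_measureI space_P_in_Q borel_closed closed_atLeast)
qed

text \<open>Two rectangles over intervals meet in one that starts at the later of the left ends,
  where both events already belong to the filtration.\<close>

lemma Int_stable_predictable_generator: "Int_stable predictable_generator"
proof (rule Int_stableI)
  fix a b assume a: "a \<in> predictable_generator" and b: "b \<in> predictable_generator"
  have empty: "{} \<in> predictable_generator"
    by (intro UnI1 CollectI exI[of _ "{}"]) auto
  from a consider (a0) E where "a = E \<times> {0}" "E \<in> sets (F 0)"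
    | (a1) E s t where "a = E \<times> {s<..t}" "0 \<le> s" "s \<le> t" "E \<in> sets (F s)" by blast
  then show "a \<inter> b \<in> predictable_generator"
  proof cases
    case a0
    from b consider (b0) E' where "b = E' \<times> {0}" "E' \<in> sets (F 0)"
      | (b1) E' s' t' where "b = E' \<times> {s'<..t'}" "0 \<le> s'" by blast
    then show ?thesis
    proof cases
      case b0
      then have "a \<inter> b = (E \<inter> E') \<times> {0}" "E \<inter> E' \<in> sets (F 0)" using a0 by auto
      then show ?thesis by blast
    next
      case b1
      then have "a \<inter> b = {}" using a0 by auto
      with empty show ?thesis by simp
    qed
  next
    case a1
    from b consider (b0) E' where "b = E' \<times> {0}"
      | (b1) E' s' t' where "b = E' \<times> {s'<..t'}" "0 \<le> s'" "s' \<le> t'" "E' \<in> sets (F s')" by blast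
    then show ?thesis
    proof cases
      case b0
      then have "a \<inter> b = {}" using a1 by auto
      with empty show ?thesis by simp
    next
      case b1
      have eq: "a \<inter> b = (E \<inter> E') \<times> {max s s'<..min t t'}" using a1 b1 by auto
      show ?thesis
      proof (cases "max s s' \<le> min t t'")
        case True
        have "E \<in> sets (F (max s s'))" "E' \<in> sets (F (max s s'))"
          using a1 b1 sets_F_mono[of s "max s s'"] sets_F_mono[of s' "max s s'"] by auto
        then have "E \<inter> E' \<in> sets (F (max s s'))" by auto
        with True eq a1(2) show ?thesis by (intro UnI2 CollectI exI conjI) auto
      next
        case False
        then have "a \<inter> b = {}" unfolding eq by auto
        with empty show ?thesis by simp
      qed
    qed
  qed
qed

section \<open>The jump measure and its compensator on predictable sets\<close>

text \<open>The predictable compensator of the jump measure, averaged over paths. The horizon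
  \<open>T\<close> keeps it finite, as the passage to complements requires.\<close>

definition intensity_measure :: "'n \<Rightarrow> 'n \<Rightarrow> real \<Rightarrow> ('a \<times> real) measure" where
  "intensity_measure i j T =
     density (Q \<Otimes>\<^sub>M lborel) (\<lambda>x. ennreal (intensity i j x) * indicator (space P \<times> {0<..T}) x)"

text \<open>The random jump measure evaluated at \<open>B\<close>. Counting with values in
  \<open>ennreal\<close> makes it additive over disjoint sets without finiteness conditions.\<close>

definition jumps_in :: "'n \<Rightarrow> 'n \<Rightarrow> real \<Rightarrow> ('a \<times> real) set \<Rightarrow> 'a \<Rightarrow> ennreal" where
  "jumps_in j i T B \<omega> =
     emeasure (count_space UNIV) {t \<in> jumps_between (trajectory \<omega>) j i. t \<le> T \<and> (\<omega>, t) \<in> B}"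

lemma intensity_nonneg: "i \<noteq> j \<Longrightarrow> 0 \<le> intensity i j x"
  by (simp add: intensity_def rate_nonneg)

lemma sets_intensity_measure: "sets (intensity_measure i j T) = sets (Q \<Otimes>\<^sub>M lborel)"
  by (simp add: intensity_measure_def)

lemma emeasure_intensity_measure:
  assumes B: "B \<in> sets (Q \<Otimes>\<^sub>M lborel)"
  shows "emeasure (intensity_measure i j T) B
    = (\<integral>\<^sup>+\<omega>. \<integral>\<^sup>+r. ennreal (intensity i j (\<omega>, r)) * indicator {0<..T} r * indicator B (\<omega>, r) \<partial>lborel \<partial>Q)"
proof -
  have [measurable]: "intensity i j \<in> borel_measurable (Q \<Otimes>\<^sub>M lborel)" by (rule intensity_measurable_lborel)
  have [measurable]: "space P \<times> {0<..T} \<in> sets (Q \<Otimes>\<^sub>M lborel)"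
    using space_P_in_Q by (intro pair_measureI) auto
  note B [measurable]
  have "emeasure (intensity_measure i j T) B
      = (\<integral>\<^sup>+x. ennreal (intensity i j x) * indicator (space P \<times> {0<..T}) x * indicator B x \<partial>(Q \<Otimes>\<^sub>M lborel))"
    unfolding intensity_measure_def by (rule emeasure_density) measurable
  also have "\<dots> = (\<integral>\<^sup>+\<omega>. \<integral>\<^sup>+r. ennreal (intensity i j (\<omega>, r)) * indicator (space P \<times> {0<..T}) (\<omega>, r) * indicator B (\<omega>, r) \<partial>lborel \<partial>Q)"
    by (rule lborel.nn_integral_fst[symmetric]) measurable
  also have "\<dots> = (\<integral>\<^sup>+\<omega>. \<integral>\<^sup>+r. ennreal (intensity i j (\<omega>, r)) * indicator {0<..T} r * indicator B (\<omega>, r) \<partial>lborel \<partial>Q)"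
    by (intro nn_integral_cong) (auto simp: indicator_def)
  finally show ?thesis .
qed

text \<open>Only the trace of \<open>B\<close> on times in \<open>{0<..T}\<close> has to be a
  rectangle. One statement thus covers generators cut off at \<open>T\<close>, generators at time
  zero, whose trace is empty, and the whole space.\<close>

lemma jumps_in_rectangle:
  assumes E: "E \<in> sets (F s)" and st: "0 \<le> s" "s \<le> t" and tT: "t \<le> T" and ji: "j \<noteq> i"
    and B: "B \<in> sets (Q \<Otimes>\<^sub>M lborel)" and BE: "B \<inter> (UNIV \<times> {0<..T}) = E \<times> {s<..t}"
  shows "jumps_in j i T B \<in> borel_measurable Q \<and>
    (\<integral>\<^sup>+\<omega>. jumps_in j i T B \<omega> \<partial>Q) = emeasure (intensity_measure i j T) B"
proof -
  have EQ: "E \<in> sets Q" using E sets_F_subset by blast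
  have eq: "jumps_in j i T B \<omega> = ennreal (indicator E \<omega> * real (jump_count j i s t \<omega>))" if \<omega>: "\<omega> \<in> space Q" for \<omega>
  proof -
    have "{r \<in> jumps_between (trajectory \<omega>) j i. r \<le> T \<and> (\<omega>, r) \<in> B}
        = {r \<in> jumps_between (trajectory \<omega>) j i. (\<omega>, r) \<in> B \<inter> (UNIV \<times> {0<..T})}"
      by (auto simp: jumps_between_def)
    also have "\<dots> = (if \<omega> \<in> E then jumps_between (trajectory \<omega>) j i \<inter> {s<..t} else {})"
      unfolding BE by auto
    finally have 1: "{r \<in> jumps_between (trajectory \<omega>) j i. r \<le> T \<and> (\<omega>, r) \<in> B}
        = (if \<omega> \<in> E then jumps_between (trajectory \<omega>) j i \<inter> {s<..t} else {})" .
    have sp: "step_path (trajectory \<omega>)" using \<omega> by (simp add: step_path)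
    have "finite (jumps_between (trajectory \<omega>) j i \<inter> {s<..t})"
      by (rule finite_subset[OF _ finite_jumps[OF sp, of t]]) (use st jumps_between_subset[OF ji, of "trajectory \<omega>"] in auto)
    then show ?thesis
      unfolding jumps_in_def 1 by (auto simp: jump_count_def emeasure_count_space_finite ennreal_of_nat_eq_real_of_nat)
  qed
  have meas: "(\<lambda>\<omega>. indicator E \<omega> * real (jump_count j i s t \<omega>)) \<in> borel_measurable Q"
    using EQ jump_count_measurable[OF st ji] by measurable
  have m: "jumps_in j i T B \<in> borel_measurable Q"
    by (rule measurable_cong[THEN iffD2, OF eq]) (use meas in simp_all)
  have "(\<integral>\<^sup>+\<omega>. jumps_in j i T B \<omega> \<partial>Q) = (\<integral>\<^sup>+\<omega>. ennreal (indicator E \<omega> * real (jump_count j i s t \<omega>)) \<partial>Q)"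
    by (rule nn_integral_cong[OF eq])
  also have "\<dots> = ennreal (\<integral>\<omega>. indicator E \<omega> * real (jump_count j i s t \<omega>) \<partial>Q)"
    using integrable_mult_indicator[OF EQ jump_count_integrable[OF st ji]]
    by (intro nn_integral_eq_integral) simp_all
  also have "\<dots> = ennreal (\<integral>\<omega>. indicator E \<omega> * integrated_intensity i j s t \<omega> \<partial>Q)"
    by (simp only: jump_count_compensator[OF st E ji])
  also have "\<dots> = (\<integral>\<^sup>+\<omega>. ennreal (indicator E \<omega> * integrated_intensity i j s t \<omega>) \<partial>Q)"
  proof (rule nn_integral_eq_integral[symmetric])
    show "integrable Q (\<lambda>\<omega>. indicator E \<omega> * integrated_intensity i j s t \<omega>)"
      using EQ integrated_intensity_measurable[of i j s t] integrated_intensity_bound[OF _ st(2)] rate_bound(1) st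
      by (intro completed.integrable_const_bound[where B = "rate_bound * (t - s)"])
        (auto simp: indicator_def intro!: AE_I2)
    show "AE \<omega> in Q. 0 \<le> indicator E \<omega> * integrated_intensity i j s t \<omega>"
      unfolding integrated_intensity_def set_lebesgue_integral_def
      using intensity_nonneg ji by (intro AE_I2 mult_nonneg_nonneg integral_nonneg) auto
  qed
  also have "\<dots> = (\<integral>\<^sup>+\<omega>. \<integral>\<^sup>+r. ennreal (intensity i j (\<omega>, r)) * indicator {0<..T} r * indicator B (\<omega>, r) \<partial>lborel \<partial>Q)"
  proof (rule nn_integral_cong)
    fix \<omega> assume "\<omega> \<in> space Q"
    then have \<omega>: "\<omega> \<in> space P" by simp
    have "ennreal (integrated_intensity i j s t \<omega>) = (\<integral>\<^sup>+r. ennreal (indicator {s<..t} r *\<^sub>R intensity i j (\<omega>, r)) \<partial>lborel)"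
      unfolding integrated_intensity_def set_lebesgue_integral_def
      using bounded_set_integrable[OF intensity_measurable_section[OF \<omega>] intensity_bound] intensity_nonneg ji
      by (intro nn_integral_eq_integral[symmetric]) (auto simp: set_integrable_def)
    then have "ennreal (indicator E \<omega> * integrated_intensity i j s t \<omega>)
        = indicator E \<omega> * (\<integral>\<^sup>+r. ennreal (indicator {s<..t} r *\<^sub>R intensity i j (\<omega>, r)) \<partial>lborel)"
      by (auto simp: indicator_def)
    also have "\<dots> = (\<integral>\<^sup>+r. indicator E \<omega> * ennreal (indicator {s<..t} r *\<^sub>R intensity i j (\<omega>, r)) \<partial>lborel)"
      using intensity_measurable_section[OF \<omega>] by (intro nn_integral_cmult[symmetric]) measurable
    also have "\<dots> = (\<integral>\<^sup>+r. ennreal (intensity i j (\<omega>, r)) * indicator {0<..T} r * indicator B (\<omega>, r) \<partial>lborel)"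
    proof (rule nn_integral_cong)
      fix r
      have "(r \<in> {0<..T} \<and> (\<omega>, r) \<in> B) = (\<omega> \<in> E \<and> r \<in> {s<..t})"
        using BE by (auto simp: set_eq_iff)
      then show "indicator E \<omega> * ennreal (indicator {s<..t} r *\<^sub>R intensity i j (\<omega>, r))
          = ennreal (intensity i j (\<omega>, r)) * indicator {0<..T} r * indicator B (\<omega>, r)"
        by (cases "r \<in> {0<..T}"; cases "(\<omega>, r) \<in> B"; cases "\<omega> \<in> E"; cases "r \<in> {s<..t}") simp_all
    qed
    finally show "ennreal (indicator E \<omega> * integrated_intensity i j s t \<omega>)
        = (\<integral>\<^sup>+r. ennreal (intensity i j (\<omega>, r)) * indicator {0<..T} r * indicator B (\<omega>, r) \<partial>lborel)" .
  qed
  also have "\<dots> = emeasure (intensity_measure i j T) B"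
    by (rule emeasure_intensity_measure[OF B, symmetric])
  finally show ?thesis using m by blast
qed

text \<open>A monotone class argument starting from the predictable rectangles. Measurability of the
  count is part of the induction claim, since the expectations for complements and unions depend on
  it.\<close>

lemma jumps_in_compensator:
  assumes T: "0 \<le> T" and ji: "j \<noteq> i" and B: "B \<in> sets (predictable_algebra P X)"
  shows "jumps_in j i T B \<in> borel_measurable Q \<and>
    (\<integral>\<^sup>+\<omega>. jumps_in j i T B \<omega> \<partial>Q) = emeasure (intensity_measure i j T) B"
  using Int_stable_predictable_generator predictable_generator_Pow B[unfolded sets_predictable]
proof (induction rule: sigma_sets_induct_disjoint)
  case (basic B)
  then have B: "B \<in> sets (Q \<Otimes>\<^sub>M lborel)"
    using sets_predictable_subset sigma_sets.Basic[OF basic] unfolding sets_predictable by blast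
  from basic consider (0) E where "B = E \<times> {0}"
    | (1) E s t where "B = E \<times> {s<..t}" "0 \<le> s" "s \<le> t" "E \<in> sets (F s)" by blast
  then show ?case
  proof cases
    case 0
    \<comment> \<open>No positive time lies in \<open>B\<close>, so an empty rectangle represents
      its trace.\<close>
    then have "B \<inter> (UNIV \<times> {0<..T}) = {} \<times> {0<..0}" by auto
    with jumps_in_rectangle[of "{}" 0 0, OF _ _ _ T ji B] show ?thesis by auto
  next
    case 1
    show ?thesis
    proof (cases "s \<le> T")
      case True
      then have "B \<inter> (UNIV \<times> {0<..T}) = E \<times> {s<..min t T}" using 1 by auto
      with jumps_in_rectangle[OF 1(4,2), of "min t T", OF _ _ ji B] True 1(3) show ?thesis by auto
    next
      case False
      then have "B \<inter> (UNIV \<times> {0<..T}) = {} \<times> {0<..0}" using 1 by auto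
      with jumps_in_rectangle[of "{}" 0 0, OF _ _ _ T ji B] show ?thesis by auto
    qed
  qed
next
  case empty
  show ?case by (simp add: jumps_in_def)
next
  case (compl B)
  let ?\<Omega> = "space P \<times> {0::real..}"
  have B: "B \<in> sets (Q \<Otimes>\<^sub>M lborel)" using compl.hyps sets_predictable_subset sets_predictable by blast
  have \<Omega>: "?\<Omega> \<in> sets (Q \<Otimes>\<^sub>M lborel)" using space_P_in_Q by (intro pair_measureI) auto
  have BO: "B \<subseteq> ?\<Omega>" using sigma_sets_into_sp[OF predictable_generator_Pow compl.hyps] .
  have "?\<Omega> \<inter> (UNIV \<times> {0<..T}) = space P \<times> {0<..T}" by auto
  note full = jumps_in_rectangle[OF space_P_in_F order_refl T order_refl ji \<Omega> this]
  have finite_jumps_T: "finite (jumps_between (trajectory \<omega>) j i \<inter> {..T})" if "\<omega> \<in> space P" for \<omega>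
    by (rule finite_subset[OF _ finite_jumps[OF step_path[OF that], of T]])
      (use ji in \<open>auto simp: jumps_between_def jumps_def\<close>)
  have Beq: "jumps_in j i T (?\<Omega> - B) \<omega> = jumps_in j i T ?\<Omega> \<omega> - jumps_in j i T B \<omega>"
    and le: "jumps_in j i T B \<omega> \<le> jumps_in j i T ?\<Omega> \<omega>" if \<omega>: "\<omega> \<in> space Q" for \<omega>
  proof -
    let ?S = "\<lambda>B. {t \<in> jumps_between (trajectory \<omega>) j i. t \<le> T \<and> (\<omega>, t) \<in> B}"
    have fin: "finite (?S B)" using finite_jumps_T[of \<omega>] \<omega> by (auto intro: finite_subset[rotated])
    have sub: "?S B \<subseteq> ?S ?\<Omega>" using BO by auto
    have "?S (?\<Omega> - B) = ?S ?\<Omega> - ?S B" by auto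
    moreover have "emeasure (count_space UNIV) (?S ?\<Omega> - ?S B) = emeasure (count_space UNIV) (?S ?\<Omega>) - emeasure (count_space UNIV) (?S B)"
      using fin sub by (intro emeasure_Diff) (auto simp: emeasure_count_space_finite)
    ultimately show "jumps_in j i T (?\<Omega> - B) \<omega> = jumps_in j i T ?\<Omega> \<omega> - jumps_in j i T B \<omega>"
      by (simp only: jumps_in_def)
    show "jumps_in j i T B \<omega> \<le> jumps_in j i T ?\<Omega> \<omega>"
      unfolding jumps_in_def using sub by (intro emeasure_mono) auto
  qed
  \<comment> \<open>Subtracting expectations for a complement is legitimate because the expected
    number of all jumps up to \<open>T\<close> is finite.\<close>
  have fin: "(\<integral>\<^sup>+\<omega>. jumps_in j i T ?\<Omega> \<omega> \<partial>Q) < \<infinity>"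
  proof -
    have "(\<integral>\<^sup>+\<omega>. jumps_in j i T ?\<Omega> \<omega> \<partial>Q) = (\<integral>\<^sup>+\<omega>. ennreal (real (jump_count j i 0 T \<omega>)) \<partial>Q)"
    proof (rule nn_integral_cong)
      fix \<omega> assume "\<omega> \<in> space Q"
      then have "{t \<in> jumps_between (trajectory \<omega>) j i. t \<le> T \<and> (\<omega>, t) \<in> ?\<Omega>} = jumps_between (trajectory \<omega>) j i \<inter> {0<..T}"
        "finite (jumps_between (trajectory \<omega>) j i \<inter> {0<..T})"
        using finite_jumps_T[of \<omega>] by (auto simp: jumps_between_def intro: finite_subset[rotated])
      then show "jumps_in j i T ?\<Omega> \<omega> = ennreal (real (jump_count j i 0 T \<omega>))"
        by (simp add: jumps_in_def jump_count_def emeasure_count_space_finite ennreal_of_nat_eq_real_of_nat)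
    qed
    also have "\<dots> < \<infinity>"
      using jump_count_integrable[OF order_refl T ji] by (simp add: integrable_iff_bounded)
    finally show ?thesis .
  qed
  have "(\<integral>\<^sup>+\<omega>. jumps_in j i T B \<omega> \<partial>Q) \<le> (\<integral>\<^sup>+\<omega>. jumps_in j i T ?\<Omega> \<omega> \<partial>Q)"
    by (rule nn_integral_mono[OF le])
  with fin have finB: "(\<integral>\<^sup>+\<omega>. jumps_in j i T B \<omega> \<partial>Q) \<noteq> \<infinity>" by auto
  have m: "jumps_in j i T (?\<Omega> - B) \<in> borel_measurable Q"
    using full compl.IH by (intro measurable_cong[THEN iffD2, OF Beq] borel_measurable_minus_ennreal) simp_all
  have "(\<integral>\<^sup>+\<omega>. jumps_in j i T (?\<Omega> - B) \<omega> \<partial>Q) = (\<integral>\<^sup>+\<omega>. jumps_in j i T ?\<Omega> \<omega> - jumps_in j i T B \<omega> \<partial>Q)"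
    by (rule nn_integral_cong[OF Beq])
  also have "\<dots> = (\<integral>\<^sup>+\<omega>. jumps_in j i T ?\<Omega> \<omega> \<partial>Q) - (\<integral>\<^sup>+\<omega>. jumps_in j i T B \<omega> \<partial>Q)"
    using full compl.IH finB le by (intro nn_integral_diff) (auto intro: AE_I2)
  also have "\<dots> = emeasure (intensity_measure i j T) (?\<Omega> - B)"
    using full compl.IH finB \<Omega> B BO by (subst emeasure_Diff) (simp_all add: sets_intensity_measure)
  finally show ?case using m by blast
next
  case (union B)
  have B: "B n \<in> sets (Q \<Otimes>\<^sub>M lborel)" for n
    using union.hyps(2) sets_predictable_subset unfolding sets_predictable by blast
  have eq: "jumps_in j i T (\<Union>n. B n) \<omega> = (\<Sum>n. jumps_in j i T (B n) \<omega>)" for \<omega>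
  proof -
    have "{t \<in> jumps_between (trajectory \<omega>) j i. t \<le> T \<and> (\<omega>, t) \<in> (\<Union>n. B n)}
        = (\<Union>n. {t \<in> jumps_between (trajectory \<omega>) j i. t \<le> T \<and> (\<omega>, t) \<in> B n})" by auto
    moreover have "disjoint_family (\<lambda>n. {t \<in> jumps_between (trajectory \<omega>) j i. t \<le> T \<and> (\<omega>, t) \<in> B n})"
      using union.hyps(1) by (fastforce simp: disjoint_family_on_def)
    ultimately show ?thesis
      unfolding jumps_in_def by (subst suminf_emeasure) auto
  qed
  have "jumps_in j i T (\<Union>n. B n) \<in> borel_measurable Q"
    unfolding eq[abs_def] using union.IH by (intro borel_measurable_suminf_order) auto
  moreover have "(\<integral>\<^sup>+\<omega>. jumps_in j i T (\<Union>n. B n) \<omega> \<partial>Q) = (\<Sum>n. \<integral>\<^sup>+\<omega>. jumps_in j i T (B n) \<omega> \<partial>Q)"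
    unfolding eq using union.IH by (intro nn_integral_suminf) auto
  moreover have "\<dots> = (\<Sum>n. emeasure (intensity_measure i j T) (B n))"
    using union.IH by simp
  moreover have "\<dots> = emeasure (intensity_measure i j T) (\<Union>n. B n)"
    using B union.hyps(1) by (intro suminf_emeasure) (auto simp: sets_intensity_measure)
  ultimately show ?case by simp
qed

text \<open>The expected number of jumps in \<open>B\<close> is zero, so the compensator formula
  makes the integral over \<open>B\<close> of a nonnegative function zero. Horizons run through the
  natural numbers to reach all positive times.\<close>

lemma intensity_null_if_no_jumps:
  assumes ji: "j \<noteq> i" and B: "B \<in> sets (predictable_algebra P X)"
    and no: "AE \<omega> in Q. \<forall>t\<in>jumps_between (trajectory \<omega>) j i. (\<omega>, t) \<notin> B"
  shows "AE x in Q \<Otimes>\<^sub>M lborel. x \<in> B \<longrightarrow> intensity i j x = 0"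
proof -
  have BQ: "B \<in> sets (Q \<Otimes>\<^sub>M lborel)" using B sets_predictable_subset by blast
  have [measurable]: "intensity i j \<in> borel_measurable (Q \<Otimes>\<^sub>M lborel)" by (rule intensity_measurable_lborel)
  have [measurable]: "space P \<times> {0<..T} \<in> sets (Q \<Otimes>\<^sub>M lborel)" for T :: real
    using space_P_in_Q by (intro pair_measureI) auto
  note BQ [measurable]
  have "AE x in Q \<Otimes>\<^sub>M lborel. x \<in> B \<longrightarrow> x \<in> space P \<times> {0<..real n} \<longrightarrow> intensity i j x = 0" for n :: nat
  proof -
    have "(\<integral>\<^sup>+\<omega>. jumps_in j i n B \<omega> \<partial>Q) = (\<integral>\<^sup>+\<omega>. 0 \<partial>Q)"
    proof (rule nn_integral_cong_AE)
      show "AE \<omega> in Q. jumps_in j i n B \<omega> = 0"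
        using no
      proof eventually_elim
        case (elim \<omega>)
        then have eq: "{t \<in> jumps_between (trajectory \<omega>) j i. t \<le> real n \<and> (\<omega>, t) \<in> B} = {}" by auto
        show ?case unfolding jumps_in_def eq by simp
      qed
    qed
    then have "emeasure (intensity_measure i j n) B = 0"
      using jumps_in_compensator[OF of_nat_0_le_iff ji B] by simp
    then have "(\<integral>\<^sup>+x. ennreal (intensity i j x) * indicator (space P \<times> {0<..real n}) x * indicator B x \<partial>(Q \<Otimes>\<^sub>M lborel)) = 0"
      unfolding intensity_measure_def by (subst (asm) emeasure_density) measurable
    then have "AE x in Q \<Otimes>\<^sub>M lborel. ennreal (intensity i j x) * indicator (space P \<times> {0<..real n}) x * indicator B x = 0"
      by (subst (asm) nn_integral_0_iff_AE) measurable
    then show ?thesis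
    proof eventually_elim
      case (elim x)
      then show ?case using intensity_nonneg[of i j x] ji by (auto simp: indicator_def ennreal_eq_0_iff)
    qed
  qed
  then have "AE x in Q \<Otimes>\<^sub>M lborel. \<forall>n. x \<in> B \<longrightarrow> x \<in> space P \<times> {0<..real n} \<longrightarrow> intensity i j x = 0"
    by (subst AE_all_countable) blast
  then show ?thesis
  proof eventually_elim
    case (elim x)
    show ?case
    proof
      assume xB: "x \<in> B"
      show "intensity i j x = 0"
      \<comment> \<open>Off this set the intensity vanishes by definition; on it the time is
        positive, so some horizon contains the point.\<close>
      proof (cases "x \<in> pre_jump_set j")
        case True
        obtain n where "snd x \<le> real n" using real_arch_simple by blast
        then have "x \<in> space P \<times> {0<..real n}" using True by (auto simp: pre_jump_set_def)
        then show ?thesis using elim xB by blast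
      qed (simp add: intensity_def)
    qed
  qed
qed

end

section \<open>Holding times and the jumps of the martingale\<close>

text \<open>Passes from Lebesgue-almost everywhere to the negligible sets on which an integrand of
  the gauge integral may be altered.\<close>

lemma AE_lborel_negligible:
  fixes R :: "real \<Rightarrow> bool"
  assumes "AE r in lborel. R r"
  obtains N where "negligible N" "\<And>r. r \<notin> N \<Longrightarrow> R r"
proof -
  from assms obtain N where "N \<in> null_sets lborel" "{r \<in> space lborel. \<not> R r} \<subseteq> N"
    by (auto simp: eventually_ae_filter)
  then show thesis
    using that[of N] by (auto simp: negligible_iff_null_sets null_sets_completionI)
qed

section \<open>The bracket density at a basis vector\<close>

lemma matrix_mult_axis_nth:
  fixes B :: "real ^ 'n ^ 'n"
  shows "(B *v axis j 1) $ i = B $ i $ j"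
  by (simp add: matrix_vector_mult_basis column_def)

lemma inner_matrix_axis:
  fixes B :: "real ^ 'n ^ 'n"
  shows "w \<bullet> (B *v axis j 1) = (\<Sum>i\<in>UNIV. w $ i * B $ i $ j)"
  by (simp add: inner_vec_def matrix_mult_axis_nth)

text \<open>As column \<open>j\<close> sums to zero, the product is the sum over \<open>i\<close> of
  \<open>B $ i $ j * (w $ i - w $ j)\<close>: only differences across the rates enter.\<close>

lemma inner_column_zero:
  fixes B :: "real ^ 'n ^ 'n"
  assumes col: "(\<Sum>i\<in>UNIV. B $ i $ j) = 0" and w: "\<And>i. B $ i $ j * (w $ i - w $ j) = 0"
  shows "w \<bullet> (B *v axis j 1) = 0"
proof -
  have "w \<bullet> (B *v axis j 1) = (\<Sum>i\<in>UNIV. B $ i $ j * (w $ i - w $ j) + w $ j * B $ i $ j)"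
    unfolding inner_matrix_axis by (rule sum.cong) (auto simp: algebra_simps)
  also have "\<dots> = 0" using col by (simp add: w flip: sum_distrib_left)
  finally show ?thesis .
qed

text \<open>With zero column sums the quadratic form is the sum over \<open>i\<close> of
  \<open>B $ i $ j * (w $ i - w $ j)\<^sup>2\<close>. Under the hypothesis on \<open>w\<close> the
  three terms of the bracket density vanish one by one.\<close>

lemma bracket_density_axis_zero:
  fixes B :: "real ^ 'n ^ 'n"
  assumes col: "(\<Sum>i\<in>UNIV. B $ i $ j) = 0" and w: "\<And>i. B $ i $ j * (w $ i - w $ j) = 0"
  shows "w \<bullet> (bracket_density B (axis j 1) *v w) = 0"
proof -
  let ?D = "diag_mat (axis j 1 :: real ^ 'n)"
  have D: "?D *v x = x $ j *\<^sub>R axis j 1" for x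
    by (simp add: vec_eq_iff diag_mat_def matrix_vector_mult_def axis_def if_distrib[of "\<lambda>a. a * _"] sum.If_cases)
  have "w \<bullet> (diag_mat (B *v axis j 1) *v w) = (\<Sum>i\<in>UNIV. w $ i * (B $ i $ j * w $ i))"
    by (simp add: inner_vec_def diag_mat_def matrix_vector_mult_def[of "\<chi> i k. _ i k"] matrix_mult_axis_nth if_distrib[of "\<lambda>a. a * _"] sum.If_cases)
  \<comment> \<open>The hypothesis says
    \<open>B $ i $ j * w $ i = B $ i $ j * w $ j\<close>.\<close>
  also have "\<dots> = (\<Sum>i\<in>UNIV. w $ j * (w $ i * B $ i $ j))"
    using w by (intro sum.cong) (auto simp: algebra_simps)
  also have "\<dots> = w $ j * (w \<bullet> (B *v axis j 1))"
    by (simp add: inner_matrix_axis sum_distrib_left)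
  finally have 1: "w \<bullet> (diag_mat (B *v axis j 1) *v w) = 0"
    using inner_column_zero[OF assms] by simp
  have 2: "w \<bullet> ((B ** ?D) *v w) = 0"
    using inner_column_zero[OF assms] by (simp add: D matrix_vector_mul_assoc[symmetric] matrix_vector_mult_scaleR)
  have "w \<bullet> ((?D ** transpose B) *v w) = w $ j * (axis j 1 \<bullet> (transpose B *v w))"
    by (simp add: D matrix_vector_mul_assoc[symmetric] inner_axis inner_axis')
  also have "axis j 1 \<bullet> (transpose B *v w) = w \<bullet> (B *v axis j 1)"
    by (metis dot_lmul_matrix inner_commute matrix_vector_mul transpose_matrix_vector)
  finally have 3: "w \<bullet> ((?D ** transpose B) *v w) = 0"
    using inner_column_zero[OF assms] by simp
  from 1 2 3 show ?thesis
    by (simp add: bracket_density_def matrix_vector_mult_diff_rdistrib inner_diff_right)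
qed

context rate_markov_chain begin

section \<open>Jumps of the martingale part\<close>

definition compensator_density :: "'a \<Rightarrow> real \<Rightarrow> real ^ 'n" where
  "compensator_density \<omega> s = A s *v left_lim (\<lambda>r. X r \<omega>) s"

lemma compensator_density_eq:
  "\<omega> \<in> space P \<Longrightarrow> 0 < s \<Longrightarrow> compensator_density \<omega> s = A s *v axis (before (trajectory \<omega>) s) 1"
  by (simp add: compensator_density_def left_lim_X)

text \<open>The density is a finite sum of intensities, which are measurable and bounded, times
  basis vectors. At time zero the left limit is arbitrary, so that point is discarded.\<close>

lemma compensator_density_integrable:
  assumes \<omega>: "\<omega> \<in> space P"
  shows "compensator_density \<omega> integrable_on {0..t}"
proof -
  have "(\<lambda>s. \<Sum>k\<in>UNIV. \<Sum>j\<in>UNIV. intensity k j (\<omega>, s) *\<^sub>R (axis k 1 :: real ^ 'n)) integrable_on {0..t}"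
  proof (intro integrable_sum integrable_on_scaleR_left)
    fix k j
    show "(\<lambda>s. intensity k j (\<omega>, s)) integrable_on {0..t}"
      using bounded_absolutely_integrable[OF intensity_measurable_section[OF \<omega>] intensity_bound]
      by (rule set_lebesgue_integral_eq_integral(1))
  qed auto
  then show ?thesis
  proof (rule integrable_spike_finite[of "{0}", rotated 2])
    fix s assume s: "s \<in> {0..t} - {0}"
    have "(\<Sum>k\<in>UNIV. \<Sum>j\<in>UNIV. intensity k j (\<omega>, s) *\<^sub>R (axis k 1 :: real ^ 'n)) $ i = (\<Sum>j\<in>UNIV. intensity i j (\<omega>, s))" for i
    proof -
      have "(\<Sum>k\<in>UNIV. \<Sum>j\<in>UNIV. intensity k j (\<omega>, s) *\<^sub>R (axis k 1 :: real ^ 'n)) $ i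
          = (\<Sum>k\<in>UNIV. if k = i then \<Sum>j\<in>UNIV. intensity k j (\<omega>, s) else 0)"
        unfolding sum_component by (intro sum.cong refl) (simp add: axis_def)
      then show ?thesis by simp
    qed
    moreover have "(\<Sum>j\<in>UNIV. intensity i j (\<omega>, s)) = rate i (before (trajectory \<omega>) s) s" for i
    proof -
      have "(\<Sum>j\<in>UNIV. intensity i j (\<omega>, s)) = (\<Sum>j\<in>UNIV. if j = before (trajectory \<omega>) s then rate i j s else 0)"
        using \<omega> s by (intro sum.cong refl) (auto simp: intensity_def pre_jump_set_def)
      then show ?thesis by simp
    qed
    ultimately show "compensator_density \<omega> s = (\<Sum>k\<in>UNIV. \<Sum>j\<in>UNIV. intensity k j (\<omega>, s) *\<^sub>R (axis k 1 :: real ^ 'n))"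
      using s \<omega> by (simp add: vec_eq_iff compensator_density_eq matrix_mult_axis_nth rate_def)
  qed simp
qed

lemma mart_part_eq: "mart_part A X t \<omega> = X t \<omega> - X 0 \<omega> - integral {0..t} (compensator_density \<omega>)"
  by (simp add: mart_part_def compensator_density_def[abs_def])

text \<open>The compensator is an indefinite integral and hence continuous, so the martingale jumps
  exactly as the chain does.\<close>

lemma mart_jump_eq:
  assumes \<omega>: "\<omega> \<in> space P" and t: "0 < t"
  shows "mart_jump A X t \<omega> = axis (state t \<omega>) 1 - axis (before (trajectory \<omega>) t) 1"
proof -
  let ?I = "\<lambda>r. integral {0..r} (compensator_density \<omega>)"
  have pos: "\<forall>\<^sub>F r in at_left t. 0 < r"
    using eventually_at_left_real[OF t] by eventually_elim auto
  have "continuous_on {0..t} ?I"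
    by (rule indefinite_integral_continuous_1[OF compensator_density_integrable[OF \<omega>]])
  then have "(?I \<longlongrightarrow> ?I t) (at t within {0..t})"
    using t by (simp add: continuous_on_def)
  then have I: "(?I \<longlongrightarrow> ?I t) (at_left t)"
    using t by (simp add: at_within_Icc_at_left)
  have "((\<lambda>r. X r \<omega>) \<longlongrightarrow> axis (before (trajectory \<omega>) t) 1) (at_left t)"
  proof (rule tendsto_eventually)
    from pos step_path_before[OF step_path[OF \<omega>] t]
    show "\<forall>\<^sub>F r in at_left t. X r \<omega> = axis (before (trajectory \<omega>) t) 1"
      by eventually_elim (use \<omega> X_eq_axis in auto)
  qed
  then have "((\<lambda>r. X r \<omega> - X 0 \<omega> - ?I r) \<longlongrightarrow> axis (before (trajectory \<omega>) t) 1 - X 0 \<omega> - ?I t) (at_left t)"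
    by (intro tendsto_diff I tendsto_const)
  then have "left_lim (\<lambda>r. mart_part A X r \<omega>) t = axis (before (trajectory \<omega>) t) 1 - X 0 \<omega> - ?I t"
    unfolding mart_part_eq left_lim_def by (intro tendsto_Lim trivial_limit_at_left_real)
  moreover have "mart_part A X t \<omega> = axis (state t \<omega>) 1 - X 0 \<omega> - ?I t"
    using X_eq_axis[OF less_imp_le[OF t] \<omega>] by (simp add: mart_part_eq)
  ultimately show ?thesis by (simp add: mart_jump_def)
qed

text \<open>The sum in \<open>mart_integral\<close> thus runs over a finite set; over an infinite
  one it would default to zero.\<close>

lemma mart_jump_times:
  "\<omega> \<in> space P \<Longrightarrow> {s \<in> {0<..t}. mart_jump A X s \<omega> \<noteq> 0} = jumps (trajectory \<omega>) \<inter> {0<..t}"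
  by (auto simp: mart_jump_eq jumps_def axis_eq_axis)

text \<open>Within one step of this length the chain leaves its state with conditional probability at
  most one half.\<close>

definition hold_time :: real where
  "hold_time = 1 / (2 * (CARD('n) * rate_bound))"

lemma hold_time: "0 < hold_time" "CARD('n) * rate_bound * hold_time = 1 / 2"
  using rate_bound(1) by (simp_all add: hold_time_def)

text \<open>All jumps from \<open>i\<close> to \<open>k\<close> in the window are counted, also
  those after a return to \<open>i\<close>; an upper bound is all that the holding argument asks
  for.\<close>

lemma expected_jumps_from_state:
  assumes s: "0 \<le> s" and ki: "k \<noteq> i"
  shows "(\<integral>\<omega>. indicator {\<omega> \<in> space P. state s \<omega> = i} \<omega> * real (jump_count i k s (s + hold_time) \<omega>) \<partial>Q)
    \<le> rate_bound * hold_time * measure Q {\<omega> \<in> space P. state s \<omega> = i}"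
proof -
  let ?E = "{\<omega> \<in> space P. state s \<omega> = i}"
  have st: "0 \<le> s" "s \<le> s + hold_time" using s hold_time by auto
  have E: "?E \<in> sets (F s)" by (rule state_in_F[OF s order_refl])
  have EQ: "?E \<in> sets Q" by (rule measurable_state_sets[OF s])
  have "(\<integral>\<omega>. indicator ?E \<omega> * real (jump_count i k s (s + hold_time) \<omega>) \<partial>Q)
      = (\<integral>\<omega>. indicator ?E \<omega> * integrated_intensity k i s (s + hold_time) \<omega> \<partial>Q)"
    by (rule jump_count_compensator[OF st E ki[symmetric]])
  also have "\<dots> \<le> (\<integral>\<omega>. indicator ?E \<omega> * (rate_bound * hold_time) \<partial>Q)"
  proof (rule integral_mono)
    have b: "\<bar>integrated_intensity k i s (s + hold_time) \<omega>\<bar> \<le> rate_bound * hold_time" if "\<omega> \<in> space P" for \<omega>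
      using integrated_intensity_bound[OF that st(2)] by simp
    show "integrable Q (\<lambda>\<omega>. indicator ?E \<omega> * integrated_intensity k i s (s + hold_time) \<omega>)"
    proof (rule completed.integrable_const_bound[where B = "rate_bound * hold_time"])
      show "AE \<omega> in Q. norm (indicator ?E \<omega> * integrated_intensity k i s (s + hold_time) \<omega>) \<le> rate_bound * hold_time"
        using b rate_bound(1) hold_time(1) by (auto simp: indicator_def intro!: AE_I2)
    qed (use EQ integrated_intensity_measurable[of k i s "s + hold_time"] in measurable)
    show "integrable Q (\<lambda>\<omega>. indicator ?E \<omega> * (rate_bound * hold_time))"
      using EQ by (intro integrable_mult_left integrable_real_indicator) (auto simp: completed.emeasure_eq_measure)
    show "indicator ?E \<omega> * integrated_intensity k i s (s + hold_time) \<omega> \<le> indicator ?E \<omega> * (rate_bound * hold_time)"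
      if "\<omega> \<in> space Q" for \<omega>
      using b[of \<omega>] that by (intro mult_left_mono) auto
  qed
  also have "\<dots> = rate_bound * hold_time * measure Q ?E"
    using EQ sets.sets_into_space[OF EQ] by (simp add: Int_absorb2)
  finally show ?thesis .
qed

text \<open>Otherwise almost every path in state \<open>i\<close> at time \<open>s\<close> would
  have a first jump in the window, necessarily out of \<open>i\<close>. The expected number of jumps
  out of \<open>i\<close> would then be at least the probability of the event, while the choice of
  \<open>hold_time\<close> bounds it by half of that. The property \<open>R\<close> carries along
  whatever holds almost surely.\<close>

lemma exists_holding_path:
  assumes s: "0 \<le> s" and pos: "0 < measure Q {\<omega> \<in> space P. state s \<omega> = i}" and R: "AE \<omega> in Q. R \<omega>"
  obtains \<omega> where "\<omega> \<in> space P" "R \<omega>" "state s \<omega> = i" "jumps (trajectory \<omega>) \<inter> {s<..s + hold_time} = {}"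
proof (rule ccontr)
  assume "\<not> thesis"
  with that have none: "\<And>\<omega>. \<omega> \<in> space P \<Longrightarrow> R \<omega> \<Longrightarrow> state s \<omega> = i \<Longrightarrow> jumps (trajectory \<omega>) \<inter> {s<..s + hold_time} \<noteq> {}"
    by blast
  let ?E = "{\<omega> \<in> space P. state s \<omega> = i}"
  let ?N = "\<lambda>k \<omega>. real (jump_count i k s (s + hold_time) \<omega>)"
  have st: "0 \<le> s" "s \<le> s + hold_time" using s hold_time by auto
  have EQ: "?E \<in> sets Q" by (rule measurable_state_sets[OF s])
  have int: "integrable Q (\<lambda>\<omega>. indicator ?E \<omega> * ?N k \<omega>)" if "k \<in> - {i}" for k
    using integrable_mult_indicator[OF EQ jump_count_integrable[OF st, of i k]] that by simp
  have "measure Q ?E = (\<integral>\<omega>. indicator ?E \<omega> \<partial>Q)"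
    using EQ sets.sets_into_space[OF EQ] by (simp add: Int_absorb2)
  also have "\<dots> \<le> (\<integral>\<omega>. (\<Sum>k\<in>-{i}. indicator ?E \<omega> * ?N k \<omega>) \<partial>Q)"
  proof (rule integral_mono_AE)
    show "integrable Q (indicator ?E :: 'a \<Rightarrow> real)"
      using EQ by (intro integrable_real_indicator) (auto simp: completed.emeasure_eq_measure)
    show "integrable Q (\<lambda>\<omega>. \<Sum>k\<in>-{i}. indicator ?E \<omega> * ?N k \<omega>)"
      using int by (rule Bochner_Integration.integrable_sum)
    show "AE \<omega> in Q. indicator ?E \<omega> \<le> (\<Sum>k\<in>-{i}. indicator ?E \<omega> * ?N k \<omega>)"
      using R AE_space
    proof eventually_elim
      case (elim \<omega>)
      show ?case
      proof (cases "\<omega> \<in> ?E")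
        case True
        let ?J = "jumps (trajectory \<omega>) \<inter> {s<..s + hold_time}"
        have sp: "step_path (trajectory \<omega>)" using True by (simp add: step_path)
        have fin: "finite ?J"
          by (rule finite_subset[OF _ finite_jumps[OF sp, of "s + hold_time"]]) (use s in auto)
        have ne: "?J \<noteq> {}" using none[of \<omega>] elim(1) True by blast
        \<comment> \<open>The first jump after \<open>s\<close>; until then the path stays in
          \<open>i\<close>.\<close>
        define \<tau> where "\<tau> = Min ?J"
        have \<tau>: "\<tau> \<in> ?J" unfolding \<tau>_def using fin ne by (rule Min_in)
        have "jumps (trajectory \<omega>) \<inter> {s<..<\<tau>} = {}"
        proof (rule ccontr)
          assume "jumps (trajectory \<omega>) \<inter> {s<..<\<tau>} \<noteq> {}"
          then obtain r where r: "r \<in> jumps (trajectory \<omega>) \<inter> {s<..<\<tau>}" by blast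
          with \<tau> have "r \<in> ?J" by auto
          with Min_le[OF fin, of r] r show False by (simp add: \<tau>_def)
        qed
        then have "before (trajectory \<omega>) \<tau> = i"
          using step_path_before_constant[OF sp s, of \<tau>] \<tau> True by auto
        then have k: "\<tau> \<in> jumps_between (trajectory \<omega>) i (state \<tau> \<omega>) \<inter> {s<..s + hold_time}" "state \<tau> \<omega> \<noteq> i"
          using \<tau> s by (auto simp: jumps_between_def jumps_def)
        have "finite (jumps_between (trajectory \<omega>) i (state \<tau> \<omega>) \<inter> {s<..s + hold_time})"
          by (rule finite_subset[OF _ fin]) (use jumps_between_subset[OF k(2)[symmetric], of "trajectory \<omega>"] in auto)
        then have "0 < jump_count i (state \<tau> \<omega>) s (s + hold_time) \<omega>"
          using k unfolding jump_count_def by (auto simp: card_gt_0_iff)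
        then have N: "1 \<le> indicator ?E \<omega> * ?N (state \<tau> \<omega>) \<omega>" using True by simp
        have "indicator ?E \<omega> = (1 :: real)" using True by simp
        also have "1 \<le> indicator ?E \<omega> * ?N (state \<tau> \<omega>) \<omega>" by (rule N)
        also have "\<dots> \<le> (\<Sum>k\<in>-{i}. indicator ?E \<omega> * ?N k \<omega>)"
          using k(2) by (intro member_le_sum) auto
        finally show ?thesis .
      qed simp
    qed
  qed
  also have "\<dots> = (\<Sum>k\<in>-{i}. \<integral>\<omega>. indicator ?E \<omega> * ?N k \<omega> \<partial>Q)"
    using int by (rule Bochner_Integration.integral_sum)
  also have "\<dots> \<le> (\<Sum>k\<in>-{i}. rate_bound * hold_time * measure Q ?E)"
    using expected_jumps_from_state[OF s, of _ i] by (intro sum_mono) auto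
  also have "\<dots> \<le> CARD('n) * (rate_bound * hold_time * measure Q ?E)"
    using rate_bound(1) hold_time(1) card_mono[of "UNIV :: 'n set" "-{i}"]
    by (auto intro!: mult_right_mono)
  also have "\<dots> = measure Q ?E / 2" using hold_time(2) by (simp add: algebra_simps)
  finally show False using pos by simp
qed

end

section \<open>Markovian solutions\<close>

locale markovian_solution = rate_markov_chain P X A i0
  for P :: "'a measure" and X :: "real \<Rightarrow> 'a \<Rightarrow> real ^ 'n" and A :: "real \<Rightarrow> real ^ 'n ^ 'n" and i0 :: 'n +
  fixes f :: "'a \<Rightarrow> real \<Rightarrow> real \<Rightarrow> real ^ 'n \<Rightarrow> real"
    and Y :: "real \<Rightarrow> 'a \<Rightarrow> real"
    and Z :: "real \<Rightarrow> 'a \<Rightarrow> real ^ 'n"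
    and u :: "real \<Rightarrow> real ^ 'n \<Rightarrow> real"
  assumes positive: "0 < t \<Longrightarrow> measure P {\<omega> \<in> space P. X t \<omega> = axis i 1} > 0"
    and dynamics: "0 < T \<Longrightarrow> solution P A X f T Y Z"
    and markovian: "markovian P X Y u"
begin

section \<open>The pathwise form of the equation\<close>

abbreviation v :: "real \<Rightarrow> real ^ 'n" where "v \<equiv> vec_of_fun u"

text \<open>The continuous part of the dynamics. Between jumps M moves by minus the compensator
  density, so both terms enter with the same sign and \<open>Y\<close> changes by minus this
  drift.\<close>

definition drift :: "'a \<Rightarrow> real \<Rightarrow> real" where
  "drift \<omega> r = f \<omega> r (left_lim (\<lambda>r. Y r \<omega>) r) (Z r \<omega>) + Z r \<omega> \<bullet> compensator_density \<omega> r"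

definition jump_sum :: "'a \<Rightarrow> real \<Rightarrow> real" where
  "jump_sum \<omega> t = (\<Sum>s\<in>jumps (trajectory \<omega>) \<inter> {0<..t}. Z s \<omega> \<bullet> (axis (state s \<omega>) 1 - axis (before (trajectory \<omega>) s) 1))"

text \<open>Collects what is demanded of a single path: the Markov form and the equation at all
  times simultaneously, outside one null set of paths.\<close>

definition regular :: "'a \<Rightarrow> bool" where
  "regular \<omega> \<longleftrightarrow> \<omega> \<in> space P \<and> (\<forall>t\<ge>0. Y t \<omega> = v t $ state t \<omega> \<and>
     drift \<omega> absolutely_integrable_on {0..t} \<and>
     Y t \<omega> = Y 0 \<omega> - integral {0..t} (drift \<omega>) + jump_sum \<omega> t)"

lemma regularD:
  assumes "regular \<omega>"
  shows "\<omega> \<in> space P"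
    and "0 \<le> t \<Longrightarrow> Y t \<omega> = v t $ state t \<omega>"
    and "0 \<le> t \<Longrightarrow> drift \<omega> absolutely_integrable_on {0..t}"
    and "0 \<le> t \<Longrightarrow> Y t \<omega> = Y 0 \<omega> - integral {0..t} (drift \<omega>) + jump_sum \<omega> t"
  using assms unfolding regular_def by blast+

lemma solution_pathwise:
  assumes \<omega>: "\<omega> \<in> space P" and t: "0 \<le> t"
    and F: "(\<lambda>s. f \<omega> s (left_lim (\<lambda>r. Y r \<omega>) s) (Z s \<omega>)) absolutely_integrable_on {0..t}"
    and M: "mart_integrable A X Z t \<omega>"
    and eq: "Y t \<omega> = Y 0 \<omega> - integral {0..t} (\<lambda>s. f \<omega> s (left_lim (\<lambda>r. Y r \<omega>) s) (Z s \<omega>)) + mart_integral A X Z t \<omega>"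
  shows "drift \<omega> absolutely_integrable_on {0..t} \<and> Y t \<omega> = Y 0 \<omega> - integral {0..t} (drift \<omega>) + jump_sum \<omega> t"
proof -
  have M': "(\<lambda>s. Z s \<omega> \<bullet> compensator_density \<omega> s) absolutely_integrable_on {0..t}"
    using M by (simp add: mart_integrable_def compensator_density_def)
  have "mart_integral A X Z t \<omega> = jump_sum \<omega> t - integral {0..t} (\<lambda>s. Z s \<omega> \<bullet> compensator_density \<omega> s)"
    unfolding mart_integral_def mart_jump_times[OF \<omega>] jump_sum_def compensator_density_def[symmetric]
    using \<omega> by (simp add: mart_jump_eq)
  moreover have "integral {0..t} (drift \<omega>) = integral {0..t} (\<lambda>s. f \<omega> s (left_lim (\<lambda>r. Y r \<omega>) s) (Z s \<omega>))
      + integral {0..t} (\<lambda>s. Z s \<omega> \<bullet> compensator_density \<omega> s)"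
    unfolding drift_def[abs_def]
    using F M' by (intro Henstock_Kurzweil_Integration.integral_add set_lebesgue_integral_eq_integral(1))
  moreover have "drift \<omega> absolutely_integrable_on {0..t}"
    unfolding drift_def[abs_def] using F M' by (rule set_integral_add(1))
  ultimately show ?thesis using eq by simp
qed

lemma AE_regular: "AE \<omega> in Q. regular \<omega>"
proof -
  \<comment> \<open>The null set of the solution property depends on the horizon; countably many
    horizons suffice. The successor keeps each of them positive.\<close>
  have "AE \<omega> in Q. \<forall>t\<in>{0..real (Suc n)}.
        (\<lambda>s. f \<omega> s (left_lim (\<lambda>r. Y r \<omega>) s) (Z s \<omega>)) absolutely_integrable_on {0..t} \<and>
        mart_integrable A X Z t \<omega> \<and>
        Y t \<omega> = Y 0 \<omega> - integral {0..t} (\<lambda>s. f \<omega> s (left_lim (\<lambda>r. Y r \<omega>) s) (Z s \<omega>))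
                 + mart_integral A X Z t \<omega>" for n :: nat
    using dynamics[of "real (Suc n)"] unfolding solution_def by simp
  then have "AE \<omega> in Q. \<forall>n. \<forall>t\<in>{0..real (Suc n)}.
        (\<lambda>s. f \<omega> s (left_lim (\<lambda>r. Y r \<omega>) s) (Z s \<omega>)) absolutely_integrable_on {0..t} \<and>
        mart_integrable A X Z t \<omega> \<and>
        Y t \<omega> = Y 0 \<omega> - integral {0..t} (\<lambda>s. f \<omega> s (left_lim (\<lambda>r. Y r \<omega>) s) (Z s \<omega>))
                 + mart_integral A X Z t \<omega>"
    by (subst AE_all_countable) blast
  moreover have "AE \<omega> in Q. \<forall>t\<ge>0. Y t \<omega> = u t (X t \<omega>)"
    using markovian unfolding markovian_def .
  ultimately show ?thesis
    using AE_space
  proof eventually_elim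
    case (elim \<omega>)
    have \<omega>: "\<omega> \<in> space P" using elim(3) by simp
    show ?case
      unfolding regular_def
    proof (intro conjI allI impI)
      fix t :: real assume t: "0 \<le> t"
      show "Y t \<omega> = v t $ state t \<omega>"
        using elim(2) t X_eq_axis[OF t \<omega>] by (simp add: vec_of_fun_def)
      obtain n where "t \<le> real n" using real_arch_simple by blast
      then have "t \<in> {0..real (Suc n)}" using t by simp
      with elim(1) show "drift \<omega> absolutely_integrable_on {0..t}"
        "Y t \<omega> = Y 0 \<omega> - integral {0..t} (drift \<omega>) + jump_sum \<omega> t"
        using solution_pathwise[OF \<omega> t] by blast+
    qed (rule \<omega>)
  qed
qed

text \<open>At time zero only the initial state has positive probability; this is the source of the
  case distinction that recurs up to the final equation.\<close>

lemma state_positive: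
  assumes "0 \<le> s" "0 < s \<or> i = i0"
  shows "0 < measure Q {\<omega> \<in> space P. state s \<omega> = i}"
proof (cases "0 < s")
  case True
  have eq: "{\<omega> \<in> space P. state s \<omega> = i} = {\<omega> \<in> space P. X s \<omega> = axis i 1}"
    using X_eq_axis_iff[OF assms(1)] by auto
  have "{\<omega> \<in> space P. X s \<omega> = axis i 1} = X s -` {axis i 1} \<inter> space P" by auto
  also have "\<dots> \<in> sets P" by (rule measurable_sets[OF X_measurable[OF assms(1)]]) simp
  finally show ?thesis using positive[OF True, of i] by (simp add: eq)
next
  case False
  then have "{\<omega> \<in> space P. state s \<omega> = i} = space Q" using assms state_0 by auto
  then show ?thesis by (simp only: completed.prob_space)
qed

text \<open>The jump sum is the same at both ends, so \<open>Y\<close> changes only by the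
  drift.\<close>

lemma regular_no_jumps:
  assumes reg: "regular \<omega>" and st: "0 \<le> s" "s \<le> t" and nj: "jumps (trajectory \<omega>) \<inter> {s<..t} = {}"
  shows "drift \<omega> absolutely_integrable_on {s..t}" "state t \<omega> = state s \<omega>"
    "v t $ state s \<omega> = v s $ state s \<omega> - integral {s..t} (drift \<omega>)"
proof -
  have \<omega>: "\<omega> \<in> space P" by (rule regularD(1)[OF reg])
  have int: "drift \<omega> absolutely_integrable_on {0..t}" by (rule regularD(3)[OF reg]) (use st in simp)
  then show "drift \<omega> absolutely_integrable_on {s..t}"
    by (rule absolutely_integrable_on_subinterval) (use st in auto)
  show state: "state t \<omega> = state s \<omega>"
    using step_path_constant[OF step_path[OF \<omega>] st(1,2) order_refl nj] .
  have value_eq: "v r $ state r \<omega> = Y 0 \<omega> - integral {0..r} (drift \<omega>) + jump_sum \<omega> r" if "0 \<le> r" for r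
    using regularD(2,4)[OF reg that] by simp
  have "jumps (trajectory \<omega>) \<inter> {0<..t} = jumps (trajectory \<omega>) \<inter> {0<..s}"
    using nj st by force
  then have "jump_sum \<omega> t = jump_sum \<omega> s" by (simp only: jump_sum_def)
  moreover have "integral {0..t} (drift \<omega>) = integral {0..s} (drift \<omega>) + integral {s..t} (drift \<omega>)"
    using Henstock_Kurzweil_Integration.integral_combine[OF st(1,2) set_lebesgue_integral_eq_integral(1)[OF int]] by simp
  moreover from value_eq[of s] value_eq[of t] have "v s $ state s \<omega> = Y 0 \<omega> - integral {0..s} (drift \<omega>) + jump_sum \<omega> s"
    "v t $ state s \<omega> = Y 0 \<omega> - integral {0..t} (drift \<omega>) + jump_sum \<omega> t"
    using st state by auto
  ultimately show "v t $ state s \<omega> = v s $ state s \<omega> - integral {s..t} (drift \<omega>)" by simp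
qed

section \<open>Continuity of the value and the relation at jumps\<close>

lemma continuous_value_ivl:
  assumes s: "0 \<le> s" "0 < s \<or> i = i0"
  shows "continuous_on {s..s + hold_time} (\<lambda>t. v t $ i)"
proof -
  from exists_holding_path[OF s(1) state_positive[OF s] AE_regular]
  obtain \<omega> where \<omega>: "regular \<omega>" "state s \<omega> = i" "jumps (trajectory \<omega>) \<inter> {s<..s + hold_time} = {}" .
  have hold: "s \<le> s + hold_time" using hold_time by simp
  have eq: "v t $ i = v s $ i - integral {s..t} (drift \<omega>)" if "t \<in> {s..s + hold_time}" for t
  proof -
    have "jumps (trajectory \<omega>) \<inter> {s<..t} = {}" using \<omega>(3) that by auto
    then show ?thesis using regular_no_jumps(3)[OF \<omega>(1) s(1), of t] that \<omega>(2) by simp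
  qed
  have "continuous_on {s..s + hold_time} (\<lambda>t. v s $ i - integral {s..t} (drift \<omega>))"
    by (intro continuous_intros indefinite_integral_continuous_1 set_lebesgue_integral_eq_integral(1)
        regular_no_jumps(1)[OF \<omega>(1) s(1) hold \<omega>(3)])
  then show ?thesis
    by (rule continuous_on_eq) (rule eq[symmetric])
qed

lemma isCont_value:
  assumes "0 < t"
  shows "isCont (\<lambda>t. v t $ i) t"
proof -
  \<comment> \<open>A start left of \<open>t\<close> that is positive, as an arbitrary
    \<open>i\<close> requires, and less than one window away, so that \<open>t\<close> is an
    interior point.\<close>
  define s where "s = max (t / 2) (t - hold_time / 2)"
  have s: "0 < s" "s < t" "t < s + hold_time"
    using assms hold_time(1) by (auto simp: s_def max_def)
  show ?thesis
    by (rule continuous_on_interior[OF continuous_value_ivl[of s i]]) (use s in auto)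
qed

text \<open>Just before \<open>\<tau>\<close> the equation holds for the value at \<open>j\<close>,
  with the jump sum short of the term at \<open>\<tau>\<close>. Continuity of the value and of the
  integral carries this to \<open>\<tau>\<close>, and subtracting it from the equation there
  isolates the jump term.\<close>

lemma jump_relation:
  assumes reg: "regular \<omega>" and \<tau>: "\<tau> \<in> jumps_between (trajectory \<omega>) j i" and ji: "j \<noteq> i"
  shows "Z \<tau> \<omega> \<bullet> (axis i 1 - axis j 1) = v \<tau> $ i - v \<tau> $ j"
proof -
  have \<omega>: "\<omega> \<in> space P" by (rule regularD(1)[OF reg])
  note sp = step_path[OF \<omega>]
  have \<tau>': "0 < \<tau>" "before (trajectory \<omega>) \<tau> = j" "state \<tau> \<omega> = i" "\<tau> \<in> jumps (trajectory \<omega>)"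
    using \<tau> ji by (auto simp: jumps_between_def jumps_def)
  let ?J = "jumps (trajectory \<omega>) \<inter> {0<..\<tau>}"
  let ?z = "Z \<tau> \<omega> \<bullet> (axis i 1 - axis j 1)"
  have fin: "finite ?J" by (rule finite_jumps[OF sp])
  let ?I = "\<lambda>r. integral {0..r} (drift \<omega>)"
  have Y: "Y r \<omega> = v r $ state r \<omega>" "Y r \<omega> = Y 0 \<omega> - ?I r + jump_sum \<omega> r" if "0 \<le> r" for r
    by (fact regularD(2)[OF reg that], fact regularD(4)[OF reg that])
  have ev: "\<forall>\<^sub>F r in at_left \<tau>. v r $ j = Y 0 \<omega> - ?I r + (jump_sum \<omega> \<tau> - ?z)"
  proof -
    \<comment> \<open>The last jump before \<open>\<tau>\<close>, or zero if there is none.\<close>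
    obtain p where p: "p < \<tau>" "0 \<le> p" "\<forall>r\<in>?J. r \<noteq> \<tau> \<longrightarrow> r \<le> p"
    proof
      show "Max (insert 0 (?J - {\<tau>})) < \<tau>" "0 \<le> Max (insert 0 (?J - {\<tau>}))"
        using fin \<tau>'(1) by (auto simp: Max_less_iff)
      show "\<forall>r\<in>?J. r \<noteq> \<tau> \<longrightarrow> r \<le> Max (insert 0 (?J - {\<tau>}))"
        using fin by (auto intro!: Max_ge)
    qed
    have "\<forall>\<^sub>F r in at_left \<tau>. r \<in> {p<..<\<tau>}" by (rule eventually_at_left_real[OF p(1)])
    with step_path_before[OF sp \<tau>'(1)] show ?thesis
    proof eventually_elim
      case (elim r)
      have "?J = insert \<tau> (jumps (trajectory \<omega>) \<inter> {0<..r})" "\<tau> \<notin> jumps (trajectory \<omega>) \<inter> {0<..r}"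
        using p \<tau>' elim(2) by force+
      moreover have "finite (jumps (trajectory \<omega>) \<inter> {0<..r})" by (rule finite_jumps[OF sp])
      ultimately have "jump_sum \<omega> \<tau> = ?z + jump_sum \<omega> r"
        by (simp add: jump_sum_def \<tau>')
      then show ?case using Y[of r] elim p(2) \<tau>'(2) by simp
    qed
  qed
  have "continuous_on {0..\<tau>} ?I"
    using \<tau>'(1) by (intro indefinite_integral_continuous_1 set_lebesgue_integral_eq_integral(1) regularD(3)[OF reg]) simp
  then have "(?I \<longlongrightarrow> ?I \<tau>) (at \<tau> within {0..\<tau>})"
    using \<tau>'(1) by (simp add: continuous_on_def)
  then have "(?I \<longlongrightarrow> ?I \<tau>) (at_left \<tau>)"
    using \<tau>'(1) by (simp add: at_within_Icc_at_left)
  then have "((\<lambda>r. Y 0 \<omega> - ?I r + (jump_sum \<omega> \<tau> - ?z)) \<longlongrightarrow> Y 0 \<omega> - ?I \<tau> + (jump_sum \<omega> \<tau> - ?z)) (at_left \<tau>)"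
    by (intro tendsto_intros)
  then have "((\<lambda>r. v r $ j) \<longlongrightarrow> Y 0 \<omega> - ?I \<tau> + (jump_sum \<omega> \<tau> - ?z)) (at_left \<tau>)"
    by (rule tendsto_cong[THEN iffD2, OF ev])
  moreover have "((\<lambda>r. v r $ j) \<longlongrightarrow> v \<tau> $ j) (at_left \<tau>)"
    using isCont_value[OF \<tau>'(1), of j] unfolding isCont_def by (rule tendsto_within_subset) simp
  ultimately have "v \<tau> $ j = Y 0 \<omega> - ?I \<tau> + (jump_sum \<omega> \<tau> - ?z)"
    using tendsto_unique[OF trivial_limit_at_left_real] by blast
  then show ?thesis using Y[of \<tau>] \<tau>' by simp
qed

section \<open>The value as a predictable process\<close>

lemma time_predictable: "snd \<in> borel_measurable (predictable_algebra P X)"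
proof (rule borel_measurableI_le)
  fix y :: real
  show "{x \<in> space (predictable_algebra P X). snd x \<le> y} \<in> sets (predictable_algebra P X)"
  proof (cases "0 \<le> y")
    case True
    then have "{x \<in> space (predictable_algebra P X). snd x \<le> y} = (space P \<times> {0}) \<union> (space P \<times> {0<..y})"
      by (auto simp: space_predictable)
    moreover have "space P \<times> {0} \<in> sets (predictable_algebra P X)" "space P \<times> {0<..y} \<in> sets (predictable_algebra P X)"
      unfolding sets_predictable using True space_P_in_F by (blast intro: sigma_sets.Basic)+
    ultimately show ?thesis by auto
  next
    case False
    then have "{x \<in> space (predictable_algebra P X). snd x \<le> y} = {}"
      by (auto simp: space_predictable)
    then show ?thesis by (simp only: sets.empty_sets)
  qed
qed

lemma value_predictable_component:
  "(\<lambda>x. v (snd x) $ i) \<in> borel_measurable (predictable_algebra P X)"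
proof -
  \<comment> \<open>Continuity is known at positive times only; at time zero the components other
    than \<open>i0\<close> are arbitrary, so the function is glued to a constant there.\<close>
  have "(\<lambda>t. if t \<in> {0<..} then v t $ i else v 0 $ i) \<in> borel_measurable borel"
    using isCont_value[of _ i]
    by (intro borel_measurable_continuous_on_if continuous_at_imp_continuous_on continuous_on_const) auto
  from measurable_compose[OF time_predictable this] show ?thesis
    by (rule measurable_cong[THEN iffD1, rotated]) (auto simp: space_predictable order_le_less)
qed

text \<open>Makes the deterministic value admissible in the hypotheses that quantify over
  predictable integrands.\<close>

lemma value_predictable: "predictable P X (\<lambda>t \<omega>. v t)"
proof -
  have "(\<lambda>x. \<Sum>i\<in>UNIV. v (snd x) $ i *\<^sub>R (axis i 1 :: real ^ 'n)) \<in> borel_measurable (predictable_algebra P X)"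
    using value_predictable_component by measurable
  moreover have "(\<Sum>i\<in>UNIV. w $ i *\<^sub>R axis i 1) = w" for w :: "real ^ 'n"
    using basis_expansion[of w] by (simp add: scalar_mult_eq_scaleR)
  ultimately show ?thesis by (simp add: predictable_def case_prod_beta')
qed

lemma Z_predictable: "predictable P X Z"
  using dynamics[of 1] by (simp add: solution_def)

section \<open>Equivalence of Z and the value\<close>

text \<open>The jump times of a path form a Lebesgue null set, so the jump relation alone says
  nothing almost everywhere; the compensator formula transfers it to almost all pairs of path and
  time at which such a jump has nonzero intensity.\<close>

lemma AE_value_differences:
  "AE x in Q \<Otimes>\<^sub>M lborel. \<forall>i j. i \<noteq> j \<longrightarrow> x \<in> pre_jump_set j \<longrightarrow> rate i j (snd x) \<noteq> 0 \<longrightarrow>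
     Z (snd x) (fst x) \<bullet> (axis i 1 - axis j 1) = v (snd x) $ i - v (snd x) $ j"
proof -
  have "AE x in Q \<Otimes>\<^sub>M lborel. i \<noteq> j \<longrightarrow> x \<in> pre_jump_set j \<longrightarrow> rate i j (snd x) \<noteq> 0 \<longrightarrow>
     Z (snd x) (fst x) \<bullet> (axis i 1 - axis j 1) = v (snd x) $ i - v (snd x) $ j" for i j
  proof (cases "i = j")
    case False
    define B where "B = {x \<in> space (predictable_algebra P X).
      Z (snd x) (fst x) \<bullet> (axis i 1 - axis j 1) \<noteq> v (snd x) $ i - v (snd x) $ j}"
    have [measurable]: "(\<lambda>x. Z (snd x) (fst x)) \<in> borel_measurable (predictable_algebra P X)"
      using Z_predictable by (simp add: predictable_def case_prod_beta')
    note value_predictable_component [measurable]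
    have "B \<in> sets (predictable_algebra P X)" unfolding B_def by measurable
    moreover have "AE \<omega> in Q. \<forall>t\<in>jumps_between (trajectory \<omega>) j i. (\<omega>, t) \<notin> B"
      using AE_regular by eventually_elim (use jump_relation False in \<open>auto simp: B_def\<close>)
    ultimately have "AE x in Q \<Otimes>\<^sub>M lborel. x \<in> B \<longrightarrow> intensity i j x = 0"
      using False by (intro intensity_null_if_no_jumps) auto
    then show ?thesis
    proof eventually_elim
      case (elim x)
      then show ?case
        by (auto simp: B_def space_predictable pre_jump_set_def intensity_def indicator_def)
    qed
  qed simp
  then show ?thesis by (intro AE_all_countable[THEN iffD2] allI)
qed

lemma value_difference_column:
  assumes \<omega>: "\<omega> \<in> space P" and t: "0 < t"
    and eq: "\<forall>i j. i \<noteq> j \<longrightarrow> (\<omega>, t) \<in> pre_jump_set j \<longrightarrow> rate i j t \<noteq> 0 \<longrightarrow>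
       Z t \<omega> \<bullet> (axis i 1 - axis j 1) = v t $ i - v t $ j"
  shows "A t $ i $ before (trajectory \<omega>) t *
    ((Z t \<omega> - v t) $ i - (Z t \<omega> - v t) $ before (trajectory \<omega>) t) = 0"
proof -
  let ?j = "before (trajectory \<omega>) t"
  have "(\<omega>, t) \<in> pre_jump_set ?j" using \<omega> t by (simp add: pre_jump_set_def)
  then have "i = ?j \<or> A t $ i $ ?j = 0 \<or> Z t \<omega> \<bullet> (axis i 1 - axis ?j 1) = v t $ i - v t $ ?j"
    using eq t by (auto simp: rate_def)
  then show ?thesis by (auto simp: inner_diff_right inner_axis)
qed

lemma inner_compensator_density:
  assumes \<omega>: "\<omega> \<in> space P" and t: "0 < t"
    and eq: "\<forall>i j. i \<noteq> j \<longrightarrow> (\<omega>, t) \<in> pre_jump_set j \<longrightarrow> rate i j t \<noteq> 0 \<longrightarrow>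
       Z t \<omega> \<bullet> (axis i 1 - axis j 1) = v t $ i - v t $ j"
  shows "Z t \<omega> \<bullet> compensator_density \<omega> t = v t \<bullet> (A t *v axis (before (trajectory \<omega>) t) 1)"
proof -
  have "(Z t \<omega> - v t) \<bullet> (A t *v axis (before (trajectory \<omega>) t) 1) = 0"
    using inner_column_zero[OF A_column_sum value_difference_column[OF assms]] t by simp
  then show ?thesis using \<omega> t by (simp add: compensator_density_eq inner_diff_left)
qed

lemma M_norm_value:
  assumes \<omega>: "\<omega> \<in> space P" and t: "0 < t"
    and eq: "\<forall>i j. i \<noteq> j \<longrightarrow> (\<omega>, t) \<in> pre_jump_set j \<longrightarrow> rate i j t \<noteq> 0 \<longrightarrow>
       Z t \<omega> \<bullet> (axis i 1 - axis j 1) = v t $ i - v t $ j"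
  shows "M_norm A X t \<omega> (Z t \<omega> - v t) = 0"
  unfolding M_norm_def left_lim_X[OF \<omega> t]
  using bracket_density_axis_zero[OF A_column_sum value_difference_column[OF assms]] t by simp

lemma M_norm_minus: "M_norm A X t \<omega> (- w) = M_norm A X t \<omega> w"
proof -
  have "B *v (- w) = - (B *v w)" for B :: "real ^ 'n ^ 'n"
    using matrix_vector_mult_scaleR[of B "-1" w] by simp
  then show ?thesis by (simp add: M_norm_def)
qed

text \<open>Both orientations are stated because the condition on the driver compares Z with a
  representative, and condition (b) a representative with Z.\<close>

lemma M_equiv_value: "M_equiv P A X {0<..} Z (\<lambda>t \<omega>. v t)"
  and M_equiv_value': "M_equiv P A X {0<..} (\<lambda>t \<omega>. v t) Z"
proof -
  have *: "AE x in Q \<Otimes>\<^sub>M lborel. 0 < snd x \<longrightarrow> M_norm A X (snd x) (fst x) (Z (snd x) (fst x) - v (snd x)) = 0"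
    using AE_value_differences AE_space
  proof eventually_elim
    case (elim x)
    then show ?case
      using M_norm_value[of "fst x" "snd x"] by (auto simp: space_pair_measure)
  qed
  then show "M_equiv P A X {0<..} Z (\<lambda>t \<omega>. v t)"
    by (simp add: M_equiv_def case_prod_beta')
  have "M_norm A X t \<omega> (v t - Z t \<omega>) = M_norm A X t \<omega> (Z t \<omega> - v t)" for t \<omega>
    using M_norm_minus[of t \<omega> "Z t \<omega> - v t"] by simp
  with * show "M_equiv P A X {0<..} (\<lambda>t \<omega>. v t) Z"
    by (simp add: M_equiv_def case_prod_beta')
qed

section \<open>The integral equation for the value\<close>

lemma AE_section:
  assumes "AE x in Q \<Otimes>\<^sub>M lborel. R (fst x) (snd x :: real)"
  shows "AE \<omega> in Q. AE r in lborel. R \<omega> r"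
proof -
  interpret pair: pair_sigma_finite Q lborel ..
  show ?thesis using pair.AE_pair[OF assms] by simp
qed

text \<open>One path is chosen that is regular, holds state \<open>i\<close> on the window and, by
  Fubini, satisfies all the almost-everywhere relations at almost every time. Along it the drift is
  minus \<open>G\<close> outside a null set.\<close>

lemma value_equation_short:
  assumes resp: "AE x in Q \<Otimes>\<^sub>M lborel. 0 < snd x \<longrightarrow>
      (\<forall>y. f (fst x) (snd x) y (Z (snd x) (fst x)) = f (fst x) (snd x) y (v (snd x)))"
    and fg: "AE x in Q \<Otimes>\<^sub>M lborel. 0 < snd x \<longrightarrow>
      f (fst x) (snd x) (Y (snd x) (fst x)) (v (snd x)) = g (X (snd x) (fst x)) (snd x) (Y (snd x) (fst x)) (v (snd x))"
    and s: "0 \<le> s" "0 < s \<or> i = i0" and t: "s \<le> t" "t \<le> s + hold_time"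
  defines "G \<equiv> \<lambda>r. (- (vec_driver g r (v r) + transpose (A r) *v v r)) $ i"
  shows "G absolutely_integrable_on {s..t} \<and> v t $ i = v s $ i + integral {s..t} G"
proof -
  let ?R = "\<lambda>\<omega> r. (0 < r \<longrightarrow> (\<forall>y. f \<omega> r y (Z r \<omega>) = f \<omega> r y (v r))) \<and>
      (0 < r \<longrightarrow> f \<omega> r (Y r \<omega>) (v r) = g (X r \<omega>) r (Y r \<omega>) (v r)) \<and>
      (\<forall>i j. i \<noteq> j \<longrightarrow> (\<omega>, r) \<in> pre_jump_set j \<longrightarrow> rate i j r \<noteq> 0 \<longrightarrow>
         Z r \<omega> \<bullet> (axis i 1 - axis j 1) = v r $ i - v r $ j)"
  have "AE x in Q \<Otimes>\<^sub>M lborel. ?R (fst x) (snd x)"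
    using resp fg AE_value_differences by eventually_elim simp
  then have "AE \<omega> in Q. AE r in lborel. ?R \<omega> r" by (rule AE_section)
  with AE_regular have "AE \<omega> in Q. regular \<omega> \<and> (AE r in lborel. ?R \<omega> r)" by eventually_elim (rule conjI)
  from exists_holding_path[OF s(1) state_positive[OF s] this]
  obtain \<omega> where \<omega>': "\<omega> \<in> space P" "regular \<omega> \<and> (AE r in lborel. ?R \<omega> r)" "state s \<omega> = i"
      "jumps (trajectory \<omega>) \<inter> {s<..s + hold_time} = {}" .
  note \<omega> = \<omega>'(1) conjunct1[OF \<omega>'(2)] conjunct2[OF \<omega>'(2)] \<omega>'(3,4)
  have no_jumps: "jumps (trajectory \<omega>) \<inter> {s<..r} = {}" if "r \<le> t" for r using \<omega>(5) t(2) that by auto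
  have state: "state r \<omega> = i" if "r \<in> {s..t}" for r
    using regular_no_jumps(2)[OF \<omega>(2) s(1) _ no_jumps, of r] that \<omega>(4) by simp
  have Yv: "Y r \<omega> = v r $ i" if "r \<in> {s..t}" for r
    using regularD(2)[OF \<omega>(2), of r] state[OF that] that s(1) by simp
  obtain N where N: "negligible N" "\<And>r. r \<notin> N \<Longrightarrow> ?R \<omega> r"
    using AE_lborel_negligible[OF \<omega>(3)] by blast
  \<comment> \<open>The point \<open>s\<close> is removed because a left limit at \<open>r\<close>
    is controlled only when the path stays in \<open>i\<close> on an interval before
    \<open>r\<close>.\<close>
  have G: "G r = - drift \<omega> r" if r: "r \<in> {s..t} - insert s N" for r
  proof -
    have r': "s < r" "r \<le> t" "0 < r" and R: "?R \<omega> r" using r s(1) N(2)[of r] by auto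
    have "before (trajectory \<omega>) r = i"
      using step_path_before_constant[OF step_path[OF \<omega>(1)] s(1) r'(1)] no_jumps[OF r'(2)] \<omega>(4) by fastforce
    then have 1: "Z r \<omega> \<bullet> compensator_density \<omega> r = v r \<bullet> (A r *v axis i 1)"
      using inner_compensator_density[OF \<omega>(1) r'(3)] R by blast
    \<comment> \<open>The dynamics use the left limit of \<open>Y\<close>, condition (b) uses
      \<open>Y\<close> itself; continuity of the value makes them agree.\<close>
    have "((\<lambda>r. Y r \<omega>) \<longlongrightarrow> v r $ i) (at_left r)"
    proof (rule tendsto_cong[THEN iffD2])
      show "\<forall>\<^sub>F q in at_left r. Y q \<omega> = v q $ i"
        using eventually_at_left_real[OF r'(1)] by eventually_elim (use r' Yv in auto)
      show "((\<lambda>q. v q $ i) \<longlongrightarrow> v r $ i) (at_left r)"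
        using isCont_value[OF r'(3), of i] unfolding isCont_def by (rule tendsto_within_subset) simp
    qed
    then have "left_lim (\<lambda>r. Y r \<omega>) r = v r $ i"
      unfolding left_lim_def by (rule tendsto_Lim[OF trivial_limit_at_left_real])
    \<comment> \<open>The driver agrees at Z and at the value for every \<open>y\<close> outside one
      null set, so the agreement may be used at the random argument
      \<open>Y r \<omega>\<close>.\<close>
    then have "f \<omega> r (left_lim (\<lambda>r. Y r \<omega>) r) (Z r \<omega>) = f \<omega> r (Y r \<omega>) (v r)"
      using R r' Yv[of r] by simp
    also have "\<dots> = g (axis i 1) r (v r $ i) (v r)"
      using R r' Yv[of r] X_eq_axis[of r \<omega>] state[of r] \<omega>(1) by simp
    finally have 2: "f \<omega> r (left_lim (\<lambda>r. Y r \<omega>) r) (Z r \<omega>) = g (axis i 1) r (v r $ i) (v r)" .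
    have "(transpose (A r) *v v r) $ i = v r \<bullet> (A r *v axis i 1)"
      unfolding inner_matrix_axis by (simp add: matrix_vector_mult_def transpose_def mult.commute)
    then show ?thesis
      by (simp add: G_def drift_def vec_driver_def 1 2 inner_axis')
  qed
  have N': "negligible (insert s N)" using N(1) by simp
  have "drift \<omega> absolutely_integrable_on {s..t}"
    by (rule regular_no_jumps(1)[OF \<omega>(2) s(1) t(1) no_jumps[OF order_refl]])
  then have "(\<lambda>r. - drift \<omega> r) absolutely_integrable_on {s..t}"
    using set_integral_uminus by (simp add: set_integrable_def)
  then have "G absolutely_integrable_on {s..t}"
    using N' G by (rule absolutely_integrable_spike)
  moreover have "integral {s..t} G = integral {s..t} (\<lambda>r. - drift \<omega> r)"
    by (rule integral_spike[OF N']) (simp add: G)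
  ultimately show ?thesis
    using regular_no_jumps(3)[OF \<omega>(2) s(1) t(1) no_jumps[OF order_refl]] \<omega>(4) by simp
qed

text \<open>Windows of length \<open>hold_time\<close> are chained by induction on their number.
  Each component and each window may use its own holding path, since the resulting equation mentions
  only deterministic functions.\<close>

lemma value_solves_ode:
  assumes resp: "AE x in Q \<Otimes>\<^sub>M lborel. 0 < snd x \<longrightarrow>
      (\<forall>y. f (fst x) (snd x) y (Z (snd x) (fst x)) = f (fst x) (snd x) y (v (snd x)))"
    and fg: "AE x in Q \<Otimes>\<^sub>M lborel. 0 < snd x \<longrightarrow>
      f (fst x) (snd x) (Y (snd x) (fst x)) (v (snd x)) = g (X (snd x) (fst x)) (snd x) (Y (snd x) (fst x)) (v (snd x))"
  shows "solves_ode i0 (\<lambda>t v. - (vec_driver g t v + transpose (A t) *v v)) v"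
  unfolding solves_ode_def
proof (intro allI impI)
  fix i and s t :: real assume st: "0 \<le> s \<and> s \<le> t \<and> (0 < s \<or> i = i0)"
  let ?G = "\<lambda>r. (- (vec_driver g r (v r) + transpose (A r) *v v r)) $ i"
  have step: "s \<le> t \<Longrightarrow> t \<le> s + real n * hold_time \<Longrightarrow>
      ?G absolutely_integrable_on {s..t} \<and> v t $ i = v s $ i + integral {s..t} ?G" for n t
  proof (induction n arbitrary: t)
    case 0
    then show ?case using value_equation_short[where g = g, OF resp fg, of s i t] st hold_time(1) by simp
  next
    case (Suc n)
    \<comment> \<open>Splits off a last window; the maximum covers the case that less than a whole
      window is left.\<close>
    define m where "m = max s (t - hold_time)"
    have m: "s \<le> m" "m \<le> t" "t \<le> m + hold_time" "m \<le> s + real n * hold_time"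
      using Suc.prems hold_time(1) by (auto simp: m_def max_def algebra_simps)
    have 1: "?G absolutely_integrable_on {s..m}" "v m $ i = v s $ i + integral {s..m} ?G"
      using Suc.IH[OF m(1,4)] by blast+
    have "0 \<le> m" "0 < m \<or> i = i0" using st m(1) by auto
    from value_equation_short[where g = g, OF resp fg this m(2,3)]
    have 2: "?G absolutely_integrable_on {m..t}" "v t $ i = v m $ i + integral {m..t} ?G" by blast+
    have "{s..m} \<union> {m..t} = {s..t}" using m by auto
    with absolutely_integrable_Un[OF 1(1) 2(1)] have 3: "?G absolutely_integrable_on {s..t}" by simp
    moreover have "integral {s..m} ?G + integral {m..t} ?G = integral {s..t} ?G"
      by (rule Henstock_Kurzweil_Integration.integral_combine[OF m(1,2) set_lebesgue_integral_eq_integral(1)[OF 3]])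
    ultimately show ?case using 1(2) 2(2) by simp
  qed
  obtain n :: nat where "(t - s) / hold_time \<le> real n" using real_arch_simple by blast
  then have "t \<le> s + real n * hold_time" using hold_time(1) by (simp add: field_simps)
  with step[of t n] st show "?G absolutely_integrable_on {s..t} \<and> v t $ i = v s $ i + integral {s..t} ?G"
    by blast
qed

end

theorem corollary1:
  fixes P :: "'a measure"
    and X :: "real \<Rightarrow> 'a \<Rightarrow> real ^ 'n"
    and A :: "real \<Rightarrow> real ^ 'n ^ 'n"
    and i0 :: 'n
    and f :: "'a \<Rightarrow> real \<Rightarrow> real \<Rightarrow> real ^ 'n \<Rightarrow> real"
    and g :: "real ^ 'n \<Rightarrow> real \<Rightarrow> real \<Rightarrow> real ^ 'n \<Rightarrow> real"
    and Y :: "real \<Rightarrow> 'a \<Rightarrow> real"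
    and Z :: "real \<Rightarrow> 'a \<Rightarrow> real ^ 'n"
    and u :: "real \<Rightarrow> real ^ 'n \<Rightarrow> real"
  assumes chain: "rate_markov_chain P X A i0"
    and positive: "\<And>t i. 0 < t \<Longrightarrow> measure P {\<omega> \<in> space P. X t \<omega> = axis i 1} > 0"
    and driver: "progressive_driver P X f" "driver_respects_M_equiv P A X f"
    and dynamics: "\<And>T. 0 < T \<Longrightarrow> solution P A X f T Y Z"
    and unique: "unique_forward P A X f Y Z \<or> unique_backward P A X f Y Z"
    and cond_a: "markovian P X Y u"
    and cond_b: "deterministic_integrand P A X i0 f g Y Z"
  shows "solves_ode i0 (\<lambda>t v. - (vec_driver g t v + transpose (A t) *v v)) (vec_of_fun u)"
proof -
  interpret rate_markov_chain P X A i0 by (rule chain)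
  interpret markovian_solution P X A i0 f Y Z u
    by standard (use positive dynamics cond_a in auto)
  show ?thesis
  proof (rule value_solves_ode)
    show "AE x in Q \<Otimes>\<^sub>M lborel. 0 < snd x \<longrightarrow>
        (\<forall>y. f (fst x) (snd x) y (Z (snd x) (fst x)) = f (fst x) (snd x) y (v (snd x)))"
      using driver(2) Z_predictable value_predictable M_equiv_value
      by (auto simp: driver_respects_M_equiv_def case_prod_beta')
    \<comment> \<open>Condition (b) is used at the representative given by the value itself, which
      is predictable and equivalent to Z.\<close>
    show "AE x in Q \<Otimes>\<^sub>M lborel. 0 < snd x \<longrightarrow>
        f (fst x) (snd x) (Y (snd x) (fst x)) (v (snd x)) = g (X (snd x) (fst x)) (snd x) (Y (snd x) (fst x)) (v (snd x))"
      using cond_b value_predictable M_equiv_value'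
      by (auto simp: deterministic_integrand_def case_prod_beta')
  qed
qed

end
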